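(* Let $(A,\Lambda)$ be any associative form ring, let $(I,\Gamma)$ and $(J,\Delta)$ be two form ideals of $(A,\Lambda)$, and let $n\ge 3$. Then the mixed commutator subgroup $[\operatorname{FU}(2n,I,\Gamma),\operatorname{FU}(2n,J,\Delta)]$ is normal in $\operatorname{EU}(2n,A,\Lambda)$. Furthermore, $$[\operatorname{FU}(2n,I,\Gamma),\operatorname{FU}(2n,J,\Delta)]=[\operatorname{EU}(2n,I,\Gamma),\operatorname{EU}(2n,J,\Delta)].$$
   Context: Form rings. $A$ is an associative ring with $1$ with an involution $a\mapsto\bar a$ (additive, $\overline{ab}=\bar b\,\bar a$, $\bar{\bar a}=a$), and $\lambda\in\operatorname{Cent}(A)$ is fixed with $\lambda\bar\lambda=1$. Put $\Lambda_{\min}=\{c-\lambda\bar c\mid c\in A\}$, $\Lambda_{\max}=\{c\in A\mid c=-\lambda\bar c\}$. A form parameter $\Lambda$ is an additive subgroup with $\Lambda_{\min}\subseteq\Lambda\subseteq\Lambda_{\max}$ and $c\Lambda\bar c\subseteq\Lambda$ for all $c\in A$; then $(A,\Lambda)$ is a form ring. Form ideals. For a two-sided ideal $I$ with $\bar I=I$ put $\Gamma_{\max}(I)=I\cap\Lambda$ and $\Gamma_{\min}(I)=\{a-\lambda\bar a\mid a\in I\}+\langle ac\bar a\mid a\in I,c\in\Lambda\rangle$ ($\langle\cdot\rangle$ = additive subgroup generated). A form ideal $(I,\Gamma)$ consists of such an $I$ and an additive subgroup $\Gamma$ with $\Gamma_{\min}(I)\subseteq\Gamma\subseteq\Gamma_{\max}(I)$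 and $c\Gamma\bar c\subseteq\Gamma$ for all $c\in A$. Elementary transvections. $\Omega=\{1,\dots,n,-n,\dots,-1\}$ indexes rows and columns of $2n\times 2n$ matrices; $\varepsilon(i)$ is the sign of $i$. For $i\ne\pm j$, $c\in A$: $T_{ij}(c)=e+ce_{ij}-\lambda^{(\varepsilon(j)-\varepsilon(i))/2}\bar c\,e_{-j,-i}$. For $c\in\lambda^{-(\varepsilon(i)+1)/2}\Lambda$: $T_{i,-i}(c)=e+ce_{i,-i}$. For a form ideal write $(I,\Gamma)_{ij}=I$ if $i\ne\pm j$ and $(I,\Gamma)_{i,-i}=\lambda^{-(\varepsilon(i)+1)/2}\Gamma$. $\operatorname{EU}(2n,A,\Lambda)$ is generated by all $T_{ij}(c)$, $c\in(A,\Lambda)_{ij}$; $\operatorname{FU}(2n,I,\Gamma)$ is generated by all $T_{ij}(a)$, $a\in(I,\Gamma)_{ij}$; $\operatorname{EU}(2n,I,\Gamma)$ is the normal closure of $\operatorname{FU}(2n,I,\Gamma)$ in $\operatorname{EU}(2n,A,\Lambda)$. For subgroups $H,K$, $[H,K]$ is the subgroup generated by all $[x,y]=xyx^{-1}y^{-1}$, $x\in H$, $y\in K$. *)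

theory Defs
  imports
    "Jordan_Normal_Form.Matrix"
    "HOL-Algebra.Generated_Groups"
    "HOL-Computational_Algebra.Group_Closure"
begin

(* The coefficient ring is the whole of a type of sort {ring, monoid_mult}, that is, an
   associative ring with 1.  Unlike ring_1, this sort does not exclude the zero ring. *)

definition add_subgroup :: "'a::ab_group_add set \<Rightarrow> bool" where
  "add_subgroup S \<longleftrightarrow>
     0 \<in> S \<and> (\<forall>x\<in>S. \<forall>y\<in>S. x + y \<in> S) \<and> (\<forall>x\<in>S. - x \<in> S)"

definition two_sided_ideal :: "'a::ring set \<Rightarrow> bool" where
  "two_sided_ideal I \<longleftrightarrow> add_subgroup I \<and> (\<forall>a. \<forall>x\<in>I. a * x \<in> I \<and> x * a \<in> I)"

definition Lambda_min :: "('a::ring \<Rightarrow> 'a) \<Rightarrow> 'a \<Rightarrow> 'a set" where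
  "Lambda_min bar lam = {c - lam * bar c | c. True}"

definition Lambda_max :: "('a::ring \<Rightarrow> 'a) \<Rightarrow> 'a \<Rightarrow> 'a set" where
  "Lambda_max bar lam = {c. c = - (lam * bar c)}"

locale form_ring =
  fixes bar :: "'a::{ring,monoid_mult} \<Rightarrow> 'a"
    and lam :: 'a
    and Lam :: "'a set"
  assumes bar_add: "bar (a + b) = bar a + bar b"
    and bar_mult: "bar (a * b) = bar b * bar a"
    and bar_bar: "bar (bar a) = a"
    and lam_central: "lam * a = a * lam"
    and lam_bar: "lam * bar lam = 1"
    and Lam_subgroup: "add_subgroup Lam"
    and Lam_lower: "Lambda_min bar lam \<subseteq> Lam"
    and Lam_upper: "Lam \<subseteq> Lambda_max bar lam"
    and Lam_conj: "x \<in> Lam \<Longrightarrow> c * x * bar c \<in> Lam"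

definition Gamma_max :: "'a set \<Rightarrow> 'a set \<Rightarrow> 'a set" where
  "Gamma_max Lam I = I \<inter> Lam"

definition Gamma_min :: "('a::ring \<Rightarrow> 'a) \<Rightarrow> 'a \<Rightarrow> 'a set \<Rightarrow> 'a set \<Rightarrow> 'a set" where
  "Gamma_min bar lam Lam I =
     {x + y | x y. x \<in> {a - lam * bar a | a. a \<in> I} \<and>
                   y \<in> group_closure {a * c * bar a | a c. a \<in> I \<and> c \<in> Lam}}"

locale form_ideal = form_ring bar lam Lam
  for bar :: "'a::{ring,monoid_mult} \<Rightarrow> 'a" and lam :: 'a and Lam :: "'a set" +
  fixes I :: "'a set"
    and Gam :: "'a set"
  assumes ideal: "two_sided_ideal I"
    and ideal_bar: "bar ` I = I"
    and Gam_subgroup: "add_subgroup Gam"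
    and Gam_lower: "Gamma_min bar lam Lam I \<subseteq> Gam"
    and Gam_upper: "Gam \<subseteq> Gamma_max Lam I"
    and Gam_conj: "x \<in> Gam \<Longrightarrow> c * x * bar c \<in> Gam"

definition Omega :: "nat \<Rightarrow> int set" where
  "Omega n = {1..int n} \<union> {- int n..-1}"

(* Position (from 0) of a signed index in the order 1, ..., n, -n, ..., -1. *)
definition pos :: "nat \<Rightarrow> int \<Rightarrow> nat" where
  "pos n i = (if 0 < i then nat (i - 1) else nat (2 * int n + i))"

definition mat_unit :: "nat \<Rightarrow> int \<Rightarrow> int \<Rightarrow> 'a::{zero,one} mat" where
  "mat_unit n i j = mat (2 * n) (2 * n) (\<lambda>(r, s). if r = pos n i \<and> s = pos n j then 1 else 0)"

(* Integer powers of lam; in a form ring the inverse of lam is bar lam. *)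
definition lam_pow :: "('a::monoid_mult \<Rightarrow> 'a) \<Rightarrow> 'a \<Rightarrow> int \<Rightarrow> 'a" where
  "lam_pow bar lam k = (if 0 \<le> k then lam ^ nat k else bar lam ^ nat (- k))"

(* Both divisions by 2 below, here and in entry_set, are exact for signed indices. *)
definition transvection ::
    "('a::{ring,monoid_mult} \<Rightarrow> 'a) \<Rightarrow> 'a \<Rightarrow> nat \<Rightarrow> int \<Rightarrow> int \<Rightarrow> 'a \<Rightarrow> 'a mat" where
  "transvection bar lam n i j c =
     (if j = - i then 1\<^sub>m (2 * n) + c \<cdot>\<^sub>m mat_unit n i (- i)
      else 1\<^sub>m (2 * n) + c \<cdot>\<^sub>m mat_unit n i j
             - (lam_pow bar lam ((sgn j - sgn i) div 2) * bar c) \<cdot>\<^sub>m mat_unit n (- j) (- i))"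

definition entry_set ::
    "('a::{ring,monoid_mult} \<Rightarrow> 'a) \<Rightarrow> 'a \<Rightarrow> 'a set \<Rightarrow> 'a set \<Rightarrow> int \<Rightarrow> int \<Rightarrow> 'a set" where
  "entry_set bar lam I Gam i j =
     (if j = - i then {lam_pow bar lam (- ((sgn i + 1) div 2)) * g | g. g \<in> Gam} else I)"

(* The group of invertible 2n x 2n matrices; ring_mat is not usable, since it requires
   semiring_1 and hence 0 \<noteq> 1. *)
definition GL :: "nat \<Rightarrow> 'a::{ring,monoid_mult} mat monoid" where
  "GL n = units_of \<lparr>carrier = carrier_mat (2 * n) (2 * n), mult = (*), one = 1\<^sub>m (2 * n)\<rparr>"

definition FU ::
    "('a::{ring,monoid_mult} \<Rightarrow> 'a) \<Rightarrow> 'a \<Rightarrow> nat \<Rightarrow> 'a set \<Rightarrow> 'a set \<Rightarrow> 'a mat set" where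
  "FU bar lam n I Gam =
     generate (GL n) {transvection bar lam n i j c | i j c.
       i \<in> Omega n \<and> j \<in> Omega n \<and> i \<noteq> j \<and> c \<in> entry_set bar lam I Gam i j}"

definition EU ::
    "('a::{ring,monoid_mult} \<Rightarrow> 'a) \<Rightarrow> 'a \<Rightarrow> 'a set \<Rightarrow> nat \<Rightarrow> 'a mat set" where
  "EU bar lam Lam n = FU bar lam n UNIV Lam"

abbreviation EU_group ::
    "('a::{ring,monoid_mult} \<Rightarrow> 'a) \<Rightarrow> 'a \<Rightarrow> 'a set \<Rightarrow> nat \<Rightarrow> 'a mat monoid" where
  "EU_group bar lam Lam n \<equiv> (GL n)\<lparr>carrier := EU bar lam Lam n\<rparr>"

definition normal_closure :: "('g, 'm) monoid_scheme \<Rightarrow> 'g set \<Rightarrow> 'g set" where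
  "normal_closure G S = \<Inter> {N. N \<lhd> G \<and> S \<subseteq> N}"

definition EU_rel ::
    "('a::{ring,monoid_mult} \<Rightarrow> 'a) \<Rightarrow> 'a \<Rightarrow> 'a set \<Rightarrow> nat \<Rightarrow> 'a set \<Rightarrow> 'a set \<Rightarrow> 'a mat set" where
  "EU_rel bar lam Lam n I Gam = normal_closure (EU_group bar lam Lam n) (FU bar lam n I Gam)"

definition mixed_commutator :: "('g, 'm) monoid_scheme \<Rightarrow> 'g set \<Rightarrow> 'g set \<Rightarrow> 'g set" where
  "mixed_commutator G H K =
     generate G {x \<otimes>\<^bsub>G\<^esub> y \<otimes>\<^bsub>G\<^esub> inv\<^bsub>G\<^esub> x \<otimes>\<^bsub>G\<^esub> inv\<^bsub>G\<^esub> y | x y. x \<in> H \<and> y \<in> K}"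

end

theory Submission
  imports Defs
begin

text \<open>
  Write \<open>E\<close> for the elementary unitary group, \<open>F\<close> and \<open>K\<close> for the elementary subgroups of the two form
  ideals and \<open>H = [F, K]\<close>. The proof uses nothing about matrices except the unitary Steinberg
  relations, which express commutators of root elements through root elements; from them, it is shown
  that \<open>H\<close> is central in \<open>E\<close> modulo a normal subgroup that it contains.

  \<^item> The two opposite Siegel parabolics have abelian unipotent radicals \<open>U\<close> and \<open>U\<^sup>-\<close>. For every
    form ideal, the conjugates by \<open>U\<close> of the elements of \<open>U\<^sup>-\<close> with coefficients in the form ideal
    generate the same group as the conjugates by \<open>U\<^sup>-\<close> of such elements of \<open>U\<close>, and therefore
    generate the relative elementary group (\<open>unipotent_conjugates_normal\<close>). Because \<open>U\<close> is abelian, a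
    subgroup contains all these conjugates as soon as it contains the elementary subgroup and the root
    elements conjugated by their opposite root subgroups (\<open>conj_by_unipotent_in\<close>).

  \<^item> The two form ideals have a symmetrised product, which is a form ideal again (\<open>level_prod\<close>). Let \<open>N\<close> be
    its relative elementary group. A root element for \<open>\<alpha>\<close> with coefficient in the product is built from
    commutators of elements of \<open>F\<close> and \<open>K\<close> for roots other than \<open>\<alpha>\<close>, and conjugation by the root subgroup of
    \<open>-\<alpha>\<close> does not take such elements out of \<open>F\<close> and \<open>K\<close>. By the preceding criterion, \<open>N\<close> lies in \<open>H\<close>.

  \<^item> Modulo \<open>N\<close>, root elements of \<open>F\<close> and \<open>K\<close> commute unless their roots are opposite. The commutators for
    opposite roots \<open>\<alpha>\<close> and \<open>-\<alpha>\<close> are central in \<open>E\<close> modulo \<open>N\<close>: every root subgroup for \<open>\<gamma> \<noteq> \<plusminus>\<alpha>\<close>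
    centralises them, by choosing a linear functional that vanishes on \<open>\<alpha>\<close> and is positive on \<open>\<gamma>\<close>, and
    these root subgroups generate \<open>E\<close>. So \<open>H\<close> is central modulo \<open>N\<close>, hence normal.

  \<^item> Modulo \<open>H\<close>, the groups \<open>F\<close> and \<open>K\<close> commute. Describing the normal closure of \<open>F\<close> by conjugates of
    \<open>U\<^sup>-\<close> under \<open>U\<close> and that of \<open>K\<close> by conjugates of \<open>U\<close> under \<open>U\<^sup>-\<close> shows that the normal closures
    commute modulo \<open>H\<close> as well, since \<open>U\<close> commutes with itself.
\<close>

section \<open>Commutators and conjugation in a group\<close>

context group
begin

definition conj_by :: "'a \<Rightarrow> 'a \<Rightarrow> 'a" where
  "conj_by g x = g \<otimes> x \<otimes> inv g"

definition commutator :: "'a \<Rightarrow> 'a \<Rightarrow> 'a" where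
  "commutator x y = x \<otimes> y \<otimes> inv x \<otimes> inv y"

lemma mult_inv_cancel_left [simp]:
  assumes "x \<in> carrier G" "y \<in> carrier G"
  shows "x \<otimes> (inv x \<otimes> y) = y" "inv x \<otimes> (x \<otimes> y) = y"
  using assms by (simp_all add: m_assoc [symmetric])

lemmas group_word_simps = conj_by_def commutator_def m_assoc inv_mult_group

lemma conj_by_closed [simp]:
  "g \<in> carrier G \<Longrightarrow> x \<in> carrier G \<Longrightarrow> conj_by g x \<in> carrier G"
  by (simp add: conj_by_def)

lemma commutator_closed [simp]:
  "x \<in> carrier G \<Longrightarrow> y \<in> carrier G \<Longrightarrow> commutator x y \<in> carrier G"
  by (simp add: commutator_def)

lemma conj_by_one [simp]: "x \<in> carrier G \<Longrightarrow> conj_by \<one> x = x"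
  by (simp add: conj_by_def)

lemma conj_by_mult:
  "\<lbrakk>g \<in> carrier G; x \<in> carrier G; y \<in> carrier G\<rbrakk> \<Longrightarrow>
     conj_by g (x \<otimes> y) = conj_by g x \<otimes> conj_by g y"
  by (simp add: group_word_simps)

lemma conj_by_inv:
  "\<lbrakk>g \<in> carrier G; x \<in> carrier G\<rbrakk> \<Longrightarrow> conj_by g (inv x) = inv (conj_by g x)"
  by (simp add: group_word_simps)

lemma conj_by_conj_by:
  "\<lbrakk>g \<in> carrier G; h \<in> carrier G; x \<in> carrier G\<rbrakk> \<Longrightarrow>
     conj_by g (conj_by h x) = conj_by (g \<otimes> h) x"
  by (simp add: group_word_simps)

lemma conj_by_commutator:
  "\<lbrakk>g \<in> carrier G; x \<in> carrier G; y \<in> carrier G\<rbrakk> \<Longrightarrow>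
     conj_by g (commutator x y) = commutator (conj_by g x) (conj_by g y)"
  by (simp add: group_word_simps)

lemma conj_by_eq_commutator_mult:
  "\<lbrakk>g \<in> carrier G; x \<in> carrier G\<rbrakk> \<Longrightarrow> conj_by g x = commutator g x \<otimes> x"
  by (simp add: group_word_simps)

lemma commutator_eq_mult_conj_by:
  "\<lbrakk>x \<in> carrier G; y \<in> carrier G\<rbrakk> \<Longrightarrow> commutator x y = x \<otimes> conj_by y (inv x)"
  by (simp add: group_word_simps)

lemma inv_commutator:
  "\<lbrakk>x \<in> carrier G; y \<in> carrier G\<rbrakk> \<Longrightarrow> inv (commutator x y) = commutator y x"
  by (simp add: group_word_simps)

lemma commutator_eq_one_iff:
  assumes "x \<in> carrier G" "y \<in> carrier G"
  shows "commutator x y = \<one> \<longleftrightarrow> x \<otimes> y = y \<otimes> x"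
proof -
  have "commutator x y = (x \<otimes> y) \<otimes> inv (y \<otimes> x)"
    using assms by (simp add: group_word_simps)
  then show ?thesis
    using assms by (metis inv_equality inv_inv m_closed r_inv inv_closed)
qed

lemma commutatorI:
  assumes "x \<in> carrier G" "y \<in> carrier G" "z \<in> carrier G"
    and "x \<otimes> y = z \<otimes> (y \<otimes> x)"
  shows "commutator x y = z"
proof -
  have "commutator x y = (x \<otimes> y) \<otimes> inv (y \<otimes> x)"
    using assms(1,2) by (simp add: group_word_simps)
  also have "\<dots> = z"
    using assms by (simp add: m_assoc)
  finally show ?thesis .
qed

lemma conj_by_eq_self_iff:
  assumes "x \<in> carrier G" "y \<in> carrier G"
  shows "conj_by x y = y \<longleftrightarrow> x \<otimes> y = y \<otimes> x"
  using assms by (metis conj_by_def inv_solve_right m_closed)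

lemma conj_by_in_normal:
  assumes "N \<lhd> G" "g \<in> carrier G" "x \<in> N"
  shows "conj_by g x \<in> N"
  using assms normal_inv_iff by (simp add: conj_by_def)

lemma subgroup_conj_by_vimage:
  assumes "subgroup X G" "g \<in> carrier G"
  shows "subgroup {x \<in> carrier G. conj_by g x \<in> X} G"
  using assms
  by (intro subgroupI)
    (auto simp: conj_by_mult conj_by_inv subgroup.m_closed subgroup.m_inv_closed
      intro!: exI [of _ \<one>], auto simp: conj_by_def subgroup.one_closed)

lemma conj_by_generate_subset:
  assumes "S \<subseteq> carrier G" "subgroup X G" "g \<in> carrier G"
    and "\<And>s. s \<in> S \<Longrightarrow> conj_by g s \<in> X" and "x \<in> generate G S"
  shows "conj_by g x \<in> X"
proof -
  have "generate G S \<subseteq> {x \<in> carrier G. conj_by g x \<in> X}"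
    using assms by (intro generate_subgroup_incl subgroup_conj_by_vimage) auto
  with assms show ?thesis by auto
qed

lemma conj_by_generate_closed:
  assumes "S \<subseteq> carrier G" "X \<subseteq> carrier G"
    and inv: "\<And>s. s \<in> S \<Longrightarrow> inv s \<in> S"
    and step: "\<And>s x. s \<in> S \<Longrightarrow> x \<in> X \<Longrightarrow> conj_by s x \<in> X"
    and "g \<in> generate G S" "x \<in> X"
  shows "conj_by g x \<in> X"
  using assms(5,6)
proof (induction g arbitrary: x rule: generate.induct)
  case one
  then show ?case using assms(2) by auto
next
  case (incl h)
  then show ?case using step by auto
next
  case (inv h)
  then show ?case using step assms(3) by auto
next
  case (eng g h)
  have "g \<in> carrier G" "h \<in> carrier G"
    using eng.hyps assms(1) generate_in_carrier by auto
  then have "conj_by (g \<otimes> h) x = conj_by g (conj_by h x)"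
    using eng.prems assms(2) by (subst conj_by_conj_by) auto
  then show ?case using eng by auto
qed

text \<open>
  Commuting modulo a normal subgroup is tested on generators, because the elements that commute
  with a given one modulo \<open>N\<close> form a subgroup: the preimage of a centraliser in the quotient.
\<close>

lemma subgroup_centralizer_mod:
  assumes N: "N \<lhd> G" and S: "S \<subseteq> carrier G"
  shows "subgroup {x \<in> carrier G. \<forall>s\<in>S. commutator x s \<in> N} G"
proof (rule subgroupI)
  have sub: "subgroup N G" using N normal_imp_subgroup by auto
  show "{x \<in> carrier G. \<forall>s\<in>S. commutator x s \<in> N} \<noteq> {}"
    using S sub by (auto intro!: exI [of _ \<one>] simp: commutator_def subgroup.one_closed subset_iff)
  fix a assume "a \<in> {x \<in> carrier G. \<forall>s\<in>S. commutator x s \<in> N}"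
  then have a: "a \<in> carrier G" "\<And>s. s \<in> S \<Longrightarrow> commutator a s \<in> N" by auto
  have "commutator (inv a) s \<in> N" if "s \<in> S" for s
  proof -
    have "commutator (inv a) s = conj_by (inv a) (inv (commutator a s))"
      using a that S by (auto simp: group_word_simps subset_iff)
    then show ?thesis
      using a that N sub by (simp add: conj_by_in_normal subgroup.m_inv_closed)
  qed
  then show "inv a \<in> {x \<in> carrier G. \<forall>s\<in>S. commutator x s \<in> N}" using a by auto
  fix b assume "b \<in> {x \<in> carrier G. \<forall>s\<in>S. commutator x s \<in> N}"
  then have b: "b \<in> carrier G" "\<And>s. s \<in> S \<Longrightarrow> commutator b s \<in> N" by auto
  have "commutator (a \<otimes> b) s \<in> N" if "s \<in> S" for s
  proof -
    have "commutator (a \<otimes> b) s = conj_by a (commutator b s) \<otimes> commutator a s"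
      using a b that S by (auto simp: group_word_simps subset_iff)
    then show ?thesis
      using a b that N sub by (simp add: conj_by_in_normal subgroup.m_closed)
  qed
  then show "a \<otimes> b \<in> {x \<in> carrier G. \<forall>s\<in>S. commutator x s \<in> N}" using a b by auto
qed auto

lemma commutator_generate_mod:
  assumes N: "N \<lhd> G" and S: "S \<subseteq> carrier G" and T: "T \<subseteq> carrier G"
    and st: "\<And>s t. s \<in> S \<Longrightarrow> t \<in> T \<Longrightarrow> commutator s t \<in> N"
    and x: "x \<in> generate G S" and y: "y \<in> generate G T"
  shows "commutator x y \<in> N"
proof -
  have sub: "subgroup N G" using N normal_imp_subgroup by auto
  have swap: "commutator b a \<in> N" if "commutator a b \<in> N" "a \<in> carrier G" "b \<in> carrier G" for a b
    using that sub inv_commutator [of a b] subgroup.m_inv_closed [of N G] by metis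
  have "generate G S \<subseteq> {x \<in> carrier G. \<forall>t\<in>T. commutator x t \<in> N}"
    using S T st by (intro generate_subgroup_incl subgroup_centralizer_mod N) auto
  with x have x': "x \<in> carrier G" "\<And>t. t \<in> T \<Longrightarrow> commutator x t \<in> N" by auto
  have "generate G T \<subseteq> {y \<in> carrier G. \<forall>s\<in>{x}. commutator y s \<in> N}"
    using x' T swap by (intro generate_subgroup_incl subgroup_centralizer_mod N) (auto simp: subset_iff)
  with y x' swap show ?thesis by auto
qed

lemma commute_generate:
  assumes S: "S \<subseteq> carrier G" and T: "T \<subseteq> carrier G"
    and st: "\<And>s t. s \<in> S \<Longrightarrow> t \<in> T \<Longrightarrow> s \<otimes> t = t \<otimes> s"
    and x: "x \<in> generate G S" and y: "y \<in> generate G T"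
  shows "x \<otimes> y = y \<otimes> x"
proof -
  have "commutator x y \<in> {\<one>}"
    by (rule commutator_generate_mod [OF one_is_normal S T _ x y])
      (use S T st in \<open>auto simp: commutator_eq_one_iff subset_iff\<close>)
  then show ?thesis
    using x y S T generate_in_carrier commutator_eq_one_iff by auto
qed

lemma commute_inv_right:
  assumes "x \<in> carrier G" "y \<in> carrier G" "x \<otimes> y = y \<otimes> x"
  shows "x \<otimes> inv y = inv y \<otimes> x"
  using assms by (metis inv_closed inv_solve_left inv_solve_right m_assoc m_closed)

text \<open>
  Write \<open>f = [g,x]\<close> and \<open>k = [g,z]\<close>, so that \<open>g\<close> carries \<open>[x,z]\<close> to \<open>[fx,kz]\<close>. As \<open>k\<close> commutes with \<open>fx\<close>
  and \<open>f\<close> with \<open>z\<close>, this is the conjugate of \<open>[x,z]\<close> by \<open>kf\<close>. Moreover \<open>f\<close> centralises \<open>[x,z]\<close> because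
  \<open>[x\<^sup>-\<^sup>1,g]\<close>, the conjugate of \<open>f\<close> by \<open>x\<^sup>-\<^sup>1\<close>, commutes with \<open>z\<close>; likewise for \<open>k\<close>.
\<close>

lemma commutator_centralized:
  assumes carr: "g \<in> carrier G" "x \<in> carrier G" "z \<in> carrier G"
    and fz: "commutator (commutator g x) z = \<one>"
    and fk: "commutator (commutator g x) (commutator g z) = \<one>"
    and xk: "commutator x (commutator g z) = \<one>"
    and f'z: "commutator (commutator (inv x) g) z = \<one>"
    and xk': "commutator x (commutator (inv z) g) = \<one>"
  shows "commutator g (commutator x z) = \<one>"
proof -
  define f k y where "f = commutator g x" and "k = commutator g z" and "y = commutator x z"
  define f' k' where "f' = commutator (inv x) g" and "k' = commutator (inv z) g"
  have c: "f \<in> carrier G" "k \<in> carrier G" "y \<in> carrier G" "f' \<in> carrier G" "k' \<in> carrier G"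
    using carr by (simp_all add: f_def k_def y_def f'_def k'_def)
  have e: "f \<otimes> z = z \<otimes> f" "f \<otimes> k = k \<otimes> f" "x \<otimes> k = k \<otimes> x" "f' \<otimes> z = z \<otimes> f'" "x \<otimes> k' = k' \<otimes> x"
    using assms c unfolding f_def [symmetric] k_def [symmetric] f'_def [symmetric] k'_def [symmetric]
    by (simp_all add: commutator_eq_one_iff)
  have f_eq: "f = conj_by x f'" and k_eq: "k = conj_by z k'"
    using carr by (simp_all add: f_def f'_def k_def k'_def group_word_simps)
  \<comment> \<open>Conjugating \<open>f\<close>, and likewise \<open>k\<close>, by \<open>z\<^sup>-\<^sup>1\<close>, \<open>x\<^sup>-\<^sup>1\<close>, \<open>z\<close>, \<open>x\<close> in turn brings it back.\<close>
  have "conj_by y f = conj_by x (conj_by z (conj_by (inv x) (conj_by (inv z) f)))"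
    using carr c by (simp add: y_def group_word_simps)
  also have "conj_by (inv z) f = f"
    using carr c e(1) by (subst conj_by_eq_self_iff) (auto simp: commute_inv_right)
  also have "conj_by (inv x) f = f'"
    using carr c unfolding f_eq by (simp add: group_word_simps)
  also have "conj_by z f' = f'"
    using carr c e(4) by (subst conj_by_eq_self_iff) auto
  finally have yf: "y \<otimes> f = f \<otimes> y"
    using f_eq c by (simp add: conj_by_eq_self_iff)
  have "conj_by y k = conj_by x (conj_by z (conj_by (inv x) (conj_by (inv z) k)))"
    using carr c by (simp add: y_def group_word_simps)
  also have "conj_by (inv z) k = k'"
    using carr c unfolding k_eq by (simp add: group_word_simps)
  also have "conj_by (inv x) k' = k'"
    using carr c e(5) by (subst conj_by_eq_self_iff) (auto simp: commute_inv_right)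
  also have "conj_by z k' = k" by (simp add: k_eq)
  also have "conj_by x k = k"
    using carr c e(3) by (subst conj_by_eq_self_iff) auto
  finally have yk: "y \<otimes> k = k \<otimes> y"
    using c by (simp add: conj_by_eq_self_iff)
  have "conj_by g y = commutator (conj_by g x) (conj_by g z)"
    unfolding y_def by (rule conj_by_commutator) (use carr in auto)
  also have "conj_by g x = f \<otimes> x"
    using carr by (simp add: f_def conj_by_eq_commutator_mult)
  also have "conj_by g z = k \<otimes> z"
    using carr by (simp add: k_def conj_by_eq_commutator_mult)
  also have "commutator (f \<otimes> x) (k \<otimes> z) = conj_by k (conj_by f y)"
  proof (rule commutatorI)
    have "(f \<otimes> x) \<otimes> (k \<otimes> z) = k \<otimes> (f \<otimes> (x \<otimes> z))"
      using carr c e(2,3) by (metis m_assoc m_closed)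
    also have "x \<otimes> z = y \<otimes> (z \<otimes> x)"
      using carr by (simp add: y_def group_word_simps)
    also have "f \<otimes> (y \<otimes> (z \<otimes> x)) = conj_by f y \<otimes> (f \<otimes> (z \<otimes> x))"
      using carr c by (simp add: group_word_simps)
    also have "f \<otimes> (z \<otimes> x) = z \<otimes> (f \<otimes> x)"
      using carr c e(1) by (metis m_assoc)
    also have "k \<otimes> (conj_by f y \<otimes> (z \<otimes> (f \<otimes> x))) = conj_by k (conj_by f y) \<otimes> (k \<otimes> z \<otimes> (f \<otimes> x))"
      using carr c by (simp add: group_word_simps)
    finally show "f \<otimes> x \<otimes> (k \<otimes> z) = conj_by k (conj_by f y) \<otimes> (k \<otimes> z \<otimes> (f \<otimes> x))" .
  qed (use carr c in auto)
  also have "conj_by f y = y"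
    using c yf by (subst conj_by_eq_self_iff) auto
  also have "conj_by k y = y"
    using c yk by (subst conj_by_eq_self_iff) auto
  finally show ?thesis
    using carr c unfolding y_def [symmetric] by (simp add: conj_by_eq_self_iff commutator_eq_one_iff)
qed

end

section \<open>Coefficients and form ideals\<close>

context form_ring
begin

lemma bar_zero [simp]: "bar 0 = 0"
  using bar_add [of 0 0] by simp

lemma bar_minus [simp]: "bar (- a) = - bar a"
  using bar_add [of a "- a"] by (simp add: eq_neg_iff_add_eq_0 add.commute)

lemma bar_diff: "bar (a - b) = bar a - bar b"
  using bar_add [of a "- b"] by simp

lemma bar_one [simp]: "bar 1 = 1"
  using bar_mult [of "bar 1" 1] by (simp add: bar_bar)

lemma bar_lam_central: "bar lam * a = a * bar lam"
  using arg_cong [OF lam_central [of "bar a"], of bar] by (simp add: bar_mult bar_bar)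

lemma bar_lam_lam: "bar lam * lam = 1"
  using lam_bar lam_central [of "bar lam"] by simp

lemma lam_cancel [simp]:
  "lam * (bar lam * a) = a" "bar lam * (lam * a) = a" "lam * bar lam = 1" "bar lam * lam = 1"
  by (simp_all add: lam_bar bar_lam_lam flip: mult.assoc)

text \<open>
  Writing \<open>\<lambda>\<^sub>i\<close> for \<open>\<lambda>\<close> when \<open>i > 0\<close> and for \<open>1\<close> when \<open>i < 0\<close> splits the powers of \<open>\<lambda>\<close> that occur in
  transvections as \<open>\<lambda>\<^sub>j \<lambda>\<^sub>i\<^sup>-\<^sup>1\<close>, and makes \<open>\<lambda>\<^sub>i\<^sup>-\<^sup>1 \<Gamma>\<close> the coefficients of the long root \<open>(i, -i)\<close>.
\<close>

definition lam_at :: "int \<Rightarrow> 'a" where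
  "lam_at i = (if 0 < i then lam else 1)"

text \<open>
  If the adjoint of matrices with respect to the hermitian form is denoted by a star, then
  \<open>(c e\<^sub>i\<^sub>j)\<^sup>* = twist i j c e\<^sub>-\<^sub>j\<^sub>,\<^sub>-\<^sub>i\<close>. Hence the twist is an anti-involution compatible with composition of
  indices.
\<close>

definition twist :: "int \<Rightarrow> int \<Rightarrow> 'a \<Rightarrow> 'a" where
  "twist i j c = lam_at j * bar (lam_at i) * bar c"

lemma lam_at_central: "lam_at i * a = a * lam_at i"
  by (simp add: lam_at_def lam_central)

lemma bar_lam_at_central: "bar (lam_at i) * a = a * bar (lam_at i)"
  by (simp add: lam_at_def bar_lam_central)

lemma lam_at_bar [simp]: "lam_at i * bar (lam_at i) = 1" "bar (lam_at i) * lam_at i = 1"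
  by (simp_all add: lam_at_def lam_bar bar_lam_lam)

lemma lam_at_bar_left [simp]:
  "lam_at i * (bar (lam_at i) * a) = a" "bar (lam_at i) * (lam_at i * a) = a"
  by (simp_all add: mult.assoc [symmetric])

lemma twist_zero [simp]: "twist i j 0 = 0"
  by (simp add: twist_def)

lemma twist_minus [simp]: "twist i j (- c) = - twist i j c"
  by (simp add: twist_def)

lemma twist_add: "twist i j (c + d) = twist i j c + twist i j d"
  by (simp add: twist_def bar_add distrib_left)

lemma twist_diff: "twist i j (c - d) = twist i j c - twist i j d"
  by (simp add: twist_def bar_diff right_diff_distrib)

lemma twist_mult: "twist i k (c * d) = twist j k d * twist i j c"
proof -
  have "twist j k d * twist i j c = lam_at k * (bar (lam_at j) * bar d * (lam_at j * (bar (lam_at i) * bar c)))"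
    by (simp add: twist_def mult.assoc)
  also have "bar (lam_at j) * bar d * (lam_at j * (bar (lam_at i) * bar c))
      = bar d * (bar (lam_at i) * bar c)"
    by (subst bar_lam_at_central) (simp add: mult.assoc)
  also have "\<dots> = (bar d * bar (lam_at i)) * bar c" by (simp only: mult.assoc)
  also have "\<dots> = bar (lam_at i) * (bar d * bar c)"
    by (simp only: bar_lam_at_central [symmetric] mult.assoc)
  finally show ?thesis by (simp add: twist_def bar_mult mult.assoc)
qed

lemma twist_one [simp]: "twist i i 1 = 1"
  by (simp add: twist_def)

lemma twist_twist:
  assumes "i \<noteq> 0" "j \<noteq> 0"
  shows "twist (- j) (- i) (twist i j c) = c"
proof -
  have "bar (twist i j c) = (c * lam_at i) * bar (lam_at j)"
    by (simp only: twist_def bar_mult bar_bar mult.assoc)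
  also have "\<dots> = bar (lam_at j) * (lam_at i * c)"
    by (simp only: bar_lam_at_central lam_at_central)
  finally have "twist (- j) (- i) (twist i j c)
      = (lam_at (- i) * bar (lam_at (- j)) * bar (lam_at j) * lam_at i) * c"
    by (simp only: twist_def [of "- j"] mult.assoc)
  also have "lam_at (- i) * bar (lam_at (- j)) * bar (lam_at j) * lam_at i = 1"
    using assms by (auto simp: lam_at_def mult.assoc)
  finally show ?thesis by simp
qed

lemma twist_form_conj:
  assumes "i \<noteq> 0" "j \<noteq> 0"
  shows "twist i j a * (bar (lam_at (- i)) * g) * a = bar (lam_at (- j)) * (bar a * g * a)"
proof -
  have "twist i j a * (bar (lam_at (- i)) * g) * a
      = lam_at j * bar (lam_at i) * ((bar a * bar (lam_at (- i))) * (g * a))"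
    by (simp only: twist_def mult.assoc)
  also have "bar a * bar (lam_at (- i)) = bar (lam_at (- i)) * bar a"
    by (rule bar_lam_at_central [symmetric])
  also have "lam_at j * bar (lam_at i) * (bar (lam_at (- i)) * bar a * (g * a))
      = (lam_at j * bar (lam_at i) * bar (lam_at (- i))) * (bar a * g * a)"
    by (simp only: mult.assoc)
  also have "lam_at j * bar (lam_at i) * bar (lam_at (- i)) = bar (lam_at (- j))"
    using assms by (auto simp: lam_at_def)
  finally show ?thesis .
qed

abbreviation level :: "'a set \<Rightarrow> 'a set \<Rightarrow> bool" where
  "level I Gam \<equiv> form_ideal bar lam Lam I Gam"

abbreviation entries :: "'a set \<Rightarrow> 'a set \<Rightarrow> int \<Rightarrow> int \<Rightarrow> 'a set" where
  "entries I Gam i j \<equiv> entry_set bar lam I Gam i j"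

lemma entries_short: "j \<noteq> - i \<Longrightarrow> entries I Gam i j = I"
  by (simp add: entry_set_def)

lemma entries_long: "i \<noteq> 0 \<Longrightarrow> entries I Gam i (- i) = {bar (lam_at i) * g | g. g \<in> Gam}"
  by (auto simp add: entry_set_def lam_pow_def lam_at_def sgn_if)

lemma level_whole: "level UNIV Lam"
proof
  show "two_sided_ideal (UNIV :: 'a set)"
    by (simp add: two_sided_ideal_def add_subgroup_def)
  show "bar ` UNIV = UNIV"
    using bar_bar by (metis surjI)
  show "Gamma_min bar lam Lam UNIV \<subseteq> Lam"
  proof -
    have "x \<in> Lam" if "x \<in> group_closure {a * c * bar a |a c. a \<in> UNIV \<and> c \<in> Lam}" for x
      using that
    proof induction
      case (base s)
      then show ?case using Lam_conj Lam_subgroup by (auto simp: add_subgroup_def)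
    next
      case (diff s t)
      then show ?case using Lam_subgroup unfolding add_subgroup_def
        by (metis add_uminus_conv_diff)
    qed
    moreover have "a - lam * bar a \<in> Lam" for a
      using Lam_lower by (auto simp: Lambda_min_def)
    ultimately show ?thesis
      using Lam_subgroup by (auto simp: Gamma_min_def add_subgroup_def)
  qed
qed (use Lam_subgroup Lam_conj in \<open>auto simp: Gamma_max_def\<close>)

lemma
  assumes "level I Gam"
  shows level_zero: "0 \<in> I" and level_add: "x \<in> I \<Longrightarrow> y \<in> I \<Longrightarrow> x + y \<in> I"
    and level_uminus: "x \<in> I \<Longrightarrow> - x \<in> I"
    and level_mult_left: "x \<in> I \<Longrightarrow> c * x \<in> I"
    and level_mult_right: "x \<in> I \<Longrightarrow> x * c \<in> I"
    and level_bar: "x \<in> I \<Longrightarrow> bar x \<in> I"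
proof -
  interpret form_ideal bar lam Lam I Gam by fact
  show "0 \<in> I" "x \<in> I \<Longrightarrow> y \<in> I \<Longrightarrow> x + y \<in> I" "x \<in> I \<Longrightarrow> - x \<in> I"
    "x \<in> I \<Longrightarrow> c * x \<in> I" "x \<in> I \<Longrightarrow> x * c \<in> I"
    using ideal by (auto simp: two_sided_ideal_def add_subgroup_def)
  show "x \<in> I \<Longrightarrow> bar x \<in> I" using ideal_bar by auto
qed

lemma
  assumes "level I Gam"
  shows form_zero: "0 \<in> Gam" and form_add: "x \<in> Gam \<Longrightarrow> y \<in> Gam \<Longrightarrow> x + y \<in> Gam"
    and form_uminus: "x \<in> Gam \<Longrightarrow> - x \<in> Gam"
    and form_diff: "x \<in> Gam \<Longrightarrow> y \<in> Gam \<Longrightarrow> x - y \<in> Gam"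
    and form_conj: "x \<in> Gam \<Longrightarrow> c * x * bar c \<in> Gam"
    and form_in_ideal: "x \<in> Gam \<Longrightarrow> x \<in> I" and form_in_Lam: "x \<in> Gam \<Longrightarrow> x \<in> Lam"
    and form_symmetrized: "a \<in> I \<Longrightarrow> a - lam * bar a \<in> Gam"
    and form_square: "a \<in> I \<Longrightarrow> c \<in> Lam \<Longrightarrow> a * c * bar a \<in> Gam"
    and form_antisym: "x \<in> Gam \<Longrightarrow> lam * bar x = - x"
proof -
  interpret form_ideal bar lam Lam I Gam by fact
  show "0 \<in> Gam" "x \<in> Gam \<Longrightarrow> y \<in> Gam \<Longrightarrow> x + y \<in> Gam" "x \<in> Gam \<Longrightarrow> - x \<in> Gam"
    using Gam_subgroup by (auto simp: add_subgroup_def)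
  show "x \<in> Gam \<Longrightarrow> y \<in> Gam \<Longrightarrow> x - y \<in> Gam"
    using Gam_subgroup unfolding add_subgroup_def by (metis add_uminus_conv_diff)
  show "x \<in> Gam \<Longrightarrow> c * x * bar c \<in> Gam" by (rule Gam_conj)
  show "x \<in> Gam \<Longrightarrow> x \<in> I" "x \<in> Gam \<Longrightarrow> x \<in> Lam"
    using Gam_upper by (auto simp: Gamma_max_def)
  then show "x \<in> Gam \<Longrightarrow> lam * bar x = - x"
    using Lam_upper by (metis (mono_tags, lifting) Lambda_max_def mem_Collect_eq minus_minus subsetD)
  show "a - lam * bar a \<in> Gam" if "a \<in> I"
  proof -
    have "(a - lam * bar a) + 0 \<in> Gamma_min bar lam Lam I"
      unfolding Gamma_min_def using that zero_in_group_closure by blast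
    then show ?thesis using Gam_lower by auto
  qed
  show "a * c * bar a \<in> Gam" if "a \<in> I" "c \<in> Lam"
  proof -
    have "(0 - lam * bar 0) + a * c * bar a \<in> Gamma_min bar lam Lam I"
      unfolding Gamma_min_def using that ideal
      by (intro CollectI exI [of _ "0 - lam * bar 0"] exI [of _ "a * c * bar a"] conjI refl)
        (auto simp: two_sided_ideal_def add_subgroup_def intro!: group_closure.base)
    then show ?thesis using Gam_lower by auto
  qed
qed

lemma
  assumes "level I Gam" "i \<noteq> 0"
  shows entries_zero: "0 \<in> entries I Gam i j"
    and entries_add: "x \<in> entries I Gam i j \<Longrightarrow> y \<in> entries I Gam i j \<Longrightarrow> x + y \<in> entries I Gam i j"
    and entries_uminus: "x \<in> entries I Gam i j \<Longrightarrow> - x \<in> entries I Gam i j"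
    and entries_in_ideal: "x \<in> entries I Gam i j \<Longrightarrow> x \<in> I"
    and entries_in_whole: "x \<in> entries I Gam i j \<Longrightarrow> x \<in> entries UNIV Lam i j"
    and twist_long: "x \<in> entries I Gam i (- i) \<Longrightarrow> twist i (- i) x = - x"
proof -
  note l = assms(1)
  show "0 \<in> entries I Gam i j"
    using assms by (cases "j = - i") (auto simp: entries_short entries_long level_zero [OF l]
        intro!: exI [of _ 0] form_zero [OF l])
  show "x + y \<in> entries I Gam i j" if "x \<in> entries I Gam i j" "y \<in> entries I Gam i j"
    using assms that by (cases "j = - i") (auto simp: entries_short entries_long level_add [OF l]
        distrib_left [symmetric] intro!: form_add [OF l])
  show "- x \<in> entries I Gam i j" if "x \<in> entries I Gam i j"
    using assms that by (cases "j = - i") (force simp: entries_short entries_long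
        intro: level_uminus [OF l] form_uminus [OF l] simp flip: mult_minus_right)+
  show "x \<in> I" if "x \<in> entries I Gam i j"
    using assms that by (cases "j = - i") (auto simp: entries_short entries_long
        intro: level_mult_left [OF l] form_in_ideal [OF l])
  show "x \<in> entries UNIV Lam i j" if "x \<in> entries I Gam i j"
    using assms that by (cases "j = - i") (auto simp: entries_short entries_long
        intro!: form_in_Lam [OF l])
  show "twist i (- i) x = - x" if x: "x \<in> entries I Gam i (- i)"
  proof -
    obtain g where g: "g \<in> Gam" "x = bar (lam_at i) * g"
      using x assms by (auto simp: entries_long)
    have "twist i (- i) x = lam_at (- i) * bar (lam_at i) * (bar g * lam_at i)"
      using g by (simp only: twist_def bar_mult bar_bar)
    also have "bar g * lam_at i = lam_at i * bar g"
      by (rule lam_at_central [symmetric])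
    also have "lam_at (- i) * bar (lam_at i) * (lam_at i * bar g) = bar (lam_at i) * (lam * bar g)"
      using assms by (auto simp: lam_at_def mult.assoc)
    also have "\<dots> = - x" using g by (simp add: form_antisym [OF l])
    finally show ?thesis .
  qed
qed

lemma entries_flip:
  assumes "level I Gam" "i \<noteq> 0" "x \<in> entries I Gam i j"
  shows "- twist i j x \<in> entries I Gam (- j) (- i)"
proof (cases "j = - i")
  case True
  then show ?thesis using assms by (simp add: twist_long [OF assms(1)])
next
  case False
  then show ?thesis using assms
    by (auto simp: entries_short twist_def intro!: level_uminus level_mult_left level_bar)
qed

text \<open>
  The third level receives all commutators of root elements of the first two: products of
  coefficients enter it as commutators of short roots, and the other conditions serve the long roots.
\<close>

definition multiplies_into ::
    "'a set \<Rightarrow> 'a set \<Rightarrow> 'a set \<Rightarrow> 'a set \<Rightarrow> 'a set \<Rightarrow> 'a set \<Rightarrow> bool" where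
  "multiplies_into X \<Xi> Y \<Upsilon> Z \<Theta> \<longleftrightarrow>
     (\<forall>x\<in>X. \<forall>y\<in>Y. x * y \<in> Z \<and> y * x \<in> Z) \<and> (\<forall>z\<in>Z. z - lam * bar z \<in> \<Theta>) \<and>
     (\<forall>x\<in>X. \<forall>u\<in>\<Upsilon>. x * u * bar x \<in> \<Theta>) \<and> (\<forall>y\<in>Y. \<forall>u\<in>\<Xi>. y * u * bar y \<in> \<Theta>)"

lemma multiplies_into_whole:
  "level I Gam \<Longrightarrow> multiplies_into UNIV Lam I Gam I Gam"
  by (simp add: multiplies_into_def level_mult_left level_mult_right form_symmetrized form_conj
      form_square)

text \<open>
  The coefficients that the Steinberg relations produce on long roots are those of the given form
  parameter: \<open>z - twist z\<close> is \<open>\<lambda>\<^sub>i\<^sup>-\<^sup>1\<close> times an element \<open>y - \<lambda> bar y\<close>, and the coefficient in the next lemma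
  is \<open>\<lambda>\<^sub>-\<^sub>j\<^sup>-\<^sup>1\<close> times an element \<open>y u bar y\<close>.
\<close>

lemma symmetrized_in_entries:
  assumes "\<And>z. z \<in> Z \<Longrightarrow> z - lam * bar z \<in> \<Theta>" and "level Z \<Theta>" "z \<in> Z" "i \<noteq> 0"
  shows "z - twist i (- i) z \<in> entries Z \<Theta> i (- i)"
proof -
  have "lam * bar (lam_at i * z) = lam * (bar (lam_at i) * bar z)"
    by (simp only: bar_mult bar_lam_at_central)
  also have "\<dots> = lam_at i * twist i (- i) z"
    using assms by (auto simp: twist_def lam_at_def mult.assoc)
  finally have "lam * bar (lam_at i * z) = lam_at i * twist i (- i) z" .
  then have "z - twist i (- i) z = bar (lam_at i) * (lam_at i * z - lam * bar (lam_at i * z))"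
    by (simp add: right_diff_distrib)
  then show ?thesis
    using assms level_mult_left by (auto simp: entries_long)
qed

lemma square_in_entries:
  assumes "\<And>y u. y \<in> Y \<Longrightarrow> u \<in> \<Xi> \<Longrightarrow> y * u * bar y \<in> \<Theta>"
    and "level Y \<Upsilon>" "a \<in> Y" "\<xi> \<in> entries X \<Xi> (- i) i" "i \<noteq> 0" "j \<noteq> 0" "level Z \<Theta>"
  shows "- twist i j a * \<xi> * a \<in> entries Z \<Theta> (- j) j"
proof -
  obtain g where g: "g \<in> \<Xi>" "\<xi> = bar (lam_at (- i)) * g"
    using assms entries_long [of "- i"] by auto
  have "bar a * g * a \<in> \<Theta>"
    using assms(1) [of "bar a" g] assms(2,3) g level_bar by (auto simp: bar_bar)
  then have "- (bar a * g * a) \<in> \<Theta>" using assms form_uminus by blast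
  then show ?thesis
    using assms(5,6) entries_long [of "- j" Z \<Theta>] g
    by (auto simp: twist_form_conj intro!: exI [of _ "- (bar a * g * a)"])
qed

subsection \<open>The symmetrised product of two form ideals\<close>

definition ideal_prod :: "'a set \<Rightarrow> 'a set \<Rightarrow> 'a set" where
  "ideal_prod I J = group_closure {x. \<exists>a\<in>I. \<exists>b\<in>J. x = a * b \<or> x = b * a}"

definition form_prod :: "'a set \<Rightarrow> 'a set \<Rightarrow> 'a set \<Rightarrow> 'a set \<Rightarrow> 'a set" where
  "form_prod I Gam J Del =
     group_closure ({x - lam * bar x | x. x \<in> ideal_prod I J} \<union>
       {b * g * bar b | b g. b \<in> J \<and> g \<in> Gam} \<union> {a * d * bar a | a d. a \<in> I \<and> d \<in> Del})"

lemma group_closure_minimal: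
  assumes "x \<in> group_closure S" "0 \<in> P" "\<And>x y. x \<in> P \<Longrightarrow> y \<in> P \<Longrightarrow> x - y \<in> P" "S \<subseteq> P"
  shows "x \<in> P"
  using assms(1) by induction (use assms in auto)

lemma add_subgroup_group_closure: "add_subgroup (group_closure S)"
  by (simp add: add_subgroup_def group_closure_add)

text \<open>
  The condition that needs an argument is that \<open>x c bar x\<close> lies in the product form parameter for \<open>c\<close> in
  \<open>\<Lambda>\<close>. For \<open>x = a b\<close> it is \<open>a (b c bar b) bar a\<close>, where \<open>b c bar b\<close> belongs to the second form parameter.
\<close>

lemma level_prod:
  assumes I: "level I Gam" and J: "level J Del"
  shows "level (ideal_prod I J) (form_prod I Gam J Del)"
proof -
  let ?P = "ideal_prod I J" and ?F = "form_prod I Gam J Del"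
  have gen1: "a * b \<in> ?P" "b * a \<in> ?P" if "a \<in> I" "b \<in> J" for a b
    using that unfolding ideal_prod_def by (auto intro!: group_closure.base)
  have gen_sym: "x - lam * bar x \<in> ?F" if "x \<in> ?P" for x
    using that unfolding form_prod_def by (auto intro!: group_closure.base)
  have genJ: "b * g * bar b \<in> ?F" if "b \<in> J" "g \<in> Gam" for b g
    using that unfolding form_prod_def by (intro group_closure.base) blast
  have genI: "a * d * bar a \<in> ?F" if "a \<in> I" "d \<in> Del" for a d
    using that unfolding form_prod_def by (intro group_closure.base) blast
  have subP: "add_subgroup ?P" and subF: "add_subgroup ?F"
    by (simp_all add: ideal_prod_def form_prod_def add_subgroup_group_closure)
  have zP: "0 \<in> ?P" and dP: "\<And>x y. x \<in> ?P \<Longrightarrow> y \<in> ?P \<Longrightarrow> x - y \<in> ?P"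
    unfolding ideal_prod_def by (auto intro: group_closure.diff)
  have zF: "0 \<in> ?F" and dF: "\<And>x y. x \<in> ?F \<Longrightarrow> y \<in> ?F \<Longrightarrow> x - y \<in> ?F"
    unfolding form_prod_def by (auto intro: group_closure.diff)
  have aF: "\<And>x y. x \<in> ?F \<Longrightarrow> y \<in> ?F \<Longrightarrow> x + y \<in> ?F"
    using subF by (auto simp: add_subgroup_def)
  have mult: "c * x \<in> ?P \<and> x * c \<in> ?P" if "x \<in> ?P" for c x
  proof -
    have "x \<in> {x. c * x \<in> ?P \<and> x * c \<in> ?P}"
    proof (rule group_closure_minimal [OF that [unfolded ideal_prod_def]])
      show "{x. \<exists>a\<in>I. \<exists>b\<in>J. x = a * b \<or> x = b * a} \<subseteq> {x. c * x \<in> ?P \<and> x * c \<in> ?P}"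
        using gen1 level_mult_left [OF I] level_mult_right [OF I]
          level_mult_left [OF J] level_mult_right [OF J]
        by (auto simp: mult.assoc) (metis mult.assoc)+
    qed (use zP dP in \<open>auto simp: left_diff_distrib right_diff_distrib\<close>)
    then show ?thesis by auto
  qed
  have barP: "bar x \<in> ?P" if "x \<in> ?P" for x
  proof -
    have "x \<in> {x. bar x \<in> ?P}"
      by (rule group_closure_minimal [OF that [unfolded ideal_prod_def]])
        (use zP dP gen1 level_bar [OF I] level_bar [OF J] in \<open>auto simp: bar_diff bar_mult\<close>)
    then show ?thesis by auto
  qed
  have upper: "x \<in> ?P \<inter> Lam" if "x \<in> ?F" for x
    by (rule group_closure_minimal [OF that [unfolded form_prod_def]])
      (use zP dP mult barP gen1 form_zero [OF level_whole] form_diff [OF level_whole]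
        form_symmetrized [OF level_whole] form_conj [OF level_whole]
        form_in_Lam [OF I] form_in_Lam [OF J] form_in_ideal [OF I] form_in_ideal [OF J] in \<open>auto\<close>)
  have conjF: "c * x * bar c \<in> ?F" if "x \<in> ?F" for c x
  proof -
    have "c * (y - lam * bar y) * bar c = (c * y * bar c) - lam * bar (c * y * bar c)" for y
    proof -
      have "c * (lam * bar y) * bar c = (c * lam) * (bar y * bar c)" by (simp only: mult.assoc)
      also have "\<dots> = lam * bar (c * y * bar c)"
        by (simp only: lam_central [symmetric] bar_mult bar_bar mult.assoc)
      finally show ?thesis by (simp only: left_diff_distrib right_diff_distrib)
    qed
    then have 1: "c * (y - lam * bar y) * bar c \<in> ?F" if "y \<in> ?P" for y
      using gen_sym mult that by metis
    have "c * (b * g * bar b) * bar c = (c * b) * g * bar (c * b)" for b g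
      by (simp add: bar_mult mult.assoc)
    then have 2: "c * (b * g * bar b) * bar c \<in> ?F" if "b \<in> J \<and> g \<in> Gam \<or> b \<in> I \<and> g \<in> Del" for b g
      using genI genJ level_mult_left [OF I] level_mult_left [OF J] that by metis
    have "x \<in> {x. c * x * bar c \<in> ?F}"
      by (rule group_closure_minimal [OF that [unfolded form_prod_def]])
        (use 1 2 zF dF in \<open>auto simp: left_diff_distrib right_diff_distrib\<close>)
    then show ?thesis by auto
  qed
  \<comment> \<open>For a sum the square splits into squares and a cross term of the form \<open>z - \<lambda> bar z\<close>.\<close>
  have square: "a * c * bar a \<in> ?F" if "a \<in> ?P" "c \<in> Lam" for a c
  proof -
    have "a \<in> {a. a \<in> ?P \<and> a * c * bar a \<in> ?F}"
    proof (rule group_closure_minimal [OF that(1) [unfolded ideal_prod_def]])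
      show "{x. \<exists>a\<in>I. \<exists>b\<in>J. x = a * b \<or> x = b * a} \<subseteq> {a. a \<in> ?P \<and> a * c * bar a \<in> ?F}"
      proof safe
        fix a b assume ab: "a \<in> I" "b \<in> J"
        have "a * (b * c * bar b) * bar a \<in> ?F" "b * (a * c * bar a) * bar b \<in> ?F"
          using ab that genI genJ form_square [OF I] form_square [OF J] by auto
        then show "a * b * c * bar (a * b) \<in> ?F" "b * a * c * bar (b * a) \<in> ?F"
          by (simp_all add: bar_mult mult.assoc)
        show "a * b \<in> ?P" "b * a \<in> ?P" using ab gen1 by auto
      qed
      fix x y assume x: "x \<in> {a. a \<in> ?P \<and> a * c * bar a \<in> ?F}" and y: "y \<in> {a. a \<in> ?P \<and> a * c * bar a \<in> ?F}"
      have c: "lam * bar c = - c" using form_antisym [OF level_whole] that by auto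
      have "lam * bar (x * c * bar y) = (lam * y) * (bar c * bar x)"
        by (simp only: bar_mult bar_bar mult.assoc)
      also have "\<dots> = y * (lam * bar c) * bar x"
        by (simp only: lam_central mult.assoc)
      also have "\<dots> = - (y * c * bar x)" by (simp add: c)
      finally have "(x - y) * c * bar (x - y)
         = (x * c * bar x + y * c * bar y) - (x * c * bar y - lam * bar (x * c * bar y))"
        by (simp add: bar_diff algebra_simps)
      moreover have "x * c * bar y \<in> ?P" using x mult by auto
      ultimately show "x - y \<in> {a. a \<in> ?P \<and> a * c * bar a \<in> ?F}"
        using x y dP dF aF gen_sym by auto
    qed (use zP zF in auto)
    then show ?thesis by auto
  qed
  show ?thesis
  proof
    show "two_sided_ideal ?P" using subP mult by (auto simp: two_sided_ideal_def)
    show "bar ` ?P = ?P" using barP bar_bar by (auto simp: image_iff) (metis)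
    show "add_subgroup ?F" by (rule subF)
    show "?F \<subseteq> Gamma_max Lam ?P" using upper by (auto simp: Gamma_max_def)
    show "c * x * bar c \<in> ?F" if "x \<in> ?F" for x c using conjF that .
    have "x \<in> ?F" if "x \<in> group_closure {a * c * bar a |a c. a \<in> ?P \<and> c \<in> Lam}" for x
      by (rule group_closure_minimal [OF that]) (use zF dF square in auto)
    then show "Gamma_min bar lam Lam ?P \<subseteq> ?F"
      using gen_sym aF by (auto simp: Gamma_min_def)
  qed
qed

lemma multiplies_into_prod:
  assumes I: "level I Gam" and J: "level J Del"
  shows "multiplies_into I Gam J Del (ideal_prod I J) (form_prod I Gam J Del)"
proof -
  have "b * g * bar b \<in> form_prod I Gam J Del" if "b \<in> J \<and> g \<in> Gam \<or> b \<in> I \<and> g \<in> Del" for b g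
    using that unfolding form_prod_def by (intro group_closure.base) blast
  moreover have "a * b \<in> ideal_prod I J \<and> b * a \<in> ideal_prod I J" if "a \<in> I" "b \<in> J" for a b
    using that unfolding ideal_prod_def by (auto intro!: group_closure.base)
  ultimately show ?thesis
    using form_symmetrized [OF level_prod [OF I J]] by (auto simp: multiplies_into_def)
qed

end

section \<open>Groups with unitary Steinberg relations\<close>

lemma uminus_in_Omega [simp]: "- i \<in> Omega n \<longleftrightarrow> i \<in> Omega n"
  by (auto simp: Omega_def)

lemma Omega_nonzero: "i \<in> Omega n \<Longrightarrow> i \<noteq> 0"
  by (auto simp: Omega_def)

lemma third_index:
  assumes "3 \<le> n" "s = 1 \<or> s = (-1 :: int)"
  obtains h where "h \<in> Omega n" "s * h > 0" "h \<noteq> i" "h \<noteq> - i" "h \<noteq> j" "h \<noteq> - j"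
proof -
  have "\<exists>m\<in>{1, 2, 3 :: int}. m \<noteq> \<bar>i\<bar> \<and> m \<noteq> \<bar>j\<bar>"
    by (simp; linarith)
  then obtain m where "m \<in> {1, 2, 3 :: int}" "m \<noteq> \<bar>i\<bar>" "m \<noteq> \<bar>j\<bar>" by blast
  then show ?thesis
    using assms by (intro that [of "s * m"]) (auto simp: Omega_def)
qed

text \<open>
  Here \<open>T i j a\<close> stands for the root element \<open>T\<^sub>i\<^sub>j(a)\<close>. The last three relations cover pairs of roots at
  angles of 120, 90 and 135 degrees; renaming \<open>(i, j)\<close> as \<open>(-j, -i)\<close> reduces all other interacting pairs to
  them.
\<close>

locale unitary_relations = form_ring bar lam Lam + group G
  for bar :: "'a::{ring,monoid_mult} \<Rightarrow> 'a" and lam :: 'a and Lam :: "'a set"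
    and G :: "('g, 'm) monoid_scheme" (structure) +
  fixes n :: nat and T :: "int \<Rightarrow> int \<Rightarrow> 'a \<Rightarrow> 'g"
  assumes rank: "3 \<le> n"
    and T_closed: "\<lbrakk>i \<in> Omega n; j \<in> Omega n; i \<noteq> j; a \<in> entry_set bar lam UNIV Lam i j\<rbrakk>
      \<Longrightarrow> T i j a \<in> carrier G"
    and generated: "carrier G \<subseteq> generate G {T i j a | i j a.
      i \<in> Omega n \<and> j \<in> Omega n \<and> i \<noteq> j \<and> a \<in> entry_set bar lam UNIV Lam i j}"
    and T_flip_short: "\<lbrakk>i \<in> Omega n; j \<in> Omega n; i \<noteq> j; j \<noteq> - i\<rbrakk>
      \<Longrightarrow> T i j a = T (- j) (- i) (- form_ring.twist bar lam i j a)"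
    and T_add: "\<lbrakk>i \<in> Omega n; j \<in> Omega n; i \<noteq> j;
        a \<in> entry_set bar lam UNIV Lam i j; b \<in> entry_set bar lam UNIV Lam i j\<rbrakk>
      \<Longrightarrow> T i j (a + b) = T i j a \<otimes> T i j b"
    and T_commute: "\<lbrakk>i \<in> Omega n; j \<in> Omega n; i \<noteq> j; h \<in> Omega n; k \<in> Omega n; h \<noteq> k;
        h \<noteq> j; h \<noteq> - i; k \<noteq> i; k \<noteq> - j;
        a \<in> entry_set bar lam UNIV Lam i j; b \<in> entry_set bar lam UNIV Lam h k\<rbrakk>
      \<Longrightarrow> commutator (T i j a) (T h k b) = \<one>"
    and T_short: "\<lbrakk>i \<in> Omega n; j \<in> Omega n; h \<in> Omega n; i \<noteq> j; i \<noteq> - j; h \<noteq> j; h \<noteq> - j;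
        i \<noteq> h; i \<noteq> - h\<rbrakk>
      \<Longrightarrow> commutator (T i j a) (T j h b) = T i h (a * b)"
    and T_short_long: "\<lbrakk>i \<in> Omega n; j \<in> Omega n; i \<noteq> j; i \<noteq> - j\<rbrakk>
      \<Longrightarrow> commutator (T i j a) (T j (- i) b)
        = T i (- i) (a * b - form_ring.twist bar lam i (- i) (a * b))"
    and T_long_short: "\<lbrakk>i \<in> Omega n; j \<in> Omega n; i \<noteq> j; i \<noteq> - j;
        a \<in> entry_set bar lam UNIV Lam i (- i)\<rbrakk>
      \<Longrightarrow> commutator (T i (- i) a) (T (- i) j b)
        = T i j (a * b) \<otimes> T (- j) j (- form_ring.twist bar lam (- i) j b * a * b)"
begin

abbreviation is_root :: "int \<Rightarrow> int \<Rightarrow> bool" where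
  "is_root i j \<equiv> i \<in> Omega n \<and> j \<in> Omega n \<and> i \<noteq> j"

text \<open>
  The pairs \<open>(i, j)\<close> and \<open>(-j, -i)\<close> name the same root \<open>e\<^sub>i - e\<^sub>j\<close>, where \<open>e\<^sub>-\<^sub>i = - e\<^sub>i\<close>, so a root has two
  names for its opposite.
\<close>

definition opposite :: "int \<Rightarrow> int \<Rightarrow> int \<Rightarrow> int \<Rightarrow> bool" where
  "opposite h k i j \<longleftrightarrow> h = j \<and> k = i \<or> h = - i \<and> k = - j"

definition root_generators :: "'a set \<Rightarrow> 'a set \<Rightarrow> (int \<Rightarrow> int \<Rightarrow> bool) \<Rightarrow> 'g set" where
  "root_generators I Gam R = {T i j a | i j a. is_root i j \<and> a \<in> entries I Gam i j \<and> R i j}"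

definition root_group :: "'a set \<Rightarrow> 'a set \<Rightarrow> (int \<Rightarrow> int \<Rightarrow> bool) \<Rightarrow> 'g set" where
  "root_group I Gam R = generate G (root_generators I Gam R)"

abbreviation elementary :: "'a set \<Rightarrow> 'a set \<Rightarrow> 'g set" where
  "elementary I Gam \<equiv> root_group I Gam (\<lambda>i j. True)"

lemma T_in [simp]:
  "level I Gam \<Longrightarrow> is_root i j \<Longrightarrow> a \<in> entries I Gam i j \<Longrightarrow> T i j a \<in> carrier G"
  using T_closed entries_in_whole Omega_nonzero by blast

lemma T_in_short [simp]: "is_root i j \<Longrightarrow> j \<noteq> - i \<Longrightarrow> T i j a \<in> carrier G"
  using T_closed entries_short by blast

lemma root_generators_closed: "level I Gam \<Longrightarrow> root_generators I Gam R \<subseteq> carrier G"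
  by (auto simp: root_generators_def)

lemma root_group_subgroup: "level I Gam \<Longrightarrow> subgroup (root_group I Gam R) G"
  unfolding root_group_def by (intro generate_is_subgroup root_generators_closed)

lemma root_group_closed: "level I Gam \<Longrightarrow> x \<in> root_group I Gam R \<Longrightarrow> x \<in> carrier G"
  using root_group_subgroup subgroup.subset by blast

lemma root_groupI:
  "is_root i j \<Longrightarrow> a \<in> entries I Gam i j \<Longrightarrow> R i j \<Longrightarrow> T i j a \<in> root_group I Gam R"
  unfolding root_group_def root_generators_def by (intro generate.incl) blast

lemma root_group_subset:
  assumes "subgroup X G"
    and "\<And>i j a. is_root i j \<Longrightarrow> R i j \<Longrightarrow> a \<in> entries I Gam i j \<Longrightarrow> T i j a \<in> X"
  shows "root_group I Gam R \<subseteq> X"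
  unfolding root_group_def using assms
  by (intro generate_subgroup_incl) (auto simp: root_generators_def)

lemma root_group_mono:
  assumes "level I Gam" "\<And>i j. is_root i j \<Longrightarrow> R i j \<Longrightarrow> S i j"
  shows "root_group I Gam R \<subseteq> root_group I Gam S"
  using assms by (intro root_group_subset root_group_subgroup) (auto intro: root_groupI)

lemma root_group_whole:
  assumes "level I Gam"
  shows "root_group I Gam R \<subseteq> root_group UNIV Lam R"
  by (intro root_group_subset root_group_subgroup level_whole)
    (metis root_groupI entries_in_whole [OF assms] Omega_nonzero)

lemma carrier_eq: "carrier G = elementary UNIV Lam"
proof
  show "carrier G \<subseteq> elementary UNIV Lam"
    using generated by (simp add: root_group_def root_generators_def conj_assoc)
qed (use root_group_closed [OF level_whole] in blast)

lemma T_zero: "is_root i j \<Longrightarrow> T i j 0 = \<one>"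
  using T_add [of i j 0 0] T_in [OF level_whole, of i j 0] entries_zero [OF level_whole, of i j]
    Omega_nonzero [of i n] by (simp add: l_cancel_one)

lemma T_uminus:
  assumes "is_root i j" "a \<in> entries UNIV Lam i j"
  shows "T i j (- a) = inv (T i j a)"
proof -
  have "- a \<in> entries UNIV Lam i j"
    using assms entries_uminus [OF level_whole] Omega_nonzero by blast
  moreover from this have "T i j (- a) \<otimes> T i j a = \<one>"
    using T_add [of i j "- a" a] T_zero [of i j] assms by simp
  ultimately show ?thesis
    using assms T_in [OF level_whole] by (metis inv_equality)
qed

lemma T_flip:
  assumes "is_root i j" "a \<in> entries UNIV Lam i j"
  shows "T i j a = T (- j) (- i) (- twist i j a)"
proof (cases "j = - i")
  case True
  then have "twist i j a = - a" using twist_long [OF level_whole, of i a] assms Omega_nonzero by blast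
  then show ?thesis using True by simp
qed (use assms T_flip_short in blast)

lemma inv_root_generators:
  assumes "level I Gam" "s \<in> root_generators I Gam R"
  shows "inv s \<in> root_generators I Gam R"
proof -
  obtain i j a where s: "s = T i j a" "is_root i j" "a \<in> entries I Gam i j" "R i j"
    using assms by (auto simp: root_generators_def)
  then have "inv s = T i j (- a)" "- a \<in> entries I Gam i j"
    using T_uminus entries_in_whole [OF assms(1)] entries_uminus [OF assms(1)] Omega_nonzero by auto
  with s show ?thesis unfolding root_generators_def by blast
qed

lemma conj_by_root_group_closed:
  assumes "level I Gam" "X \<subseteq> carrier G"
    and "\<And>i j a x. is_root i j \<Longrightarrow> R i j \<Longrightarrow> a \<in> entries I Gam i j \<Longrightarrow> x \<in> X \<Longrightarrow> conj_by (T i j a) x \<in> X"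
    and "g \<in> root_group I Gam R" "x \<in> X"
  shows "conj_by g x \<in> X"
  by (rule conj_by_generate_closed [OF root_generators_closed [OF assms(1)] assms(2) _ _
        assms(4) [unfolded root_group_def] assms(5)])
    (use assms inv_root_generators in \<open>auto simp: root_generators_def\<close>)

subsection \<open>The commutator formula\<close>

text \<open>
  An odd function \<open>w\<close> on indices is a linear functional on roots, with value \<open>w i - w j\<close> on \<open>(i, j)\<close>.
  A commutator of root elements for \<open>\<gamma>\<close> and \<open>\<alpha>\<close> involves \<open>\<alpha> + \<gamma>\<close>, and also the long root \<open>\<alpha> + 2\<gamma>\<close> or
  \<open>2\<alpha> + \<gamma>\<close> when \<open>\<alpha>\<close>, respectively \<open>\<gamma>\<close>, is the only long one. All that is used later about these roots
  is their weight, so a property \<open>R\<close> of roots holds for them as soon as it holds for all roots of the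
  right weight and length.
\<close>

definition combinations_satisfy ::
    "(int \<Rightarrow> int) \<Rightarrow> int \<Rightarrow> int \<Rightarrow> int \<Rightarrow> int \<Rightarrow> (int \<Rightarrow> int \<Rightarrow> bool) \<Rightarrow> bool" where
  "combinations_satisfy w h k i j R \<longleftrightarrow> (\<forall>p q. is_root p q \<longrightarrow>
     (w p - w q = (w h - w k) + (w i - w j) \<or>
      q = - p \<and> j = - i \<and> k \<noteq> - h \<and> w p - w q = 2 * (w h - w k) + (w i - w j) \<or>
      q = - p \<and> k = - h \<and> j \<noteq> - i \<and> w p - w q = (w h - w k) + 2 * (w i - w j)) \<longrightarrow> R p q)"

lemma composable_commutator:
  assumes odd: "\<And>i. w (- i) = - w i"
    and X: "level X \<Xi>" and Y: "level Y \<Upsilon>" and Z: "level Z \<Theta>"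
    and m: "multiplies_into X \<Xi> Y \<Upsilon> Z \<Theta>"
    and r: "is_root h i" "is_root i j" "h \<noteq> j"
    and c: "c \<in> entries X \<Xi> h i" and a: "a \<in> entries Y \<Upsilon> i j"
    and R: "combinations_satisfy w h i i j R"
  shows "commutator (T h i c) (T i j a) \<in> root_group Z \<Theta> R"
proof -
  have nz: "h \<noteq> 0" "i \<noteq> 0" "j \<noteq> 0" using r Omega_nonzero by auto
  have cX: "c \<in> X" and aY: "a \<in> Y"
    using c a nz entries_in_ideal [OF X] entries_in_ideal [OF Y] by auto
  have ca: "c * a \<in> Z" and ac: "a * c \<in> Z" using m cX aY by (auto simp: multiplies_into_def)
  have sym: "\<And>z. z \<in> Z \<Longrightarrow> z - lam * bar z \<in> \<Theta>"
    and sqY: "\<And>y u. y \<in> Y \<Longrightarrow> u \<in> \<Xi> \<Longrightarrow> y * u * bar y \<in> \<Theta>"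
    and sqX: "\<And>x u. x \<in> X \<Longrightarrow> u \<in> \<Upsilon> \<Longrightarrow> x * u * bar x \<in> \<Theta>"
    using m by (auto simp: multiplies_into_def)
  note sg = root_group_subgroup [OF Z, of R]
  consider "h \<noteq> - i" "j \<noteq> - i" "j \<noteq> - h" | "h \<noteq> - i" "j = - h" | "h = - i" | "h \<noteq> - i" "j = - i"
    by blast
  then show ?thesis
  proof cases
    case 1
    have "R h j" using R r by (auto simp: combinations_satisfy_def)
    moreover have "commutator (T h i c) (T i j a) = T h j (c * a)"
      using 1 r by (intro T_short) auto
    ultimately show ?thesis using r 1 ca by (auto intro!: root_groupI simp: entries_short)
  next
    case 2
    have "R h (- h)" using R r 2 odd by (auto simp: combinations_satisfy_def)
    moreover have "commutator (T h i c) (T i (- h) a) = T h (- h) (c * a - twist h (- h) (c * a))"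
      using 2 r by (intro T_short_long) auto
    ultimately show ?thesis
      using r 2 ca nz by (auto intro!: root_groupI symmetrized_in_entries [OF sym Z])
  next
    case 3
    have ji: "j \<noteq> - i" "j \<noteq> i" using r 3 by auto
    have 1: "R (- i) j" using R r 3 odd by (auto simp: combinations_satisfy_def)
    have 2: "R (- j) j"
      using R [unfolded combinations_satisfy_def, rule_format, of "- j" j] r 3 odd ji nz by auto
    have "commutator (T (- i) i c) (T i j a) = T (- i) j (c * a) \<otimes> T (- j) j (- twist i j a * c * a)"
      using T_long_short [of "- i" j c a] r 3 ji c entries_in_whole [OF X, of h c i] nz by auto
    moreover have "T (- i) j (c * a) \<in> root_group Z \<Theta> R"
      using r ca ji 1 by (intro root_groupI) (auto simp: entries_short)
    moreover have "T (- j) j (- twist i j a * c * a) \<in> root_group Z \<Theta> R"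
      using r nz 2 3 c by (intro root_groupI square_in_entries [OF sqY Y aY _ _ _ Z]) auto
    ultimately show ?thesis using 3 subgroup.m_closed [OF sg] by auto
  next
    case 4
    have hi: "h \<noteq> i" using r by auto
    define c' where "c' = - twist h i c"
    have c': "c' \<in> X" using entries_flip [OF X _ c] nz 4 r unfolding c'_def by (auto simp: entries_short)
    have "T h i c = T (- i) (- h) c'"
      unfolding c'_def using r nz c entries_in_whole [OF X] by (intro T_flip) auto
    then have "commutator (T h i c) (T i j a) = inv (commutator (T i (- i) a) (T (- i) (- h) c'))"
      using r 4 a T_in [OF Y] T_in_short by (subst inv_commutator) auto
    also have "commutator (T i (- i) a) (T (- i) (- h) c')
        = T i (- h) (a * c') \<otimes> T h (- h) (- twist (- i) (- h) c' * a * c')"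
      using T_long_short [of i "- h" a c'] r 4 hi a entries_in_whole [OF Y, of i a j] nz by auto
    finally have eq: "commutator (T h i c) (T i j a)
        = inv (T i (- h) (a * c') \<otimes> T h (- h) (- twist (- i) (- h) c' * a * c'))" .
    have 1: "R i (- h)" using R r 4 odd by (auto simp: combinations_satisfy_def)
    have 2: "R h (- h)"
      using R [unfolded combinations_satisfy_def, rule_format, of h "- h"] r 4 odd nz by auto
    have "T i (- h) (a * c') \<in> root_group Z \<Theta> R"
      using r m aY c' hi 4 1 by (intro root_groupI) (auto simp: entries_short multiplies_into_def)
    moreover have "T h (- h) (- twist (- i) (- h) c' * a * c') \<in> root_group Z \<Theta> R"
      using square_in_entries [OF sqX X c', where \<xi> = a and i = "- i" and j = "- h"] r nz 2 4 a Z
      by (intro root_groupI) auto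
    ultimately show ?thesis
      unfolding eq using subgroup.m_closed [OF sg] subgroup.m_inv_closed [OF sg] by auto
  qed
qed

lemma combinations_satisfy_flip_left:
  assumes "\<And>i. w (- i) = - w i" "combinations_satisfy w h k i j R"
  shows "combinations_satisfy w (- k) (- h) i j R"
  using assms unfolding combinations_satisfy_def
  by (simp add: algebra_simps) (metis minus_equation_iff)

lemma combinations_satisfy_flip_right:
  assumes "\<And>i. w (- i) = - w i" "combinations_satisfy w h k i j R"
  shows "combinations_satisfy w h k (- j) (- i) R"
  using assms unfolding combinations_satisfy_def
  by (simp add: algebra_simps) (metis minus_equation_iff)

text \<open>
  If two roots interact at all, then up to renaming each of them as \<open>(-j, -i)\<close> the second index of the
  first is the first index of the second.
\<close>

lemma root_commutator:
  assumes odd: "\<And>i. w (- i) = - w i"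
    and X: "level X \<Xi>" and Y: "level Y \<Upsilon>" and Z: "level Z \<Theta>"
    and m: "multiplies_into X \<Xi> Y \<Upsilon> Z \<Theta>"
    and r: "is_root h k" "is_root i j" "\<not> opposite h k i j"
    and c: "c \<in> entries X \<Xi> h k" and a: "a \<in> entries Y \<Upsilon> i j"
    and R: "combinations_satisfy w h k i j R"
  shows "commutator (T h k c) (T i j a) \<in> root_group Z \<Theta> R"
proof -
  have nz: "h \<noteq> 0" "k \<noteq> 0" "i \<noteq> 0" "j \<noteq> 0" using r Omega_nonzero by auto
  note comp = composable_commutator [where w = w, OF odd X Y Z m]
  have c': "- twist h k c \<in> entries X \<Xi> (- k) (- h)" and a': "- twist i j a \<in> entries Y \<Upsilon> (- j) (- i)"
    using entries_flip [OF X _ c] entries_flip [OF Y _ a] nz by auto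
  have flips: "T h k c = T (- k) (- h) (- twist h k c)" "T i j a = T (- j) (- i) (- twist i j a)"
    using r nz c a entries_in_whole [OF X] entries_in_whole [OF Y] by (blast intro: T_flip)+
  consider "k = i" | "k = - j" | "h = - i" | "h = j" | "h \<noteq> j" "h \<noteq> - i" "k \<noteq> i" "k \<noteq> - j" by blast
  then show ?thesis
  proof cases
    case 1
    then show ?thesis using comp [of h i j c a R] r c a R by (auto simp: opposite_def)
  next
    case 2
    then show ?thesis
      using comp [of h "- j" "- i" c "- twist i j a" R] r c a' flips(2)
        combinations_satisfy_flip_right [of w, OF odd R] by (auto simp: opposite_def)
  next
    case 3
    then show ?thesis
      using comp [of "- k" i j "- twist h k c" a R] r c' a flips(1)
        combinations_satisfy_flip_left [of w, OF odd R] by (auto simp: opposite_def)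
  next
    case 4
    then show ?thesis
      using comp [of "- k" "- j" "- i" "- twist h k c" "- twist i j a" R] r c' a' flips
        combinations_satisfy_flip_left [of w, OF odd combinations_satisfy_flip_right [of w, OF odd R]]
      by (auto simp: opposite_def)
  next
    case 5
    have "commutator (T h k c) (T i j a) = \<one>"
      using 5 r c a nz entries_in_whole [OF X] entries_in_whole [OF Y] by (intro T_commute) auto
    then show ?thesis using subgroup.one_closed [OF root_group_subgroup [OF Z]] by auto
  qed
qed

lemma commutator_in_product:
  assumes "level X \<Xi>" "level Y \<Upsilon>" "level Z \<Theta>" "multiplies_into X \<Xi> Y \<Upsilon> Z \<Theta>"
    and "is_root h k" "is_root i j" "\<not> opposite h k i j"
    and "c \<in> entries X \<Xi> h k" "a \<in> entries Y \<Upsilon> i j"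
  shows "commutator (T h k c) (T i j a) \<in> elementary Z \<Theta>"
  using assms by (intro root_commutator [where w = "\<lambda>i. i"]) (auto simp: combinations_satisfy_def)

text \<open>
  Outside the case of opposite roots, the elementary subgroup of a level is stable under conjugation by
  root elements with arbitrary coefficients. All difficulties about relative groups come from opposite
  roots.
\<close>

lemma conj_by_not_opposite:
  assumes I: "level I Gam" and r: "is_root h k" "is_root i j" "\<not> opposite h k i j"
    and c: "c \<in> entries UNIV Lam h k" and a: "a \<in> entries I Gam i j"
  shows "conj_by (T h k c) (T i j a) \<in> elementary I Gam"
proof -
  have "commutator (T h k c) (T i j a) \<in> elementary I Gam"
    by (rule commutator_in_product [OF level_whole I I multiplies_into_whole [OF I] r c a])
  moreover have "T i j a \<in> elementary I Gam" using r a by (intro root_groupI) auto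
  moreover have "T h k c \<in> carrier G" "T i j a \<in> carrier G"
    using T_in [OF level_whole] T_in [OF I] r a c by auto
  ultimately show ?thesis
    using subgroup.m_closed [OF root_group_subgroup [OF I]] by (simp add: conj_by_eq_commutator_mult)
qed

end

section \<open>Relative elementary groups from opposite Siegel parabolics\<close>

context unitary_relations
begin

text \<open>
  The two opposite Siegel parabolics are distinguished by a sign \<open>s = 1\<close> or \<open>s = -1\<close>. The height of a
  root is \<open>2\<close> on the unipotent radical of the parabolic of sign \<open>s\<close>, \<open>0\<close> on the common Levi subgroup and
  \<open>-2\<close> on the opposite radical.
\<close>

definition height :: "int \<Rightarrow> int \<Rightarrow> int \<Rightarrow> int" where
  "height s i j = s * sgn i - s * sgn j"

definition unipotent :: "int \<Rightarrow> 'a set \<Rightarrow> 'a set \<Rightarrow> 'g set" where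
  "unipotent s I Gam = root_group I Gam (\<lambda>i j. 0 < height s i j)"

lemma height_uminus [simp]: "height (- s) i j = - height s i j"
  by (simp add: height_def)

lemma height_cases:
  assumes "s = 1 \<or> s = -1" "is_root i j"
  obtains "height s i j = 2" "s * i > 0" "s * j < 0"
    | "height s i j = 0" "s * i > 0" "s * j > 0" "j \<noteq> - i"
    | "height s i j = 0" "s * i < 0" "s * j < 0" "j \<noteq> - i"
    | "height s i j = - 2" "s * i < 0" "s * j > 0"
  using assms Omega_nonzero [of i n] Omega_nonzero [of j n]
  by (cases "0 < i"; cases "0 < j") (auto simp: height_def sgn_if)

lemma height_opposite: "opposite h k i j \<Longrightarrow> height s h k = - height s i j"
  by (auto simp: opposite_def height_def)

lemma conj_root_in:
  assumes odd: "\<And>i. w (- i) = - w i" and I: "level I Gam"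
    and r: "is_root h k" "is_root i j" "\<not> opposite h k i j"
    and c: "c \<in> entries UNIV Lam h k" and a: "a \<in> entries I Gam i j"
    and R: "combinations_satisfy w h k i j R" "R i j"
  shows "conj_by (T h k c) (T i j a) \<in> root_group I Gam R"
proof -
  have "commutator (T h k c) (T i j a) \<in> root_group I Gam R"
    by (rule root_commutator [where w = w, OF odd level_whole I I multiplies_into_whole [OF I]])
      (use r c a R in auto)
  moreover have "T i j a \<in> root_group I Gam R" using r a R by (intro root_groupI) auto
  moreover have "T h k c \<in> carrier G" "T i j a \<in> carrier G"
    using T_in [OF level_whole] T_in [OF I] r a c by auto
  ultimately show ?thesis
    using subgroup.m_closed [OF root_group_subgroup [OF I]] by (simp add: conj_by_eq_commutator_mult)
qed

lemma conj_height:
  assumes I: "level I Gam" and r: "is_root h k" "is_root i j" "\<not> opposite h k i j"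
    and c: "c \<in> entries UNIV Lam h k" and a: "a \<in> entries I Gam i j"
    and R: "R i j" "\<And>p q. is_root p q \<Longrightarrow> height s p q = height s h k + height s i j \<or>
      q = - p \<and> j = - i \<and> k \<noteq> - h \<and> height s p q = 2 * height s h k + height s i j \<or>
      q = - p \<and> k = - h \<and> j \<noteq> - i \<and> height s p q = height s h k + 2 * height s i j \<Longrightarrow> R p q"
  shows "conj_by (T h k c) (T i j a) \<in> root_group I Gam R"
  using R(2) unfolding height_def
  by (intro conj_root_in [where w = "\<lambda>i. s * sgn i" and I = I] I r c a R(1))
    (auto simp: combinations_satisfy_def)

lemma conj_root_group_closed:
  assumes I: "level I Gam" and c: "is_root h k" "c \<in> entries UNIV Lam h k"
    and "\<And>i j a. is_root i j \<Longrightarrow> R i j \<Longrightarrow> a \<in> entries I Gam i j \<Longrightarrow>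
      conj_by (T h k c) (T i j a) \<in> root_group I Gam S"
    and "x \<in> root_group I Gam R"
  shows "conj_by (T h k c) x \<in> root_group I Gam S"
  by (rule conj_by_generate_subset [OF root_generators_closed [OF I] root_group_subgroup [OF I] _ _
        assms(5) [unfolded root_group_def]])
    (use assms(4) c T_in [OF level_whole] in \<open>auto simp: root_generators_def\<close>)

lemma parabolic_normalizes_unipotent:
  assumes "level I Gam" "is_root h k" "c \<in> entries UNIV Lam h k" "0 \<le> height s h k"
    and "x \<in> unipotent s I Gam"
  shows "conj_by (T h k c) x \<in> unipotent s I Gam"
  unfolding unipotent_def
proof (rule conj_root_group_closed [OF assms(1-3) _ assms(5) [unfolded unipotent_def]])
  fix i j a assume "is_root i j" "0 < height s i j" "a \<in> entries I Gam i j"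
  then show "conj_by (T h k c) (T i j a) \<in> root_group I Gam (\<lambda>i j. 0 < height s i j)"
    using assms height_opposite [of h k i j s] by (intro conj_height [where s = s]) auto
qed

lemma unipotent_normalizes_parabolic:
  assumes "level I Gam" "is_root h k" "c \<in> entries UNIV Lam h k" "0 < height s h k"
    and "x \<in> root_group I Gam (\<lambda>i j. 0 \<le> height s i j)"
  shows "conj_by (T h k c) x \<in> root_group I Gam (\<lambda>i j. 0 \<le> height s i j)"
proof (rule conj_root_group_closed [OF assms(1-3) _ assms(5)])
  fix i j a assume "is_root i j" "0 \<le> height s i j" "a \<in> entries I Gam i j"
  then show "conj_by (T h k c) (T i j a) \<in> root_group I Gam (\<lambda>i j. 0 \<le> height s i j)"
    using assms height_opposite [of h k i j s] by (intro conj_height [where s = s]) auto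
qed

lemma unipotent_closed: "level I Gam \<Longrightarrow> x \<in> unipotent s I Gam \<Longrightarrow> x \<in> carrier G"
  unfolding unipotent_def by (rule root_group_closed)

lemma unipotent_subgroup: "level I Gam \<Longrightarrow> subgroup (unipotent s I Gam) G"
  unfolding unipotent_def by (rule root_group_subgroup)

lemma unipotent_elementary: "level I Gam \<Longrightarrow> unipotent s I Gam \<subseteq> elementary I Gam"
  unfolding unipotent_def by (rule root_group_mono) auto

lemma unipotent_whole: "level I Gam \<Longrightarrow> unipotent s I Gam \<subseteq> unipotent s UNIV Lam"
  unfolding unipotent_def by (rule root_group_whole)

lemma unipotent_commute:
  assumes s: "s = 1 \<or> s = -1" and "x \<in> unipotent s UNIV Lam" "y \<in> unipotent s UNIV Lam"
  shows "x \<otimes> y = y \<otimes> x"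
proof (rule commute_generate [OF root_generators_closed root_generators_closed _
      assms(2,3) [unfolded unipotent_def root_group_def]])
  fix x y assume "x \<in> root_generators UNIV Lam (\<lambda>i j. 0 < height s i j)"
    and "y \<in> root_generators UNIV Lam (\<lambda>i j. 0 < height s i j)"
  then obtain i j a h k b where x: "x = T i j a" "is_root i j" "0 < height s i j" "a \<in> entries UNIV Lam i j"
    and y: "y = T h k b" "is_root h k" "0 < height s h k" "b \<in> entries UNIV Lam h k"
    by (auto simp: root_generators_def)
  have "s * i > 0" "s * j < 0" "s * h > 0" "s * k < 0"
    using height_cases [OF s x(2)] height_cases [OF s y(2)] x(3) y(3) by force+
  then have "h \<noteq> j" "h \<noteq> - i" "k \<noteq> i" "k \<noteq> - j" using s by auto
  then have "commutator x y = \<one>" using x y by (auto intro!: T_commute)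
  then show "x \<otimes> y = y \<otimes> x"
    using x y T_in [OF level_whole] commutator_eq_one_iff by auto
qed (rule level_whole)+

text \<open>
  Conjugating a root element \<open>x\<close> for \<open>\<alpha>\<close> in the radical of sign \<open>-s\<close> by the radical \<open>U\<close> of sign \<open>s\<close>: since
  \<open>U\<close> is abelian, the factor of the conjugating element on \<open>-\<alpha>\<close> can be applied last, and the others
  change \<open>x\<close> only by factors \<open>f\<close> that are already under control. Those factors have height at least \<open>0\<close>,
  except for one long root of height \<open>-2\<close> when \<open>\<alpha>\<close> is short; hence long roots are treated first.
\<close>

lemma conj_by_unipotent_in:
  assumes s: "s = 1 \<or> s = -1" and I: "level I Gam" and X: "subgroup X G" and sub: "elementary I Gam \<subseteq> X"
    and opp: "\<And>i j b c. \<lbrakk>is_root i j; height s i j < 0; b \<in> entries I Gam i j; c \<in> entries UNIV Lam j i\<rbrakk>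
      \<Longrightarrow> conj_by (T j i c) (T i j b) \<in> X"
    and u: "u \<in> unipotent s UNIV Lam" and x: "x \<in> elementary I Gam"
  shows "conj_by u x \<in> X"
proof -
  \<comment> \<open>Passing to the largest subset of \<open>X\<close> that \<open>U\<close> normalises lets the factors \<open>f\<close> be conjugated further.\<close>
  define Q where "Q = {x \<in> carrier G. \<forall>u\<in>unipotent s UNIV Lam. conj_by u x \<in> X}"
  have Uc: "\<And>u. u \<in> unipotent s UNIV Lam \<Longrightarrow> u \<in> carrier G"
    using unipotent_closed [OF level_whole] by auto
  note Usub = unipotent_subgroup [OF level_whole, of s]
  have Q_sub: "subgroup Q G"
  proof (rule subgroupI)
    show "Q \<noteq> {}" using Uc subgroup.one_closed [OF X]
      by (auto simp: Q_def conj_by_def intro!: exI [of _ \<one>])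
  qed (use Uc X in \<open>auto simp: Q_def conj_by_inv conj_by_mult subgroup.m_closed subgroup.m_inv_closed\<close>)
  have Q_X: "q \<in> X" if "q \<in> Q" for q
    using that subgroup.one_closed [OF Usub] unfolding Q_def by force
  have Q_conj: "conj_by u q \<in> Q" if "q \<in> Q" "u \<in> unipotent s UNIV Lam" for q u
    using that Uc subgroup.m_closed [OF Usub] by (auto simp: Q_def conj_by_conj_by)
  have step: "T i j b \<in> Q"
    if r: "is_root i j" "height s i j < 0" and b: "b \<in> entries I Gam i j"
      and f: "\<And>h k d. \<lbrakk>is_root h k; 0 < height s h k; \<not> opposite h k i j; d \<in> entries UNIV Lam h k\<rbrakk>
        \<Longrightarrow> commutator (T h k d) (T i j b) \<in> Q" for i j b
  proof -
    define Z where "Z c = conj_by (T j i c) (T i j b)" for c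
    have Tb: "T i j b \<in> carrier G" using T_in [OF I] r b by auto
    have ji: "is_root j i" "0 < height s j i" using r by (auto simp: height_def)
    have Tc: "T j i c \<in> unipotent s UNIV Lam" if "c \<in> entries UNIV Lam j i" for c
      unfolding unipotent_def using that ji by (intro root_groupI) auto
    have gen: "\<exists>c'\<in>entries UNIV Lam j i. \<exists>q\<in>Q. conj_by g (Z c) = q \<otimes> Z c'"
      if g: "g \<in> root_generators UNIV Lam (\<lambda>i j. 0 < height s i j)" and c: "c \<in> entries UNIV Lam j i" for g c
    proof -
      obtain h k d where d: "g = T h k d" "is_root h k" "0 < height s h k" "d \<in> entries UNIV Lam h k"
        using g by (auto simp: root_generators_def)
      then have gU: "g \<in> unipotent s UNIV Lam" unfolding unipotent_def by (auto intro: root_groupI)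
      show ?thesis
      proof (cases "opposite h k i j")
        case True
        have "\<exists>e\<in>entries UNIV Lam j i. g = T j i e"
        proof (cases "h = j \<and> k = i")
          case False
          then have "h = - i" "k = - j" using True by (auto simp: opposite_def)
          then show ?thesis
            using T_flip [OF d(2,4)] entries_flip [OF level_whole _ d(4)] d Omega_nonzero by auto
        qed (use d in auto)
        then obtain e where e: "e \<in> entries UNIV Lam j i" "g = T j i e" by blast
        have "conj_by g (Z c) = conj_by (T j i (e + c)) (T i j b)"
          using e c ji Tb Tc Uc T_add [of j i e c] by (simp add: Z_def conj_by_conj_by)
        moreover have ec: "e + c \<in> entries UNIV Lam j i"
          using e c entries_add [OF level_whole] ji Omega_nonzero by blast
        ultimately have "conj_by g (Z c) = \<one> \<otimes> Z (e + c)"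
          using Tb Tc [OF ec] Uc by (simp add: Z_def)
        then show ?thesis using ec subgroup.one_closed [OF Q_sub] by blast
      next
        case False
        let ?f = "commutator g (T i j b)"
        have fQ: "?f \<in> Q" using f d False by auto
        have carr: "g \<in> carrier G" "T j i c \<in> carrier G" "?f \<in> carrier G"
          using gU Uc Tc c Tb by auto
        have "conj_by g (Z c) = conj_by (T j i c) (conj_by g (T i j b))"
          unfolding Z_def using carr Tb unipotent_commute [OF s gU Tc [OF c]]
          by (simp add: conj_by_conj_by)
        also have "conj_by g (T i j b) = ?f \<otimes> T i j b"
          using carr Tb by (simp add: conj_by_eq_commutator_mult)
        also have "conj_by (T j i c) (?f \<otimes> T i j b) = conj_by (T j i c) ?f \<otimes> Z c"
          unfolding Z_def using carr Tb by (simp add: conj_by_mult)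
        finally show ?thesis using c Q_conj [OF fQ Tc [OF c]] by blast
      qed
    qed
    have all: "\<exists>c'\<in>entries UNIV Lam j i. \<exists>q\<in>Q. conj_by u (Z c) = q \<otimes> Z c'"
      if "u \<in> unipotent s UNIV Lam" "c \<in> entries UNIV Lam j i" for u c
      using that(1) [unfolded unipotent_def root_group_def] that(2)
    proof (induction u arbitrary: c rule: generate.induct)
      case one
      have "conj_by \<one> (Z c) = \<one> \<otimes> Z c" using Tb Tc one Uc by (simp add: Z_def)
      then show ?case using one subgroup.one_closed [OF Q_sub] by blast
    next
      case (incl g)
      then show ?case by (rule gen)
    next
      case (inv g)
      then show ?case by (intro gen inv_root_generators level_whole)
    next
      case (eng g h)
      then have gh: "g \<in> unipotent s UNIV Lam" "h \<in> unipotent s UNIV Lam"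
        by (auto simp: unipotent_def root_group_def)
      obtain c1 q1 where 1: "c1 \<in> entries UNIV Lam j i" "q1 \<in> Q" "conj_by h (Z c) = q1 \<otimes> Z c1"
        using eng.IH(2) [OF eng.prems] by blast
      obtain c2 q2 where 2: "c2 \<in> entries UNIV Lam j i" "q2 \<in> Q" "conj_by g (Z c1) = q2 \<otimes> Z c2"
        using eng.IH(1) [OF 1(1)] by blast
      have Zc: "Z c \<in> carrier G" if "c \<in> entries UNIV Lam j i" for c
        using that Tb Tc Uc by (simp add: Z_def)
      have q: "q1 \<in> carrier G" "q2 \<in> carrier G" "conj_by g q1 \<in> Q" "conj_by g q1 \<in> carrier G"
        using 1 2 Q_conj gh Uc by (auto simp: Q_def)
      have "conj_by (g \<otimes> h) (Z c) = conj_by g (q1 \<otimes> Z c1)"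
        using 1(3) gh Uc Zc eng.prems by (simp flip: conj_by_conj_by)
      also have "\<dots> = (conj_by g q1 \<otimes> q2) \<otimes> Z c2"
        using q gh Uc 1 2 Zc by (simp add: conj_by_mult m_assoc)
      finally show ?case using 2 q subgroup.m_closed [OF Q_sub] by blast
    qed
    have zero: "0 \<in> entries UNIV Lam j i" using entries_zero [OF level_whole] ji Omega_nonzero by blast
    have Z0: "Z 0 = T i j b" using Tb T_zero [of j i] ji by (simp add: Z_def)
    have "conj_by u (T i j b) \<in> X" if u: "u \<in> unipotent s UNIV Lam" for u
    proof -
      obtain c q where c: "c \<in> entries UNIV Lam j i" "q \<in> Q" "conj_by u (T i j b) = q \<otimes> Z c"
        using all [OF u zero] Z0 by auto
      moreover have "Z c \<in> X" unfolding Z_def using opp r b c by blast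
      ultimately show ?thesis using Q_X subgroup.m_closed [OF X] by auto
    qed
    then show ?thesis using Tb by (simp add: Q_def)
  qed
  have nonneg: "root_group I Gam (\<lambda>i j. 0 \<le> height s i j) \<subseteq> Q"
  proof
    fix x assume x: "x \<in> root_group I Gam (\<lambda>i j. 0 \<le> height s i j)"
    have "conj_by u x \<in> root_group I Gam (\<lambda>i j. 0 \<le> height s i j)" if "u \<in> unipotent s UNIV Lam" for u
      by (rule conj_by_root_group_closed [OF level_whole _ _ that [unfolded unipotent_def] x])
        (use root_group_closed [OF I] unipotent_normalizes_parabolic [OF I] in auto)
    then show "x \<in> Q"
      using x root_group_closed [OF I] root_group_mono [OF I, of "\<lambda>i j. 0 \<le> height s i j" "\<lambda>i j. True"] sub
      unfolding Q_def by blast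
  qed
  have comm: "commutator (T h k d) (T i j b) \<in> root_group I Gam R"
    if "is_root i j" "is_root h k" "\<not> opposite h k i j" "d \<in> entries UNIV Lam h k" "b \<in> entries I Gam i j"
      "combinations_satisfy (\<lambda>i. s * sgn i) h k i j R" for h k d i j b R
    by (rule root_commutator [OF _ level_whole I I multiplies_into_whole [OF I] _ _ _ _ _ that(6)])
      (use that in auto)
  have long: "T i j b \<in> Q" if ij: "is_root i j" "b \<in> entries I Gam i j" "j = - i" for i j b
  proof (cases "height s i j < 0")
    case True
    show ?thesis
    proof (rule step)
      fix h k d
      assume "is_root h k" "0 < height s h k" "\<not> opposite h k i j" "d \<in> entries UNIV Lam h k"
      moreover from this have "height s h k = 2" "height s i j = - 2"
        using height_cases [OF s, of h k] height_cases [OF s, of i j] ij True by force+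
      ultimately have "commutator (T h k d) (T i j b) \<in> root_group I Gam (\<lambda>i j. 0 \<le> height s i j)"
        using ij by (intro comm) (auto simp: combinations_satisfy_def height_def)
      then show "commutator (T h k d) (T i j b) \<in> Q" using nonneg by auto
    qed (use ij True in auto)
  next
    case False
    then show ?thesis using subsetD [OF nonneg root_groupI [OF ij(1,2)]] by auto
  qed
  have nonneg_or_long: "root_group I Gam (\<lambda>i j. 0 \<le> height s i j \<or> j = - i) \<subseteq> Q"
  proof (rule root_group_subset [OF Q_sub])
    fix i j b assume "is_root i j" "0 \<le> height s i j \<or> j = - i" "b \<in> entries I Gam i j"
    then show "T i j b \<in> Q" using long subsetD [OF nonneg root_groupI] by blast
  qed
  have "T i j b \<in> Q" if ij: "is_root i j" "b \<in> entries I Gam i j" for i j b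
  proof (cases "height s i j < 0 \<and> j \<noteq> - i")
    case True
    show ?thesis
    proof (rule step)
      fix h k d
      assume "is_root h k" "0 < height s h k" "\<not> opposite h k i j" "d \<in> entries UNIV Lam h k"
      moreover from this have "height s h k = 2" "height s i j = - 2"
        using height_cases [OF s, of h k] height_cases [OF s, of i j] ij True by force+
      ultimately have "commutator (T h k d) (T i j b) \<in> root_group I Gam (\<lambda>i j. 0 \<le> height s i j \<or> j = - i)"
        using ij True by (intro comm) (auto simp: combinations_satisfy_def height_def)
      then show "commutator (T h k d) (T i j b) \<in> Q" using nonneg_or_long by auto
    qed (use ij True in auto)
  next
    case False
    then show ?thesis
      using long [OF ij] subsetD [OF nonneg root_groupI [OF ij]] by (cases "j = - i") auto
  qed
  then have "elementary I Gam \<subseteq> Q" by (intro root_group_subset Q_sub) auto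
  then show ?thesis using u x by (auto simp: Q_def)
qed

subsection \<open>Splitting root elements\<close>

lemma short_root_split:
  assumes "is_root i j" "i \<noteq> - j" "h \<in> Omega n" "h \<noteq> i" "h \<noteq> - i" "h \<noteq> j" "h \<noteq> - j"
  shows "T i j (a * b) = commutator (T i h a) (T h j b)"
  using assms by (subst T_short) auto

text \<open>
  A long root element is the second factor in the commutator of an orthogonal long root element with a
  short one of coefficient \<open>1\<close>. The coefficient \<open>\<xi>\<close> is the image of \<open>b\<close> under transport to the other
  long root, which is invertible because \<open>twist (- p) j 1\<close> and \<open>twist j (- p) 1\<close> are inverse units.
\<close>

lemma long_root_split:
  assumes I: "level I Gam" and r: "j \<in> Omega n" "p \<in> Omega n" "p \<noteq> j" "p \<noteq> - j"
    and b: "b \<in> entries I Gam (- j) j"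
  obtains \<xi> where "\<xi> \<in> entries I Gam p (- p)" "\<xi> \<in> I"
    "T (- j) j b = inv (T p j \<xi>) \<otimes> commutator (T p (- p) \<xi>) (T (- p) j 1)"
proof -
  have nz: "j \<noteq> 0" "p \<noteq> 0" using r Omega_nonzero by auto
  define \<xi> where "\<xi> = - twist j (- p) 1 * b * 1"
  have \<xi>: "\<xi> \<in> entries I Gam p (- p)"
    using square_in_entries [OF form_conj [OF I] level_whole _ b _ _ I, of 1 "- p"] nz
    by (auto simp: \<xi>_def)
  have "twist (- p) j 1 * twist j (- p) 1 = 1"
    using twist_mult [of j j 1 1 "- p"] by simp
  then have "- twist (- p) j 1 * \<xi> * 1 = b"
    by (simp add: \<xi>_def flip: mult.assoc)
  moreover have "commutator (T p (- p) \<xi>) (T (- p) j 1)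
      = T p j (\<xi> * 1) \<otimes> T (- j) j (- twist (- p) j 1 * \<xi> * 1)"
    using r \<xi> entries_in_whole [OF I] nz by (intro T_long_short) auto
  ultimately have "commutator (T p (- p) \<xi>) (T (- p) j 1) = T p j \<xi> \<otimes> T (- j) j b"
    by simp
  moreover have "T p j \<xi> \<in> carrier G" "T (- j) j b \<in> carrier G"
    using r b nz T_in [OF I, of "- j" j b] by auto
  ultimately have "T (- j) j b = inv (T p j \<xi>) \<otimes> commutator (T p (- p) \<xi>) (T (- p) j 1)"
    by simp
  then show ?thesis using that \<xi> entries_in_ideal [OF I _ \<xi>] nz by blast
qed

subsection \<open>Generation by conjugates of one radical\<close>

text \<open>
  The subgroup generated by the following conjugates is visibly normalised by the parabolic of sign \<open>-s\<close>.
  It turns out not to depend on the sign, so it is normalised by both parabolics, hence normal.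
\<close>

definition unipotent_conjugates :: "int \<Rightarrow> 'a set \<Rightarrow> 'a set \<Rightarrow> 'g set" where
  "unipotent_conjugates s I Gam =
     {conj_by v u | v u. v \<in> unipotent (- s) UNIV Lam \<and> u \<in> unipotent s I Gam}"

context
  fixes s :: int and I Gam :: "'a set"
  assumes s: "s = 1 \<or> s = -1" and I: "level I Gam"
begin

abbreviation (input) "unipotent_span \<equiv> generate G (unipotent_conjugates s I Gam)"

lemma unipotent_conjugates_closed: "unipotent_conjugates s I Gam \<subseteq> carrier G"
  using unipotent_closed [OF level_whole] unipotent_closed [OF I]
  by (auto simp: unipotent_conjugates_def)

lemma span_subgroup: "subgroup unipotent_span G"
  by (rule generate_is_subgroup [OF unipotent_conjugates_closed])

lemma opposite_parabolic_normalizes_span: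
  assumes g: "g \<in> root_group UNIV Lam (\<lambda>i j. height s i j \<le> 0)" and x: "x \<in> unipotent_span"
  shows "conj_by g x \<in> unipotent_span"
proof (rule conj_by_root_group_closed [OF level_whole _ _ g x])
  show "unipotent_span \<subseteq> carrier G" using span_subgroup subgroup.subset by auto
  fix h k c x
  assume r: "is_root h k" "height s h k \<le> 0" and c: "c \<in> entries UNIV Lam h k" and x: "x \<in> unipotent_span"
  have Tc: "T h k c \<in> carrier G" using r c T_in [OF level_whole] by auto
  show "conj_by (T h k c) x \<in> unipotent_span"
  proof (rule conj_by_generate_subset [OF unipotent_conjugates_closed span_subgroup Tc _ x])
    fix y assume "y \<in> unipotent_conjugates s I Gam"
    then obtain v u where vu: "y = conj_by v u" "v \<in> unipotent (- s) UNIV Lam" "u \<in> unipotent s I Gam"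
      by (auto simp: unipotent_conjugates_def)
    have carr: "v \<in> carrier G" "u \<in> carrier G"
      using vu unipotent_closed [OF level_whole] unipotent_closed [OF I] by auto
    show "conj_by (T h k c) y \<in> unipotent_span"
    proof (cases "height s h k = 0")
      case True
      have "conj_by (T h k c) y = conj_by (conj_by (T h k c) v) (conj_by (T h k c) u)"
        using vu carr Tc by (simp add: group_word_simps)
      moreover have "conj_by (T h k c) v \<in> unipotent (- s) UNIV Lam"
        using parabolic_normalizes_unipotent [OF level_whole, of h k c "- s" v] r c True vu by auto
      moreover have "conj_by (T h k c) u \<in> unipotent s I Gam"
        using parabolic_normalizes_unipotent [OF I, of h k c s u] r c True vu by auto
      ultimately show ?thesis by (auto simp: unipotent_conjugates_def intro!: generate.incl)
    next
      case False
      have "T h k c \<in> unipotent (- s) UNIV Lam"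
        unfolding unipotent_def using r c False by (intro root_groupI) auto
      then have "T h k c \<otimes> v \<in> unipotent (- s) UNIV Lam"
        using vu subgroup.m_closed [OF unipotent_subgroup [OF level_whole]] by auto
      moreover have "conj_by (T h k c) y = conj_by (T h k c \<otimes> v) u"
        using vu carr Tc by (simp add: conj_by_conj_by)
      ultimately show ?thesis
        using vu by (auto simp: unipotent_conjugates_def intro!: generate.incl)
    qed
  qed
qed

lemma commutator_in_span:
  assumes "x \<in> unipotent_span" and g: "g \<in> root_group UNIV Lam (\<lambda>i j. height s i j \<le> 0)"
  shows "commutator x g \<in> unipotent_span" "commutator g x \<in> unipotent_span"
proof -
  have carr: "x \<in> carrier G" "g \<in> carrier G"
    using assms span_subgroup subgroup.subset root_group_closed [OF level_whole] by blast+
  have "conj_by g (inv x) \<in> unipotent_span"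
    using assms subgroup.m_inv_closed [OF span_subgroup] opposite_parabolic_normalizes_span by auto
  then show 1: "commutator x g \<in> unipotent_span"
    using assms carr subgroup.m_closed [OF span_subgroup] by (simp add: commutator_eq_mult_conj_by)
  then show "commutator g x \<in> unipotent_span"
    using inv_commutator [OF carr] subgroup.m_inv_closed [OF span_subgroup 1] by simp
qed

lemma unipotent_in_span: "unipotent s I Gam \<subseteq> unipotent_span"
proof
  fix u assume u: "u \<in> unipotent s I Gam"
  then have "u = conj_by \<one> u" using unipotent_closed [OF I] by simp
  then have "u \<in> unipotent_conjugates s I Gam"
    using u subgroup.one_closed [OF unipotent_subgroup [OF level_whole]]
    unfolding unipotent_conjugates_def by blast
  then show "u \<in> unipotent_span" by (rule generate.incl)
qed

text \<open>
  Starting from the radical of sign \<open>s\<close>, commutators with elements of the opposite parabolic give the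
  short roots of the Levi subgroup, and from these the roots of the opposite radical.
\<close>

lemma elementary_in_span: "elementary I Gam \<subseteq> unipotent_span"
proof (rule root_group_subset [OF span_subgroup])
  have upper: "T i j a \<in> unipotent_span" if "is_root i j" "a \<in> entries I Gam i j" "0 < height s i j" for i j a
    using that unipotent_in_span unfolding unipotent_def by (auto intro: root_groupI)
  have lower: "T i j 1 \<in> root_group UNIV Lam (\<lambda>i j. height s i j \<le> 0)"
    if "is_root i j" "j \<noteq> - i" "height s i j \<le> 0" for i j
    using that by (intro root_groupI) (auto simp: entries_short)
  have levi1: "T i j a \<in> unipotent_span" if r: "is_root i j" "s * i > 0" "s * j > 0" "j \<noteq> - i" and a: "a \<in> I" for i j a
  proof -
    obtain h where h: "h \<in> Omega n" "s * h > 0" "h \<noteq> i" "h \<noteq> - i" "h \<noteq> j" "h \<noteq> - j"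
      using third_index [OF rank s] .
    have "T i j (a * 1) = commutator (T i (- h) a) (T (- h) j 1)"
      using r h by (intro short_root_split) auto
    moreover have "T i (- h) a \<in> unipotent_span" using r h a s
      by (intro upper) (auto simp: entries_short height_def sgn_if)
    moreover have "T (- h) j 1 \<in> root_group UNIV Lam (\<lambda>i j. height s i j \<le> 0)"
      using r h s by (intro lower) (auto simp: height_def sgn_if)
    ultimately show ?thesis using commutator_in_span by auto
  qed
  fix i j a assume r: "is_root i j" and a: "a \<in> entries I Gam i j"
  have nz: "i \<noteq> 0" "j \<noteq> 0" using r Omega_nonzero by auto
  show "T i j a \<in> unipotent_span"
  proof (rule height_cases [OF s r])
    assume "height s i j = 2"
    then show ?thesis using upper r a by auto
  next
    assume "s * i > 0" "s * j > 0" "j \<noteq> - i"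
    then show ?thesis using levi1 r a by (auto simp: entries_short)
  next
    assume *: "s * i < 0" "s * j < 0" "j \<noteq> - i"
    have "T i j a = T (- j) (- i) (- twist i j a)"
      using r * by (intro T_flip) (auto simp: entries_short)
    moreover have "- twist i j a \<in> I"
      using entries_flip [OF I _ a] nz * by (auto simp: entries_short)
    ultimately show ?thesis using levi1 [of "- j" "- i"] r * by auto
  next
    assume *: "s * i < 0" "s * j > 0" "height s i j = - 2"
    obtain h where h: "h \<in> Omega n" "s * h > 0" "h \<noteq> i" "h \<noteq> - i" "h \<noteq> j" "h \<noteq> - j"
      using third_index [OF rank s] .
    show ?thesis
    proof (cases "j = - i")
      case False
      have "T i j (1 * a) = commutator (T i h 1) (T h j a)"
        using r h False by (intro short_root_split) auto
      moreover have "T i h 1 \<in> root_group UNIV Lam (\<lambda>i j. height s i j \<le> 0)"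
        using r h s * by (intro lower) (auto simp: height_def sgn_if)
      moreover have "T h j a \<in> unipotent_span" using r h * a False by (intro levi1) (auto simp: entries_short)
      ultimately show ?thesis using commutator_in_span by auto
    next
      case True
      then have ij: "i = - j" by simp
      then have a': "a \<in> entries I Gam (- j) j" using a by simp
      obtain \<xi> where \<xi>: "\<xi> \<in> entries I Gam h (- h)" "\<xi> \<in> I"
        "T (- j) j a = inv (T h j \<xi>) \<otimes> commutator (T h (- h) \<xi>) (T (- h) j 1)"
        using long_root_split [OF I _ _ _ _ a', of h] h r by auto
      have "T h j \<xi> \<in> unipotent_span" using r h * \<xi> by (intro levi1) auto
      moreover have "T h (- h) \<xi> \<in> unipotent_span" using \<xi> h s
        by (intro upper) (auto simp: height_def sgn_if)
      moreover have "T (- h) j 1 \<in> root_group UNIV Lam (\<lambda>i j. height s i j \<le> 0)"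
        using r h s * by (intro lower) (auto simp: height_def sgn_if)
      ultimately show ?thesis
        using ij \<xi>(3) commutator_in_span subgroup.m_inv_closed [OF span_subgroup] subgroup.m_closed [OF span_subgroup]
        by auto
    qed
  qed
qed

text \<open>
  Split the root element into a commutator whose factors, after conjugation, lie in the span and in the
  opposite parabolic respectively. For a long root this requires taking the long factor in the radical
  of sign \<open>s\<close>: it is then fixed by the conjugation, and the short factor of coefficient \<open>1\<close> stays in
  the opposite parabolic.
\<close>

lemma opposite_conjugate_in_span:
  assumes r: "is_root i j" "height s i j < 0"
    and b: "b \<in> entries I Gam i j" and c: "c \<in> entries UNIV Lam j i"
  shows "conj_by (T j i c) (T i j b) \<in> unipotent_span"
proof -
  have ij: "s * i < 0" "s * j > 0" "height s i j = - 2"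
    using height_cases [OF s r(1)] r(2) by force+
  have nz: "i \<noteq> 0" "j \<noteq> 0" using r Omega_nonzero by auto
  obtain h where h: "h \<in> Omega n" "s * h > 0" "h \<noteq> i" "h \<noteq> - i" "h \<noteq> j" "h \<noteq> - j"
    using third_index [OF rank s] .
  have Tc: "T j i c \<in> carrier G" using T_in [OF level_whole] r c by auto
  have inK: "conj_by (T j i c) (T p q a) \<in> unipotent_span"
    if "is_root p q" "\<not> opposite j i p q" "a \<in> entries I Gam p q" for p q a
    using conj_by_not_opposite [OF I _ that(1,2) c that(3)] r elementary_in_span by auto
  show ?thesis
  proof (cases "j = - i")
    case False
    have "T i j (1 * b) = commutator (T i h 1) (T h j b)"
      using r h False by (intro short_root_split) auto
    then have "conj_by (T j i c) (T i j b)
        = commutator (conj_by (T j i c) (T i h 1)) (conj_by (T j i c) (T h j b))"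
      using r h Tc False by (simp add: conj_by_commutator)
    moreover have "conj_by (T j i c) (T h j b) \<in> unipotent_span"
      using r h b False nz by (intro inK) (auto simp: opposite_def entries_short)
    moreover have "conj_by (T j i c) (T i h 1) \<in> root_group UNIV Lam (\<lambda>i j. height s i j \<le> 0)"
    proof (rule conj_height [where s = s, OF level_whole])
      have "height s j i = 2" "height s i h = - 2"
        using ij h s by (auto simp: height_def sgn_if)
      then show "height s p q \<le> 0" if "height s p q = height s j i + height s i h \<or>
          q = - p \<and> h = - i \<and> i \<noteq> - j \<and> height s p q = 2 * height s j i + height s i h \<or>
          q = - p \<and> i = - j \<and> h \<noteq> - i \<and> height s p q = height s j i + 2 * height s i h" for p q
        using that h by auto
      show "height s i h \<le> 0" using \<open>height s i h = - 2\<close> by simp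
    qed (use r h c False in \<open>auto simp: opposite_def entries_short\<close>)
    ultimately show ?thesis using commutator_in_span by auto
  next
    case True
    then have i: "i = - j" by simp
    then have b': "b \<in> entries I Gam (- j) j" using b by simp
    obtain \<xi> where \<xi>: "\<xi> \<in> entries I Gam h (- h)" "\<xi> \<in> I"
      "T (- j) j b = inv (T h j \<xi>) \<otimes> commutator (T h (- h) \<xi>) (T (- h) j 1)"
      using long_root_split [OF I _ _ _ _ b', of h] h r by auto
    have carr: "T h j \<xi> \<in> carrier G" "T h (- h) \<xi> \<in> carrier G" "T (- h) j 1 \<in> carrier G"
      using r h \<xi> T_in [OF I, of h "- h" \<xi>] Omega_nonzero [of h n] by auto
    have "conj_by (T j i c) (T i j b) = inv (conj_by (T j i c) (T h j \<xi>))
        \<otimes> commutator (conj_by (T j i c) (T h (- h) \<xi>)) (conj_by (T j i c) (T (- h) j 1))"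
      using i \<xi>(3) carr Tc by (simp add: conj_by_mult conj_by_inv conj_by_commutator)
    moreover have "conj_by (T j i c) (T h j \<xi>) \<in> unipotent_span"
      using r h \<xi> i nz by (intro inK) (auto simp: opposite_def entries_short)
    moreover have "conj_by (T j i c) (T h (- h) \<xi>) \<in> unipotent_span"
      using r h \<xi> i nz Omega_nonzero [of h n] by (intro inK) (auto simp: opposite_def)
    moreover have "conj_by (T j i c) (T (- h) j 1) \<in> root_group UNIV Lam (\<lambda>i j. height s i j \<le> 0)"
    proof (rule conj_height [where s = s, OF level_whole])
      have "height s j i = 2" "height s (- h) j = - 2"
        using ij h s by (auto simp: height_def sgn_if)
      then show "height s p q \<le> 0" if "height s p q = height s j i + height s (- h) j \<or>
          q = - p \<and> j = - (- h) \<and> i \<noteq> - j \<and> height s p q = 2 * height s j i + height s (- h) j \<or>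
          q = - p \<and> i = - j \<and> j \<noteq> - (- h) \<and> height s p q = height s j i + 2 * height s (- h) j" for p q
        using that h by auto
      show "height s (- h) j \<le> 0" using \<open>height s (- h) j = - 2\<close> by simp
    qed (use r h c i nz in \<open>auto simp: opposite_def entries_short\<close>)
    ultimately show ?thesis
      using commutator_in_span subgroup.m_inv_closed [OF span_subgroup] subgroup.m_closed [OF span_subgroup]
      by auto
  qed
qed

lemma opposite_span_subset: "generate G (unipotent_conjugates (- s) I Gam) \<subseteq> unipotent_span"
proof (rule generate_subgroup_incl [OF _ span_subgroup])
  show "unipotent_conjugates (- s) I Gam \<subseteq> unipotent_span"
    using conj_by_unipotent_in [OF s I span_subgroup elementary_in_span opposite_conjugate_in_span]
      unipotent_elementary [OF I]
    by (auto simp: unipotent_conjugates_def)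
qed

end

lemma generate_unipotent_conjugates_opposite:
  assumes "s = 1 \<or> s = -1" "level I Gam"
  shows "generate G (unipotent_conjugates (- s) I Gam) = generate G (unipotent_conjugates s I Gam)"
proof -
  have "- s = 1 \<or> - s = - 1" using assms(1) by auto
  from opposite_span_subset [OF this assms(2)] opposite_span_subset [OF assms] show ?thesis by auto
qed

lemma unipotent_conjugates_normal:
  assumes s: "s = 1 \<or> s = -1" and I: "level I Gam"
  shows "generate G (unipotent_conjugates s I Gam) \<lhd> G"
proof -
  let ?K = "generate G (unipotent_conjugates s I Gam)"
  have sub: "subgroup ?K G" using span_subgroup s I by auto
  have "conj_by g x \<in> ?K" if g: "g \<in> carrier G" and x: "x \<in> ?K" for g x
  proof (rule conj_by_root_group_closed [OF level_whole _ _ g [unfolded carrier_eq] x])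
    fix i j a x assume ij: "is_root i j" "a \<in> entries UNIV Lam i j" and x: "x \<in> ?K"
    show "conj_by (T i j a) x \<in> ?K"
    proof (cases "height s i j \<le> 0")
      case True
      then show ?thesis
        using opposite_parabolic_normalizes_span [OF s I root_groupI x] ij by auto
    next
      case False
      have s': "- s = 1 \<or> - s = - 1" using s by auto
      have x': "x \<in> generate G (unipotent_conjugates (- s) I Gam)"
        using x generate_unipotent_conjugates_opposite [OF s I] by simp
      show ?thesis
        using opposite_parabolic_normalizes_span [OF s' I root_groupI x', of i j a] ij False
          generate_unipotent_conjugates_opposite [OF s I] by auto
    qed
  qed (use sub subgroup.subset in auto)
  then show ?thesis
    using sub normal_inv_iff by (simp add: conj_by_def)
qed

lemma normal_closure_elementary_subset:
  assumes "s = 1 \<or> s = -1" "level I Gam"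
  shows "normal_closure G (elementary I Gam) \<subseteq> generate G (unipotent_conjugates s I Gam)"
  unfolding normal_closure_def
  using unipotent_conjugates_normal [OF assms] elementary_in_span [OF assms] by blast

end

section \<open>The mixed commutator subgroup\<close>

lemma (in group) commutator_centralized_mod:
  assumes N: "N \<lhd> G"
    and carr: "g \<in> carrier G" "x \<in> carrier G" "z \<in> carrier G"
    and mod: "commutator (commutator g x) z \<in> N" "commutator (commutator g x) (commutator g z) \<in> N"
      "commutator x (commutator g z) \<in> N" "commutator (commutator (inv x) g) z \<in> N"
      "commutator x (commutator (inv z) g) \<in> N"
  shows "commutator g (commutator x z) \<in> N"
proof -
  interpret Q: group "G Mod N" using N by (rule normal.factorgroup_is_group)
  define \<pi> where "\<pi> = (\<lambda>a. N #> a)"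
  have hom: "\<pi> \<in> hom G (G Mod N)" unfolding \<pi>_def using N by (rule normal.r_coset_hom_Mod)
  interpret P: group_hom G "G Mod N" \<pi>
    using hom by unfold_locales
  have comm: "\<pi> (commutator a b) = Q.commutator (\<pi> a) (\<pi> b)" if "a \<in> carrier G" "b \<in> carrier G" for a b
    using that by (simp add: commutator_def Q.commutator_def)
  have one: "\<pi> a = N \<longleftrightarrow> a \<in> N" if "a \<in> carrier G" for a
    using that N unfolding \<pi>_def
    by (meson normal_imp_subgroup coset_join1 coset_join2 subgroup.subset is_group)
  have "Q.commutator (\<pi> g) (Q.commutator (\<pi> x) (\<pi> z)) = \<one>\<^bsub>G Mod N\<^esub>"
    by (rule Q.commutator_centralized)
      (use carr mod in \<open>simp_all add: comm [symmetric] one P.hom_inv [symmetric] del: P.hom_inv\<close>)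
  then show ?thesis using carr by (simp add: comm [symmetric] one)
qed

lemma mixed_commutator_mono:
  assumes "group G" "H \<subseteq> H'" "K \<subseteq> K'"
  shows "mixed_commutator G H K \<subseteq> mixed_commutator G H' K'"
  unfolding mixed_commutator_def
  by (rule group.mono_generate [OF assms(1)]) (use assms in blast)

context group
begin

lemma mixed_commutator_eq:
  "mixed_commutator G H K = generate G {commutator x y | x y. x \<in> H \<and> y \<in> K}"
  by (simp add: mixed_commutator_def commutator_def)

lemma commutator_in_mixed: "x \<in> H \<Longrightarrow> y \<in> K \<Longrightarrow> commutator x y \<in> mixed_commutator G H K"
  unfolding mixed_commutator_eq by (intro generate.incl) blast

lemma mixed_commutator_subgroup:
  "H \<subseteq> carrier G \<Longrightarrow> K \<subseteq> carrier G \<Longrightarrow> subgroup (mixed_commutator G H K) G"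
  unfolding mixed_commutator_eq by (intro generate_is_subgroup) (auto intro!: commutator_closed)

lemma mixed_commutator_le:
  "subgroup N G \<Longrightarrow> (\<And>x y. x \<in> H \<Longrightarrow> y \<in> K \<Longrightarrow> commutator x y \<in> N) \<Longrightarrow> mixed_commutator G H K \<subseteq> N"
  unfolding mixed_commutator_eq by (intro generate_subgroup_incl) auto

lemma mixed_commutator_commute:
  assumes "H \<subseteq> carrier G" "K \<subseteq> carrier G"
  shows "mixed_commutator G H K = mixed_commutator G K H"
proof -
  have le: "mixed_commutator G H K \<subseteq> mixed_commutator G K H"
    if HK: "H \<subseteq> carrier G" "K \<subseteq> carrier G" for H K
  proof (rule mixed_commutator_le)
    show sub: "subgroup (mixed_commutator G K H) G" using HK by (rule mixed_commutator_subgroup [rotated])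
    fix x y assume "x \<in> H" "y \<in> K"
    then have "commutator y x \<in> mixed_commutator G K H" "x \<in> carrier G" "y \<in> carrier G"
      using HK commutator_in_mixed by auto
    then show "commutator x y \<in> mixed_commutator G K H"
      using subgroup.m_inv_closed [OF sub] inv_commutator [of y x] by metis
  qed
  show ?thesis using le [OF assms] le [OF assms(2,1)] by auto
qed

lemma normal_central_mod:
  assumes N: "N \<lhd> G"
  shows "{z \<in> carrier G. \<forall>e\<in>carrier G. commutator z e \<in> N} \<lhd> G"
proof -
  let ?Z = "{z \<in> carrier G. \<forall>e\<in>carrier G. commutator z e \<in> N}"
  have "conj_by g z \<in> ?Z" if g: "g \<in> carrier G" and z: "z \<in> ?Z" for g z
  proof -
    have "commutator (conj_by g z) e \<in> N" if e: "e \<in> carrier G" for e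
    proof -
      have "commutator (conj_by g z) e = conj_by g (commutator z (conj_by (inv g) e))"
        using g z e by (simp add: group_word_simps)
      then show ?thesis using g z e conj_by_in_normal [OF N g] by auto
    qed
    then show ?thesis using g z by auto
  qed
  then show ?thesis
    using subgroup_centralizer_mod [OF N subset_refl] normal_inv_iff by (simp add: conj_by_def)
qed

end

context unitary_relations
begin

lemma T_diff:
  assumes "is_root i j" "a \<in> entries UNIV Lam i j" "b \<in> entries UNIV Lam i j"
  shows "T i j (a - b) = T i j a \<otimes> inv (T i j b)"
  using assms T_add [of i j a "- b"] T_uminus [of i j b] entries_uminus [OF level_whole, of i b j]
    Omega_nonzero [of i n] by simp

lemma elementary_closed: "level I Gam \<Longrightarrow> elementary I Gam \<subseteq> carrier G"
  using root_group_closed by blast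

lemma conj_commutator_in_mixed:
  assumes I: "level I Gam" and J: "level J Del" and g: "is_root h k" "c \<in> entries UNIV Lam h k"
    and a: "is_root p q" "\<not> opposite h k p q" "a \<in> entries I Gam p q"
    and b: "is_root r t" "\<not> opposite h k r t" "b \<in> entries J Del r t"
  shows "conj_by (T h k c) (commutator (T p q a) (T r t b))
    \<in> mixed_commutator G (elementary I Gam) (elementary J Del)"
proof -
  have "T h k c \<in> carrier G" "T p q a \<in> carrier G" "T r t b \<in> carrier G"
    using g a b T_in [OF level_whole] T_in [OF I] T_in [OF J] by auto
  then show ?thesis
    using conj_by_not_opposite [OF I g(1) a(1,2) g(2) a(3)] conj_by_not_opposite [OF J g(1) b(1,2) g(2) b(3)]
    by (simp add: conj_by_commutator commutator_in_mixed)
qed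

text \<open>
  A long root element with coefficient \<open>b g bar b\<close> arises, up to a short root element, as a commutator
  of a long root element of one level with a short root element of the other.
\<close>

lemma conj_long_square_in_mixed:
  assumes I: "level I Gam" and J: "level J Del" and H: "H = mixed_commutator G (elementary I Gam) (elementary J Del)"
    and i: "i \<in> Omega n" and c: "c \<in> entries UNIV Lam (- i) i"
    and short: "\<And>j a b. \<lbrakk>j \<in> Omega n; j \<noteq> i; j \<noteq> - i; a \<in> I; b \<in> J\<rbrakk>
      \<Longrightarrow> conj_by (T (- i) i c) (T j (- i) (a * b)) \<in> H"
    and b: "b \<in> J" and g: "g \<in> Gam"
  shows "conj_by (T (- i) i c) (T i (- i) (bar (lam_at i) * (b * g * bar b))) \<in> H"
proof -
  obtain j where j: "j \<in> Omega n" "j \<noteq> i" "j \<noteq> - i"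
    using third_index [OF rank, of 1 i i] by auto
  have nz: "i \<noteq> 0" "j \<noteq> 0" using i j Omega_nonzero by auto
  have sub: "subgroup H G" unfolding H
    by (intro mixed_commutator_subgroup elementary_closed I J)
  \<comment> \<open>The sign compensates for the minus sign of the long factor of the commutator.\<close>
  define \<xi> where "\<xi> = bar (lam_at j) * (- g)"
  have \<xi>: "\<xi> \<in> entries I Gam j (- j)"
    unfolding \<xi>_def entries_long [OF nz(2)] using form_uminus [OF I g] by blast
  have bJ: "bar b \<in> J" using level_bar [OF J b] .
  have "- twist (- j) (- i) (bar b) * \<xi> * bar b = bar (lam_at i) * (b * g * bar b)"
    using twist_form_conj [of "- j" "- i" "bar b" g] nz by (simp add: \<xi>_def bar_bar)
  then have "commutator (T j (- j) \<xi>) (T (- j) (- i) (bar b))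
      = T j (- i) (\<xi> * bar b) \<otimes> T i (- i) (bar (lam_at i) * (b * g * bar b))"
    using T_long_short [of j "- i" \<xi> "bar b"] i j \<xi> entries_in_whole [OF I nz(2)] by auto
  moreover have ge: "bar (lam_at i) * (b * g * bar b) \<in> entries UNIV Lam i (- i)"
    using form_conj [OF I g, of b] form_in_Lam [OF I] nz by (auto simp: entries_long)
  have carr: "T j (- i) (\<xi> * bar b) \<in> carrier G" "T i (- i) (bar (lam_at i) * (b * g * bar b)) \<in> carrier G"
    "T (- i) i c \<in> carrier G" "T j (- j) \<xi> \<in> carrier G" "T (- j) (- i) (bar b) \<in> carrier G"
    using i j c nz ge \<xi> T_in [OF level_whole, of i "- i"] T_in [OF level_whole, of "- i" i] T_in [OF I, of j "- j" \<xi>]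
    by auto
  ultimately have "T i (- i) (bar (lam_at i) * (b * g * bar b))
      = inv (T j (- i) (\<xi> * bar b)) \<otimes> commutator (T j (- j) \<xi>) (T (- j) (- i) (bar b))"
    by simp
  then have "conj_by (T (- i) i c) (T i (- i) (bar (lam_at i) * (b * g * bar b)))
      = inv (conj_by (T (- i) i c) (T j (- i) (\<xi> * bar b)))
        \<otimes> conj_by (T (- i) i c) (commutator (T j (- j) \<xi>) (T (- j) (- i) (bar b)))"
    using carr by (simp add: conj_by_mult conj_by_inv)
  moreover have "conj_by (T (- i) i c) (T j (- i) (\<xi> * bar b)) \<in> H"
    using short i j entries_in_ideal [OF I nz(2) \<xi>] bJ by auto
  moreover have "conj_by (T (- i) i c) (commutator (T j (- j) \<xi>) (T (- j) (- i) (bar b))) \<in> H"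
    unfolding H using i j c \<xi> bJ nz
    by (intro conj_commutator_in_mixed I J) (auto simp: opposite_def entries_short)
  ultimately show ?thesis
    using subgroup.m_closed [OF sub] subgroup.m_inv_closed [OF sub] by auto
qed

context
  fixes I Gam J Del :: "'a set"
  assumes I: "level I Gam" and J: "level J Del"
begin

abbreviation (input) "H \<equiv> mixed_commutator G (elementary I Gam) (elementary J Del)"
abbreviation (input) "P \<equiv> ideal_prod I J"
abbreviation (input) "\<Theta> \<equiv> form_prod I Gam J Del"

lemma product_level: "level P \<Theta>"
  by (rule level_prod [OF I J])

lemma mixed_subgroup: "subgroup H G"
  by (intro mixed_commutator_subgroup elementary_closed I J)

lemma mixed_commute: "H = mixed_commutator G (elementary J Del) (elementary I Gam)"
  by (intro mixed_commutator_commute elementary_closed I J)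

subsection \<open>Elementary subgroups of the product level\<close>

text \<open>
  Every root element of the product level is made from commutators of root elements for roots
  different from its own. Conjugation by the opposite root subgroup leaves the factors of such a
  commutator inside the two elementary subgroups.
\<close>

lemma short_product_in_mixed:
  assumes r: "is_root i j" "j \<noteq> - i" and c: "c \<in> entries UNIV Lam j i" and x: "x \<in> P"
  shows "conj_by (T j i c) (T i j x) \<in> H"
proof -
  have ij: "i \<noteq> - j" using r by auto
  have Tc: "T j i c \<in> carrier G" using r c T_in [OF level_whole] by auto
  have "x \<in> {x. conj_by (T j i c) (T i j x) \<in> H}"
  proof (rule group_closure_minimal [OF x [unfolded ideal_prod_def]])
    show "0 \<in> {x. conj_by (T j i c) (T i j x) \<in> H}"
      using r Tc T_zero [of i j] subgroup.one_closed [OF mixed_subgroup] by (simp add: conj_by_def)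
    show "x - y \<in> {x. conj_by (T j i c) (T i j x) \<in> H}"
      if "x \<in> {x. conj_by (T j i c) (T i j x) \<in> H}" "y \<in> {x. conj_by (T j i c) (T i j x) \<in> H}" for x y
      using that r Tc T_diff [of i j x y] subgroup.m_closed [OF mixed_subgroup] subgroup.m_inv_closed [OF mixed_subgroup]
      by (simp add: entries_short conj_by_mult conj_by_inv)
    obtain h where h: "h \<in> Omega n" "h \<noteq> i" "h \<noteq> - i" "h \<noteq> j" "h \<noteq> - j"
      using third_index [OF rank, of 1 i j] by auto
    have split: "T i j (a * b) = commutator (T i h a) (T h j b)" for a b
      using short_root_split [OF r(1) ij h] .
    show "{x. \<exists>a\<in>I. \<exists>b\<in>J. x = a * b \<or> x = b * a} \<subseteq> {x. conj_by (T j i c) (T i j x) \<in> H}"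
    proof safe
      fix a b assume ab: "a \<in> I" "b \<in> J"
      show "conj_by (T j i c) (T i j (a * b)) \<in> H"
        unfolding split using r h ab c Omega_nonzero
        by (intro conj_commutator_in_mixed I J) (auto simp: opposite_def entries_short)
      show "conj_by (T j i c) (T i j (b * a)) \<in> H"
        unfolding split mixed_commute using r h ab c Omega_nonzero
        by (intro conj_commutator_in_mixed I J) (auto simp: opposite_def entries_short)
    qed
  qed
  then show ?thesis by simp
qed

lemma long_product_in_mixed:
  assumes i: "i \<in> Omega n" and c: "c \<in> entries UNIV Lam (- i) i"
    and short: "\<And>j z. \<lbrakk>j \<in> Omega n; j \<noteq> i; j \<noteq> - i; z \<in> P\<rbrakk> \<Longrightarrow> conj_by (T (- i) i c) (T j (- i) z) \<in> H"
    and x: "x \<in> entries P \<Theta> i (- i)"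
  shows "conj_by (T (- i) i c) (T i (- i) x) \<in> H"
proof -
  let ?g = "T (- i) i c"
  have nz: "i \<noteq> 0" and ri: "is_root i (- i)" using i Omega_nonzero by auto
  have Tc: "?g \<in> carrier G" using i c nz T_in [OF level_whole, of "- i" i] by auto
  have prods: "a * b \<in> P" "b * a \<in> P" if "a \<in> I" "b \<in> J" for a b
    using multiplies_into_prod [OF I J] that by (auto simp: multiplies_into_def)
  have one: "conj_by ?g (T i (- i) 0) \<in> H"
    using ri Tc T_zero [of i "- i"] subgroup.one_closed [OF mixed_subgroup] by (simp add: conj_by_def)
  have diff: "conj_by ?g (T i (- i) (x - y)) \<in> H"
    if "conj_by ?g (T i (- i) x) \<in> H" "conj_by ?g (T i (- i) y) \<in> H"
      "x \<in> entries UNIV Lam i (- i)" "y \<in> entries UNIV Lam i (- i)" for x y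
    using that ri Tc T_diff [of i "- i" x y] T_in [OF level_whole ri]
      subgroup.m_closed [OF mixed_subgroup] subgroup.m_inv_closed [OF mixed_subgroup]
    by (simp add: conj_by_mult conj_by_inv)
  have sym: "conj_by ?g (T i (- i) (y - twist i (- i) y)) \<in> H" if y: "y \<in> P" for y
  proof -
    obtain j where j: "j \<in> Omega n" "j \<noteq> i" "j \<noteq> - i"
      using third_index [OF rank, of 1 i i] by auto
    have ent: "y - twist i (- i) y \<in> entries UNIV Lam i (- i)" for y
      using symmetrized_in_entries [OF form_symmetrized [OF level_whole] level_whole] nz by auto
    have "y \<in> {y. conj_by ?g (T i (- i) (y - twist i (- i) y)) \<in> H}"
    proof (rule group_closure_minimal [OF y [unfolded ideal_prod_def]])
      show "u - v \<in> {y. conj_by ?g (T i (- i) (y - twist i (- i) y)) \<in> H}"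
        if "u \<in> {y. conj_by ?g (T i (- i) (y - twist i (- i) y)) \<in> H}"
          "v \<in> {y. conj_by ?g (T i (- i) (y - twist i (- i) y)) \<in> H}" for u v
      proof -
        have "(u - v) - twist i (- i) (u - v) = (u - twist i (- i) u) - (v - twist i (- i) v)"
          by (simp add: twist_diff algebra_simps)
        with diff [OF _ _ ent ent, of u v] that show ?thesis by (simp only: mem_Collect_eq)
      qed
      have split: "T i (- i) (a * b - twist i (- i) (a * b)) = commutator (T i j a) (T j (- i) b)" for a b
        using i j by (subst T_short_long) auto
      show "{x. \<exists>a\<in>I. \<exists>b\<in>J. x = a * b \<or> x = b * a}
          \<subseteq> {y. conj_by ?g (T i (- i) (y - twist i (- i) y)) \<in> H}"
      proof safe
        fix a b assume ab: "a \<in> I" "b \<in> J"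
        show "conj_by ?g (T i (- i) (a * b - twist i (- i) (a * b))) \<in> H"
          unfolding split using i j ab c nz
          by (intro conj_commutator_in_mixed I J) (auto simp: opposite_def entries_short)
        show "conj_by ?g (T i (- i) (b * a - twist i (- i) (b * a))) \<in> H"
          unfolding split mixed_commute using i j ab c nz
          by (intro conj_commutator_in_mixed I J) (auto simp: opposite_def entries_short)
      qed
    qed (use one in auto)
    then show ?thesis by simp
  qed
  obtain z where z: "z \<in> \<Theta>" "x = bar (lam_at i) * z" using x entries_long [OF nz] by auto
  let ?S = "{z \<in> Lam. conj_by ?g (T i (- i) (bar (lam_at i) * z)) \<in> H}"
  have "z \<in> ?S"
  proof (rule group_closure_minimal [OF z(1) [unfolded form_prod_def]])
    show "0 \<in> ?S" using one form_zero [OF level_whole] by simp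
    show "u - v \<in> ?S" if "u \<in> ?S" "v \<in> ?S" for u v
    proof -
      have "bar (lam_at i) * u \<in> entries UNIV Lam i (- i)" "bar (lam_at i) * v \<in> entries UNIV Lam i (- i)"
        using that nz by (auto simp: entries_long)
      then show ?thesis using that diff form_diff [OF level_whole] by (simp add: right_diff_distrib)
    qed
    have 1: "x - lam * bar x \<in> ?S" if "x \<in> P" for x
    proof -
      define y where "y = bar (lam_at i) * x"
      have "lam * bar x = lam_at i * twist i (- i) y"
      proof -
        have "twist i (- i) y = lam_at (- i) * bar (lam_at i) * (bar x * lam_at i)"
          by (simp only: y_def twist_def bar_mult bar_bar)
        also have "bar x * lam_at i = lam_at i * bar x" by (rule lam_at_central [symmetric])
        finally show ?thesis using nz by (auto simp: lam_at_def mult.assoc)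
      qed
      then have "bar (lam_at i) * (x - lam * bar x) = y - twist i (- i) y"
        by (simp add: y_def right_diff_distrib)
      moreover have "y \<in> P" using that level_mult_left [OF product_level] by (simp add: y_def)
      ultimately show ?thesis using sym form_symmetrized [OF level_whole] by auto
    qed
    have 2: "b * g * bar b \<in> ?S" if "b \<in> J" "g \<in> Gam" for b g
      using conj_long_square_in_mixed [OF I J refl i c _ that] short prods that
        form_conj [OF level_whole] form_in_Lam [OF I] by auto
    have 3: "a * d * bar a \<in> ?S" if "a \<in> I" "d \<in> Del" for a d
      using conj_long_square_in_mixed [OF J I mixed_commute i c _ that] short prods that
        form_conj [OF level_whole] form_in_Lam [OF J] by auto
    show "{x - lam * bar x |x. x \<in> P} \<union> {b * g * bar b |b g. b \<in> J \<and> g \<in> Gam}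
        \<union> {a * d * bar a |a d. a \<in> I \<and> d \<in> Del} \<subseteq> ?S"
      using 1 2 3 by auto
  qed
  then show ?thesis using z by auto
qed

lemma elementary_product_in_mixed: "elementary P \<Theta> \<subseteq> H"
proof (rule root_group_subset [OF mixed_subgroup])
  have zero: "0 \<in> entries UNIV Lam j i" if "is_root i j" for i j
    using that entries_zero [OF level_whole] Omega_nonzero by blast
  have short: "T i j a \<in> H" if "is_root i j" "j \<noteq> - i" "a \<in> P" for i j a
    using short_product_in_mixed [OF that(1,2) zero that(3)] that T_zero [of j i] by simp
  fix i j a assume r: "is_root i j" and a: "a \<in> entries P \<Theta> i j"
  show "T i j a \<in> H"
  proof (cases "j = - i")
    case False
    then show ?thesis using short r a by (auto simp: entries_short)
  next
    case True
    have T1: "T (- i) i 0 = \<one>" using T_zero [of "- i" i] r True by auto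
    have "conj_by (T (- i) i 0) (T i (- i) a) \<in> H"
    proof (rule long_product_in_mixed)
      show "0 \<in> entries UNIV Lam (- i) i" using zero [of i "- i"] r True by auto
      show "conj_by (T (- i) i 0) (T j (- i) z) \<in> H"
        if "j \<in> Omega n" "j \<noteq> i" "j \<noteq> - i" "z \<in> P" for j z
        using short [of j "- i" z] that r T1 by simp
    qed (use r a True in auto)
    then show ?thesis using T1 r a True T_in [OF product_level] by simp
  qed
qed

lemma opposite_conjugate_product_in_mixed:
  assumes r: "is_root i j" and b: "b \<in> entries P \<Theta> i j" and c: "c \<in> entries UNIV Lam j i"
  shows "conj_by (T j i c) (T i j b) \<in> H"
proof (cases "j = - i")
  case False
  then show ?thesis using short_product_in_mixed r b c by (auto simp: entries_short)
next
  case True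
  have nz: "i \<noteq> 0" using r Omega_nonzero by auto
  have "conj_by (T (- i) i c) (T i (- i) b) \<in> H"
  proof (rule long_product_in_mixed)
    show "conj_by (T (- i) i c) (T h (- i) z) \<in> H"
      if "h \<in> Omega n" "h \<noteq> i" "h \<noteq> - i" "z \<in> P" for h z
    proof (rule subsetD [OF elementary_product_in_mixed conj_by_not_opposite [OF product_level]])
    qed (use that r True c nz in \<open>auto simp: opposite_def entries_short\<close>)
  qed (use r b c True in auto)
  then show ?thesis using True by simp
qed

text \<open>
  This is the relative elementary group of the product level, described by its generators.
\<close>

definition product_closure :: "'g set" where
  "product_closure = generate G (unipotent_conjugates 1 (ideal_prod I J) (form_prod I Gam J Del))"

lemma product_closure_normal: "product_closure \<lhd> G"
  unfolding product_closure_def by (rule unipotent_conjugates_normal [OF _ product_level]) simp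

lemma elementary_product_in_closure: "elementary P \<Theta> \<subseteq> product_closure"
  unfolding product_closure_def by (rule elementary_in_span [OF _ product_level]) simp

lemma product_closure_in_mixed: "product_closure \<subseteq> H"
  unfolding product_closure_def
proof (rule generate_subgroup_incl [OF _ mixed_subgroup])
  show "unipotent_conjugates 1 P \<Theta> \<subseteq> H"
    using conj_by_unipotent_in [OF _ product_level mixed_subgroup elementary_product_in_mixed opposite_conjugate_product_in_mixed, of "-1"]
      unipotent_elementary [OF product_level, of 1]
    by (auto simp: unipotent_conjugates_def)
qed

subsection \<open>Commutators of opposite root elements are central modulo the product level\<close>

lemma commutator_not_opposite_mod:
  assumes "x \<in> root_group I Gam R" "y \<in> root_group J Del S"
    and "\<And>h k i j. is_root h k \<Longrightarrow> is_root i j \<Longrightarrow> R h k \<Longrightarrow> S i j \<Longrightarrow> \<not> opposite h k i j"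
  shows "commutator x y \<in> product_closure"
proof (rule commutator_generate_mod [OF product_closure_normal root_generators_closed [OF I] root_generators_closed [OF J] _
      assms(1,2) [unfolded root_group_def]])
  fix x y assume "x \<in> root_generators I Gam R" "y \<in> root_generators J Del S"
  then obtain h k c i j a where "x = T h k c" "is_root h k" "R h k" "c \<in> entries I Gam h k"
    "y = T i j a" "is_root i j" "S i j" "a \<in> entries J Del i j"
    by (auto simp: root_generators_def)
  then show "commutator x y \<in> product_closure"
    using commutator_in_product [OF I J product_level multiplies_into_prod [OF I J]] assms(3)
      elementary_product_in_closure by blast
qed

text \<open>
  Two roots that are neither equal nor opposite are linearly independent, so some functional separates
  them in this way.
\<close>

lemma functional_vanishing_on_root:
  assumes "is_root i j" "is_root h k" "\<not> opposite h k i j" "\<not> opposite h k j i"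
  shows "\<exists>w :: int \<Rightarrow> int. (\<forall>m. w (- m) = - w m) \<and> w i = w j \<and> w h > w k"
proof -
  \<comment> \<open>The coordinate functionals of the root lattice.\<close>
  define e where "e m k = (if k = m then 1 else if k = - m then - 1 else 0 :: int)" for m k :: int
  have nz: "i \<noteq> 0" "j \<noteq> 0" "h \<noteq> 0" "k \<noteq> 0" using assms Omega_nonzero by auto
  have odd: "e m (- k) = - e m k" if "m \<noteq> 0" for m k
    using that unfolding e_def by simp
  have same: "e m m = 1" and off: "k \<noteq> m \<Longrightarrow> k \<noteq> - m \<Longrightarrow> e m k = 0" and le: "k \<noteq> m \<Longrightarrow> e m k \<le> 0" for m k
    unfolding e_def by simp_all
  have hk': "h \<noteq> k" "i \<noteq> j" using assms by auto
  consider "h \<noteq> i" "h \<noteq> - i" "h \<noteq> j" "h \<noteq> - j" | "k \<noteq> i" "k \<noteq> - i" "k \<noteq> j" "k \<noteq> - j"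
    | "h = i \<or> h = - i \<or> h = j \<or> h = - j" "k = i \<or> k = - i \<or> k = j \<or> k = - j"
    by blast
  then show ?thesis
  proof cases
    case 1
    have "e h i = 0" "e h j = 0" using 1 by (auto intro!: off)
    moreover have "e h k < e h h" using le [of k h] hk' same [of h] by simp
    ultimately show ?thesis using odd [OF nz(3)] by (intro exI [of _ "e h"]) auto
  next
    case 2
    have "e k i = 0" "e k j = 0" using 2 by (auto intro!: off)
    moreover have "e k h < e k k" using le [of h k] hk' same [of k] by simp
    ultimately show ?thesis using odd [OF nz(4)] by (intro exI [of _ "\<lambda>m. - e k m"]) auto
  next
    case 3
    have ji: "j \<noteq> - i"
    proof
      assume j: "j = - i"
      then have "h = i \<or> h = - i" "k = i \<or> k = - i" using 3 by auto
      then show False using assms(3,4) hk' j unfolding opposite_def by (elim disjE; simp)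
    qed
    then have "i \<noteq> - j" "- j \<noteq> i" "- i \<noteq> j" by auto
    have ev: "e i i = 1" "e j j = 1" "e i j = 0" "e j i = 0" "e i (- i) = - 1" "e j (- j) = - 1"
      "e i (- j) = 0" "e j (- i) = 0"
      using \<open>j \<noteq> - i\<close> \<open>i \<noteq> - j\<close> \<open>- j \<noteq> i\<close> \<open>- i \<noteq> j\<close> hk'(2) nz(1,2) unfolding e_def by simp_all
    have "(h = i \<or> h = j) \<and> (k = - i \<or> k = - j) \<or> (h = - i \<or> h = - j) \<and> (k = i \<or> k = j)"
      using 3 assms(3,4) hk'(1) unfolding opposite_def by (elim disjE; simp)
    then consider "h = i \<or> h = j" "k = - i \<or> k = - j" | "h = - i \<or> h = - j" "k = i \<or> k = j"
      by blast
    then show ?thesis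
    proof cases
      case 1
      then have "e i k + e j k < e i h + e j h" using ev by (elim disjE; simp)
      then show ?thesis using ev odd [OF nz(1)] odd [OF nz(2)]
        by (intro exI [of _ "\<lambda>m. e i m + e j m"]) auto
    next
      case 2
      then have "e i h + e j h < e i k + e j k" using ev by (elim disjE; simp)
      then show ?thesis using ev odd [OF nz(1)] odd [OF nz(2)]
        by (intro exI [of _ "\<lambda>m. - e i m - e j m"]) auto
    qed
  qed
qed

text \<open>
  Choose a functional that vanishes on \<open>\<alpha> = (i, j)\<close> and is positive on \<open>\<gamma> = (h, k)\<close>. Commutators of
  \<open>\<gamma>\<close>-elements with \<open>\<plusminus>\<alpha>\<close>-elements have positive weight, and elements of positive weight of one level
  commute modulo \<open>product_closure\<close> with elements of nonnegative weight of the other.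
\<close>

lemma other_root_centralizes:
  assumes r: "is_root i j" and a: "a \<in> entries I Gam i j" and b: "b \<in> entries J Del j i"
    and hk: "is_root h k" "\<not> opposite h k i j" "\<not> opposite h k j i" and c: "c \<in> entries UNIV Lam h k"
  shows "commutator (T h k c) (commutator (T i j a) (T j i b)) \<in> product_closure"
proof -
  obtain w :: "int \<Rightarrow> int" where "(\<forall>m. w (- m) = - w m) \<and> w i = w j \<and> w h > w k"
    using functional_vanishing_on_root [OF r hk] ..
  then have odd: "w (- m) = - w m" and w: "w i = w j" "w h > w k" for m by auto
  let ?P = "\<lambda>p q. w p - w q > 0" and ?Z = "\<lambda>p q. w p - w q \<ge> 0"
  have ji: "is_root j i" using r by auto
  have nz: "i \<noteq> 0" "j \<noteq> 0" using r Omega_nonzero by auto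
  have opp: "w p - w q = - (w t - w u)" if "opposite p q t u" for p q t u
    using that odd by (auto simp: opposite_def)
  have PZ: "commutator x y \<in> product_closure" if "x \<in> root_group I Gam ?P" "y \<in> root_group J Del ?Z" for x y
    using that by (rule commutator_not_opposite_mod) (auto dest: opp)
  have ZP: "commutator x y \<in> product_closure" if "x \<in> root_group I Gam ?Z" "y \<in> root_group J Del ?P" for x y
    using that by (rule commutator_not_opposite_mod) (auto dest: opp)
  have weight: "combinations_satisfy w h k i j ?P" "combinations_satisfy w h k j i ?P"
    using w by (auto simp: combinations_satisfy_def)
  have fI: "commutator (T h k c) (T i j a) \<in> root_group I Gam ?P" if "a \<in> entries I Gam i j" for a
    by (rule root_commutator [where w = w, OF odd level_whole I I multiplies_into_whole [OF I] hk(1) r hk(2) c that weight(1)])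
  have fJ: "commutator (T h k c) (T j i b) \<in> root_group J Del ?P" if "b \<in> entries J Del j i" for b
    by (rule root_commutator [where w = w, OF odd level_whole J J multiplies_into_whole [OF J] hk(1) ji hk(3) c that weight(2)])
  have carr: "T h k c \<in> carrier G" "T i j a \<in> carrier G" "T j i b \<in> carrier G"
    using hk c r a b T_in [OF level_whole] T_in [OF I] T_in [OF J] by auto
  have inv_eqs: "inv (T i j a) = T i j (- a)" "inv (T j i b) = T j i (- b)"
    using r ji a b nz T_uminus entries_in_whole [OF I] entries_in_whole [OF J] by auto
  have mem: "- a \<in> entries I Gam i j" "- b \<in> entries J Del j i"
    using a b nz entries_uminus [OF I] entries_uminus [OF J] by auto
  have fI': "commutator (inv (T i j a)) (T h k c) \<in> root_group I Gam ?P"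
    using subgroup.m_inv_closed [OF root_group_subgroup [OF I] fI [OF mem(1)]] carr
    by (simp add: inv_eqs [symmetric] inv_commutator)
  have fJ': "commutator (inv (T j i b)) (T h k c) \<in> root_group J Del ?P"
    using subgroup.m_inv_closed [OF root_group_subgroup [OF J] fJ [OF mem(2)]] carr
    by (simp add: inv_eqs [symmetric] inv_commutator)
  have x: "T i j a \<in> root_group I Gam ?Z" and z: "T j i b \<in> root_group J Del ?Z"
    using r a b w by (auto intro!: root_groupI)
  have PZ_J: "y \<in> root_group J Del ?Z" if "y \<in> root_group J Del ?P" for y
    using that root_group_mono [OF J, of ?P ?Z] by auto
  show ?thesis
    by (rule commutator_centralized_mod [OF product_closure_normal carr])
      (intro PZ ZP fI [OF a] fJ [OF b] fI' fJ' x z PZ_J)+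
qed

text \<open>
  A third index makes every root a sum of two roots, or of a long root and twice a short one, that are
  different from \<open>\<plusminus>\<alpha>\<close>.
\<close>

lemma generated_without_root:
  assumes C: "subgroup C G"
    and other: "\<And>h k c. \<lbrakk>is_root h k; \<not> opposite h k i j; \<not> opposite h k j i; c \<in> entries UNIV Lam h k\<rbrakk> \<Longrightarrow> T h k c \<in> C"
  shows "carrier G \<subseteq> C"
  unfolding carrier_eq
proof (rule root_group_subset [OF C])
  have comm: "commutator x y \<in> C" if "x \<in> C" "y \<in> C" for x y
    using that C by (simp add: commutator_def subgroup.m_closed subgroup.m_inv_closed)
  fix p q c assume r: "is_root p q" and c: "c \<in> entries UNIV Lam p q"
  show "T p q c \<in> C"
  proof (cases "opposite p q i j \<or> opposite p q j i")
    case False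
    then show ?thesis using other r c by auto
  next
    case True
    obtain h where h: "h \<in> Omega n" "h \<noteq> p" "h \<noteq> - p" "h \<noteq> q" "h \<noteq> - q"
      using third_index [OF rank, of 1 p q] by auto
    have in_C: "T p h x \<in> C" "T h q x \<in> C" "T (- h) q x \<in> C" for x
      using h r True by (auto intro!: other simp: opposite_def entries_short)
    show ?thesis
    proof (cases "q = - p")
      case False
      then have "p \<noteq> - q" by auto
      then show ?thesis using short_root_split [OF r _ h, of 1 c] comm in_C by simp
    next
      case True': True
      then have p: "p = - q" by simp
      then have c': "c \<in> entries UNIV Lam (- q) q" using c by simp
      obtain \<xi> where \<xi>: "\<xi> \<in> entries UNIV Lam h (- h)"
        "T (- q) q c = inv (T h q \<xi>) \<otimes> commutator (T h (- h) \<xi>) (T (- h) q 1)"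
        using long_root_split [OF level_whole _ _ _ _ c', of h] h r by auto
      have "T h (- h) \<xi> \<in> C"
        using h r True p \<xi>(1) Omega_nonzero [of h n] by (intro other) (auto simp: opposite_def)
      then show ?thesis
        using \<xi>(2) p comm in_C subgroup.m_closed [OF C] subgroup.m_inv_closed [OF C] by auto
    qed
  qed
qed

lemma opposite_commutator_central:
  assumes r: "is_root i j" and a: "a \<in> entries I Gam i j" and b: "b \<in> entries J Del j i"
    and e: "e \<in> carrier G"
  shows "commutator (commutator (T i j a) (T j i b)) e \<in> product_closure"
proof -
  let ?y = "commutator (T i j a) (T j i b)"
  have y: "?y \<in> carrier G" using r a b T_in [OF I] T_in [OF J] by auto
  have "carrier G \<subseteq> {g \<in> carrier G. \<forall>s\<in>{?y}. commutator g s \<in> product_closure}"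
  proof (rule generated_without_root)
    show "subgroup {g \<in> carrier G. \<forall>s\<in>{?y}. commutator g s \<in> product_closure} G"
      using y by (intro subgroup_centralizer_mod product_closure_normal) auto
    fix h k c
    assume "is_root h k" "\<not> opposite h k i j" "\<not> opposite h k j i" "c \<in> entries UNIV Lam h k"
    then show "T h k c \<in> {g \<in> carrier G. \<forall>s\<in>{?y}. commutator g s \<in> product_closure}"
      using other_root_centralizes [OF r a b] T_in [OF level_whole] by auto
  qed
  then have "commutator e ?y \<in> product_closure" using e by auto
  then show ?thesis
    using inv_commutator [OF e y] subgroup.m_inv_closed [OF normal_imp_subgroup [OF product_closure_normal]] by metis
qed

text \<open>
  The elements that are central modulo \<open>product_closure\<close> form a normal subgroup, so it suffices that
  it contains the commutators of generators.
\<close>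

lemma mixed_central_mod_product:
  assumes "x \<in> H" "e \<in> carrier G"
  shows "commutator x e \<in> product_closure"
proof -
  let ?Z = "{z \<in> carrier G. \<forall>e\<in>carrier G. commutator z e \<in> product_closure}"
  have Z: "?Z \<lhd> G" by (rule normal_central_mod [OF product_closure_normal])
  have NZ: "x \<in> ?Z" if "x \<in> product_closure" for x
  proof -
    have sub: "subgroup product_closure G" using product_closure_normal by (rule normal_imp_subgroup)
    have xc: "x \<in> carrier G" using that sub subgroup.subset by auto
    have "commutator x e \<in> product_closure" if "e \<in> carrier G" for e
      using xc that \<open>x \<in> product_closure\<close> sub conj_by_in_normal [OF product_closure_normal that]
      by (simp add: commutator_eq_mult_conj_by subgroup.m_closed subgroup.m_inv_closed)
    then show ?thesis using xc by auto
  qed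
  have "H \<subseteq> ?Z"
  proof (rule mixed_commutator_le [OF normal_imp_subgroup [OF Z]])
    fix x y assume "x \<in> elementary I Gam" "y \<in> elementary J Del"
    then show "commutator x y \<in> ?Z"
      unfolding root_group_def
    proof (rule commutator_generate_mod [OF Z root_generators_closed [OF I] root_generators_closed [OF J], rotated])
      fix x y assume "x \<in> root_generators I Gam (\<lambda>i j. True)" "y \<in> root_generators J Del (\<lambda>i j. True)"
      then obtain h k a i j b where xy: "x = T h k a" "is_root h k" "a \<in> entries I Gam h k"
        "y = T i j b" "is_root i j" "b \<in> entries J Del i j"
        by (auto simp: root_generators_def)
      show "commutator x y \<in> ?Z"
      proof (cases "opposite h k i j")
        case False
        then show ?thesis
          using commutator_in_product [OF I J product_level multiplies_into_prod [OF I J]] xy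
            elementary_product_in_closure NZ by blast
      next
        case True
        have nz: "i \<noteq> 0" "j \<noteq> 0" using xy Omega_nonzero by auto
        have "\<exists>b'\<in>entries J Del k h. y = T k h b'"
        proof (cases "h = j \<and> k = i")
          case False
          then have "h = - i" "k = - j" using True by (auto simp: opposite_def)
          then show ?thesis
            using T_flip [of i j b] entries_flip [OF J _ xy(6)] entries_in_whole [OF J _ xy(6)] xy nz by auto
        qed (use xy in auto)
        then obtain b' where b': "b' \<in> entries J Del k h" "y = T k h b'" by blast
        then show ?thesis
          using opposite_commutator_central [OF xy(2,3) b'(1)] xy T_in [OF I xy(2,3)] T_in [OF J _ b'(1)] by auto
      qed
    qed
  qed
  then show ?thesis using assms by auto
qed

lemma mixed_commutator_normal: "H \<lhd> G"
proof -
  have "conj_by e x \<in> H" if "e \<in> carrier G" "x \<in> H" for e x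
  proof -
    have xc: "x \<in> carrier G" using that mixed_subgroup subgroup.subset by auto
    have "commutator e x \<in> product_closure"
      using inv_commutator [OF xc that(1)] mixed_central_mod_product [OF that(2,1)]
        subgroup.m_inv_closed [OF normal_imp_subgroup [OF product_closure_normal]] by metis
    then show ?thesis
      using that xc product_closure_in_mixed subgroup.m_closed [OF mixed_subgroup] by (auto simp: conj_by_eq_commutator_mult)
  qed
  then show ?thesis using mixed_subgroup normal_inv_iff by (simp add: conj_by_def)
qed

subsection \<open>Relative elementary subgroups commute modulo the mixed commutator\<close>

text \<open>
  Describe the normal closure of one level by conjugates of the radical of sign \<open>-1\<close> and that of the
  other by conjugates of the radical of sign \<open>1\<close>. After one conjugation, a commutator of generators is
  \<open>[w u' w\<^sup>-\<^sup>1, u]\<close> with \<open>w\<close> and \<open>u\<close> in the same abelian radical, which is \<open>w [u', u] w\<^sup>-\<^sup>1\<close>.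
\<close>

lemma relative_commutator_in_mixed:
  assumes x: "x \<in> normal_closure G (elementary I Gam)" and y: "y \<in> normal_closure G (elementary J Del)"
  shows "commutator x y \<in> H"
proof -
  let ?E = "generate G (unipotent_conjugates (- 1) I Gam)"
  have E: "?E \<lhd> G" by (rule unipotent_conjugates_normal [OF _ I]) simp
  have E_closed: "?E \<subseteq> carrier G" using normal_imp_subgroup [OF E] subgroup.subset by auto
  have x': "x \<in> ?E" using x normal_closure_elementary_subset [OF _ I, of "- 1"] by auto
  have y': "y \<in> generate G (unipotent_conjugates 1 J Del)"
    using y normal_closure_elementary_subset [OF _ J, of 1] by auto
  have Uc: "unipotent 1 J Del \<subseteq> carrier G" using unipotent_closed [OF J] by auto
  have radical: "commutator z u \<in> H" if z: "z \<in> ?E" and u: "u \<in> unipotent 1 J Del" for z u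
  proof (rule commutator_generate_mod [OF mixed_commutator_normal _ Uc _ z generate.incl [OF u]])
    show "unipotent_conjugates (- 1) I Gam \<subseteq> carrier G" by (rule unipotent_conjugates_closed [OF _ I]) simp
    fix s u assume "s \<in> unipotent_conjugates (- 1) I Gam" and u: "u \<in> unipotent 1 J Del"
    then obtain w v where s: "s = conj_by w v" "w \<in> unipotent 1 UNIV Lam" "v \<in> unipotent (- 1) I Gam"
      by (auto simp: unipotent_conjugates_def)
    have carr: "w \<in> carrier G" "v \<in> carrier G" "u \<in> carrier G"
      using s u unipotent_closed [OF level_whole] unipotent_closed [OF I] unipotent_closed [OF J] by auto
    have "conj_by w u = u"
      using unipotent_commute [of 1 w u] s u unipotent_whole [OF J] carr by (auto simp: conj_by_eq_self_iff)
    then have "commutator s u = conj_by w (commutator v u)"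
      using s carr by (simp add: conj_by_commutator)
    moreover have "commutator v u \<in> H"
      using s u unipotent_elementary [OF I] unipotent_elementary [OF J] by (intro commutator_in_mixed) auto
    ultimately show "commutator s u \<in> H" using conj_by_in_normal [OF mixed_commutator_normal] carr by simp
  qed
  show ?thesis
  proof (rule commutator_generate_mod [OF mixed_commutator_normal E_closed _ _ generate.incl [OF x'] y'])
    show "unipotent_conjugates 1 J Del \<subseteq> carrier G" by (rule unipotent_conjugates_closed [OF _ J]) simp
    fix z t assume z: "z \<in> ?E" and "t \<in> unipotent_conjugates 1 J Del"
    then obtain v u where t: "t = conj_by v u" "v \<in> unipotent (- 1) UNIV Lam" "u \<in> unipotent 1 J Del"
      by (auto simp: unipotent_conjugates_def)
    have carr: "z \<in> carrier G" "v \<in> carrier G" "u \<in> carrier G"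
      using z t E_closed Uc unipotent_closed [OF level_whole] by auto
    have "commutator z t = conj_by v (commutator (conj_by (inv v) z) u)"
      using t carr by (simp add: group_word_simps)
    moreover have "conj_by (inv v) z \<in> ?E" using conj_by_in_normal [OF E _ z] carr by auto
    ultimately show "commutator z t \<in> H" using radical t carr conj_by_in_normal [OF mixed_commutator_normal] by simp
  qed
qed

lemma mixed_commutator_relative:
  "H = mixed_commutator G (normal_closure G (elementary I Gam)) (normal_closure G (elementary J Del))"
proof
  show "H \<subseteq> mixed_commutator G (normal_closure G (elementary I Gam)) (normal_closure G (elementary J Del))"
    by (rule mixed_commutator_mono [OF is_group]) (auto simp: normal_closure_def)
  show "mixed_commutator G (normal_closure G (elementary I Gam)) (normal_closure G (elementary J Del)) \<subseteq> H"
    by (rule mixed_commutator_le [OF mixed_subgroup relative_commutator_in_mixed])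
qed

end

end

section \<open>Transvections satisfy the unitary Steinberg relations\<close>

lemma pos_less: "i \<in> Omega n \<Longrightarrow> pos n i < 2 * n"
  by (auto simp: Omega_def pos_def)

lemma pos_inject: "i \<in> Omega n \<Longrightarrow> j \<in> Omega n \<Longrightarrow> pos n i = pos n j \<longleftrightarrow> i = j"
  by (auto simp: Omega_def pos_def split: if_splits)

lemma pos_surj:
  assumes "r < 2 * n"
  obtains i where "i \<in> Omega n" "r = pos n i"
proof (cases "r < n")
  case True
  then show ?thesis by (intro that [of "int r + 1"]) (auto simp: Omega_def pos_def)
next
  case False
  then show ?thesis using assms by (intro that [of "int r - 2 * int n"]) (auto simp: Omega_def pos_def)
qed

lemma left_one_mat:
  fixes M :: "'a::{ring,monoid_mult} mat"
  assumes "M \<in> carrier_mat m m"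
  shows "1\<^sub>m m * M = M"
proof (rule eq_matI)
  fix i j assume "i < dim_row M" "j < dim_col M"
  then have "(1\<^sub>m m * M) $$ (i, j) = (\<Sum>k = 0..<m. 1\<^sub>m m $$ (i, k) * M $$ (k, j))"
    using assms by (simp add: scalar_prod_def)
  also have "\<dots> = (\<Sum>k = 0..<m. (if k = i then M $$ (k, j) else 0))"
    using assms \<open>i < dim_row M\<close> by (intro sum.cong) auto
  also have "\<dots> = M $$ (i, j)" using assms \<open>i < dim_row M\<close> by (simp add: sum.delta)
  finally show "(1\<^sub>m m * M) $$ (i, j) = M $$ (i, j)" .
qed (use assms in auto)

lemma right_one_mat:
  fixes M :: "'a::{ring,monoid_mult} mat"
  assumes "M \<in> carrier_mat m m"
  shows "M * 1\<^sub>m m = M"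
proof (rule eq_matI)
  fix i j assume "i < dim_row M" "j < dim_col M"
  then have "(M * 1\<^sub>m m) $$ (i, j) = (\<Sum>k = 0..<m. M $$ (i, k) * 1\<^sub>m m $$ (k, j))"
    using assms by (simp add: scalar_prod_def)
  also have "\<dots> = (\<Sum>k = 0..<m. (if k = j then M $$ (i, k) else 0))"
    using assms \<open>j < dim_col M\<close> by (intro sum.cong) auto
  also have "\<dots> = M $$ (i, j)" using assms \<open>j < dim_col M\<close> by (simp add: sum.delta)
  finally show "(M * 1\<^sub>m m) $$ (i, j) = M $$ (i, j)" .
qed (use assms in auto)

abbreviation mat_monoid :: "nat \<Rightarrow> 'a::{ring,monoid_mult} mat monoid" where
  "mat_monoid n \<equiv> \<lparr>carrier = carrier_mat (2 * n) (2 * n), mult = (*), one = 1\<^sub>m (2 * n)\<rparr>"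

lemma monoid_mat_monoid: "monoid (mat_monoid n)"
  by (rule monoidI) (auto simp: assoc_mult_mat left_one_mat right_one_mat)

lemma GL_group: "group (GL n)"
  unfolding GL_def by (rule monoid.units_group [OF monoid_mat_monoid])

lemma GL_mult: "x \<otimes>\<^bsub>GL n\<^esub> y = x * y"
  by (simp add: GL_def units_of_def)

context form_ring
begin

text \<open>
  Multiplication by a transvection from the left is a row operation. On a single column, indexed by
  signed indices, it acts as follows.
\<close>

definition row_op :: "int \<times> int \<times> 'a \<Rightarrow> (int \<Rightarrow> 'a) \<Rightarrow> int \<Rightarrow> 'a" where
  "row_op = (\<lambda>(i, j, c) v p. v p + (if p = i then c * v j else 0)
     - (if p = - j \<and> j \<noteq> - i then twist i j c * v (- i) else 0))"

definition transv :: "nat \<Rightarrow> int \<times> int \<times> 'a \<Rightarrow> 'a mat" where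
  "transv n = (\<lambda>(i, j, c). transvection bar lam n i j c)"

definition index_ok :: "nat \<Rightarrow> int \<times> int \<times> 'a \<Rightarrow> bool" where
  "index_ok n = (\<lambda>(i, j, c). i \<in> Omega n \<and> j \<in> Omega n \<and> i \<noteq> j)"

lemma transv_carrier [simp]: "transv n t \<in> carrier_mat (2 * n) (2 * n)"
  by (auto simp: transv_def transvection_def mat_unit_def split: prod.split)

lemma lam_pow_twist:
  assumes "i \<noteq> 0" "j \<noteq> 0"
  shows "lam_pow bar lam ((sgn j - sgn i) div 2) * bar c = twist i j c"
  using assms by (auto simp: lam_pow_def twist_def lam_at_def sgn_if mult.assoc)

lemma transv_entry:
  assumes "i \<in> Omega n" "j \<in> Omega n" "r < 2 * n" "k < 2 * n"
  shows "transv n (i, j, c) $$ (r, k) = (if k = r then 1 else 0)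
    + (if k = pos n j then if r = pos n i then c else 0 else 0)
    - (if k = pos n (- i) then if r = pos n (- j) \<and> j \<noteq> - i then twist i j c else 0 else 0)"
proof -
  have nz: "i \<noteq> 0" "j \<noteq> 0" using assms Omega_nonzero by auto
  show ?thesis
    using assms by (auto simp: transv_def transvection_def mat_unit_def lam_pow_twist [OF nz])
qed

lemma transv_mult_entry:
  assumes t: "index_ok n t" and M: "M \<in> carrier_mat (2 * n) (2 * n)" and p: "p \<in> Omega n" and s: "s < 2 * n"
  shows "(transv n t * M) $$ (pos n p, s) = row_op t (\<lambda>q. M $$ (pos n q, s)) p"
proof -
  obtain i j c where ijc: "t = (i, j, c)" "i \<in> Omega n" "j \<in> Omega n" "i \<noteq> j"
    using t by (auto simp: index_ok_def)
  let ?a = "if pos n p = pos n i then c else 0"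
  let ?b = "if pos n p = pos n (- j) \<and> j \<noteq> - i then twist i j c else 0"
  have "(transv n t * M) $$ (pos n p, s) = (\<Sum>k = 0..<2 * n. transv n t $$ (pos n p, k) * M $$ (k, s))"
    using M s pos_less [OF p] carrier_matD [OF transv_carrier, of n t] by (simp add: scalar_prod_def)
  also have "\<dots> = (\<Sum>k = 0..<2 * n. (if k = pos n p then M $$ (k, s) else 0)
      + (if k = pos n j then ?a * M $$ (k, s) else 0) - (if k = pos n (- i) then ?b * M $$ (k, s) else 0))"
    using ijc p pos_less [OF p] by (intro sum.cong) (auto simp: transv_entry distrib_right left_diff_distrib)
  also have "\<dots> = M $$ (pos n p, s) + ?a * M $$ (pos n j, s) - ?b * M $$ (pos n (- i), s)"
    using ijc p pos_less [of _ n] by (simp add: sum.distrib sum_subtractf sum.delta)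
  also have "\<dots> = row_op t (\<lambda>q. M $$ (pos n q, s)) p"
    using ijc p by (auto simp: row_op_def pos_inject)
  finally show ?thesis .
qed

text \<open>
  A product of transvections acts on columns by the composed row operations. Applied to the columns of
  the identity matrix, this reduces relations between transvections to pointwise identities between
  functions.
\<close>

definition word_mat :: "nat \<Rightarrow> (int \<times> int \<times> 'a) list \<Rightarrow> 'a mat" where
  "word_mat n ts = foldr (\<lambda>t M. transv n t * M) ts (1\<^sub>m (2 * n))"

lemma word_mat_simps [simp]:
  "word_mat n [] = 1\<^sub>m (2 * n)" "word_mat n (t # ts) = transv n t * word_mat n ts"
  by (simp_all add: word_mat_def)

lemma word_mat_carrier [simp]: "word_mat n ts \<in> carrier_mat (2 * n) (2 * n)"
  by (induction ts) (auto intro: mult_carrier_mat [OF transv_carrier])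

lemma word_mat_dim [simp]: "dim_row (word_mat n ts) = 2 * n" "dim_col (word_mat n ts) = 2 * n"
  using carrier_matD [OF word_mat_carrier] by auto

lemma row_op_cong:
  assumes "index_ok n t" "p \<in> Omega n" "\<And>q. q \<in> Omega n \<Longrightarrow> v q = v' q"
  shows "row_op t v p = row_op t v' p"
  using assms by (auto simp: index_ok_def row_op_def split: prod.splits)

lemma word_mat_entry:
  assumes "list_all (index_ok n) ts" "p \<in> Omega n" "s < 2 * n"
  shows "word_mat n ts $$ (pos n p, s) = foldr row_op ts (\<lambda>q. 1\<^sub>m (2 * n) $$ (pos n q, s)) p"
  using assms
proof (induction ts arbitrary: p)
  case (Cons t ts)
  then have t: "index_ok n t" by simp
  have "word_mat n (t # ts) $$ (pos n p, s) = row_op t (\<lambda>q. word_mat n ts $$ (pos n q, s)) p"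
    using transv_mult_entry [OF t word_mat_carrier Cons.prems(2,3)] by simp
  also have "\<dots> = row_op t (foldr row_op ts (\<lambda>q. 1\<^sub>m (2 * n) $$ (pos n q, s))) p"
    by (rule row_op_cong [OF t Cons.prems(2)]) (use Cons in auto)
  finally show ?case by simp
qed simp

lemma word_mat_eqI:
  assumes "list_all (index_ok n) ts" "list_all (index_ok n) us"
    and "\<And>v p. foldr row_op ts v p = foldr row_op us v p"
  shows "word_mat n ts = word_mat n us"
proof (rule eq_matI)
  fix r s assume "r < dim_row (word_mat n us)" "s < dim_col (word_mat n us)"
  then have rs: "r < 2 * n" "s < 2 * n" by auto
  then obtain p where "p \<in> Omega n" "r = pos n p" using pos_surj by blast
  then show "word_mat n ts $$ (r, s) = word_mat n us $$ (r, s)"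
    using rs assms by (simp add: word_mat_entry)
qed auto

lemma transv_word: "transv n t = word_mat n [t]"
  using right_one_mat [OF transv_carrier] by simp

subsection \<open>Relations between row operations\<close>

lemma row_op_apply:
  "row_op (i, j, c) v p = v p + (if p = i then c * v j else 0)
     - (if p = - j \<and> j \<noteq> - i then twist i j c * v (- i) else 0)"
  by (simp add: row_op_def)

lemma row_op_add:
  assumes "i \<noteq> j" "i \<noteq> 0" "j \<noteq> 0"
  shows "row_op (i, j, a + b) v p = row_op (i, j, a) (row_op (i, j, b) v) p"
proof (cases "j = - i")
  case False
  then have "i \<noteq> - j" "- i \<noteq> j" "j \<noteq> i" "- j \<noteq> i" using assms by auto
  then show ?thesis using assms False by (simp add: row_op_apply twist_add distrib_right)
qed (use assms in \<open>simp add: row_op_apply distrib_right\<close>)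

lemma row_op_flip:
  assumes "i \<noteq> j" "i \<noteq> 0" "j \<noteq> 0" "j \<noteq> - i"
  shows "row_op (i, j, a) v p = row_op (- j, - i, - twist i j a) v p"
  using assms by (auto simp: row_op_apply twist_twist)

text \<open>
  A row operation changes only the rows \<open>i\<close> and \<open>-j\<close>. To compare two compositions it is enough to know how
  each operation changes the rows that the next one reads.
\<close>

lemma row_op_unchanged: "p \<noteq> i \<Longrightarrow> p \<noteq> - j \<Longrightarrow> row_op (i, j, c) v p = v p"
  by (simp add: row_op_apply)

lemma row_op_commute:
  assumes "h \<noteq> j" "h \<noteq> - i" "k \<noteq> i" "k \<noteq> - j"
  shows "row_op (i, j, a) (row_op (h, k, b) v) p = row_op (h, k, b) (row_op (i, j, a) v) p"
proof -
  have "j \<noteq> h" "j \<noteq> - k" "- i \<noteq> h" "- i \<noteq> - k" "k \<noteq> - j" "- h \<noteq> i" "- h \<noteq> - j" using assms by auto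
  then have "row_op (h, k, b) v j = v j" "row_op (h, k, b) v (- i) = v (- i)"
    "row_op (i, j, a) v k = v k" "row_op (i, j, a) v (- h) = v (- h)"
    using assms by (simp_all only: row_op_unchanged not_False_eq_True)
  then show ?thesis
    by (simp only: row_op_apply [of i j a "row_op (h, k, b) v"] row_op_apply [of h k b "row_op (i, j, a) v"])
      (simp only: row_op_apply diff_conv_add_uminus add_ac)
qed

lemma row_op_short:
  assumes "i \<noteq> 0" "j \<noteq> 0" "h \<noteq> 0" "i \<noteq> j" "i \<noteq> - j" "h \<noteq> j" "h \<noteq> - j" "i \<noteq> h" "i \<noteq> - h"
  shows "row_op (i, j, a) (row_op (j, h, b) v) p
    = row_op (i, h, a * b) (row_op (j, h, b) (row_op (i, j, a) v)) p"
proof -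
  have ne: "j \<noteq> i" "- j \<noteq> i" "j \<noteq> - i" "- i \<noteq> j" "j \<noteq> h" "- h \<noteq> j" "j \<noteq> - h" "- j \<noteq> h"
    "h \<noteq> i" "- h \<noteq> i" "h \<noteq> - i" "- i \<noteq> h" "- i \<noteq> - j" "- i \<noteq> - h" "- j \<noteq> - h"
    using assms by auto
  have tw: "twist i h (a * b) = twist j h b * twist i j a" by (rule twist_mult)
  consider "p = i" | "p = - j" | "p = j" | "p = - h" | "p \<noteq> i" "p \<noteq> - j" "p \<noteq> j" "p \<noteq> - h" by blast
  then show ?thesis
    by cases (use assms ne in \<open>simp_all add: row_op_apply tw algebra_simps\<close>)
qed

lemma row_op_short_long:
  assumes "i \<noteq> 0" "j \<noteq> 0" "i \<noteq> j" "i \<noteq> - j"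
  shows "row_op (i, j, a) (row_op (j, - i, b) v) p
    = row_op (i, - i, a * b - twist i (- i) (a * b)) (row_op (j, - i, b) (row_op (i, j, a) v)) p"
proof -
  have ne: "j \<noteq> i" "- j \<noteq> i" "j \<noteq> - i" "- i \<noteq> j" "- i \<noteq> - j" using assms by auto
  have tw: "twist i (- i) (a * b) = twist j (- i) b * twist i j a" by (rule twist_mult)
  consider "p = i" | "p = - j" | "p = j" | "p = - i" | "p \<noteq> i" "p \<noteq> - j" "p \<noteq> j" "p \<noteq> - i" by blast
  then show ?thesis
    by cases (use assms ne in \<open>simp_all add: row_op_apply tw algebra_simps\<close>)
qed

lemma row_op_long_short:
  assumes "i \<noteq> 0" "j \<noteq> 0" "i \<noteq> j" "i \<noteq> - j" "twist i (- i) a = - a"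
  shows "row_op (i, - i, a) (row_op (- i, j, b) v) p
    = row_op (i, j, a * b) (row_op (- j, j, - twist (- i) j b * a * b)
        (row_op (- i, j, b) (row_op (i, - i, a) v))) p"
proof -
  have ne: "j \<noteq> i" "- j \<noteq> i" "j \<noteq> - i" "- i \<noteq> j" "- i \<noteq> - j" using assms by auto
  have tw: "twist i j (a * b) = - (twist (- i) j b * a)"
    using twist_mult [of i j a b "- i"] assms by simp
  consider "p = i" | "p = - j" | "p = j" | "p = - i" | "p \<noteq> i" "p \<noteq> - j" "p \<noteq> j" "p \<noteq> - i" by blast
  then show ?thesis
    by cases (use assms ne in \<open>simp_all add: row_op_apply tw algebra_simps\<close>)
qed

end

section \<open>The elementary unitary group\<close>

context form_ring
begin

definition elementary_generators :: "nat \<Rightarrow> 'a set \<Rightarrow> 'a set \<Rightarrow> 'a mat set" where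
  "elementary_generators n I Gam = {transvection bar lam n i j c | i j c.
     i \<in> Omega n \<and> j \<in> Omega n \<and> i \<noteq> j \<and> c \<in> entry_set bar lam I Gam i j}"

lemma FU_eq: "FU bar lam n I Gam = generate (GL n) (elementary_generators n I Gam)"
  by (simp add: FU_def elementary_generators_def)

lemma transv_zero:
  assumes "index_ok n (i, j, 0)"
  shows "transv n (i, j, 0) = 1\<^sub>m (2 * n)"
proof -
  have "word_mat n [(i, j, 0)] = word_mat n []"
    using assms by (intro word_mat_eqI) (auto simp: row_op_apply)
  then show ?thesis unfolding transv_word by simp
qed

lemma transv_add:
  assumes "index_ok n (i, j, a)"
  shows "transv n (i, j, a + b) = transv n (i, j, a) * transv n (i, j, b)"
proof -
  have ij: "i \<in> Omega n" "j \<in> Omega n" "i \<noteq> j" using assms by (auto simp: index_ok_def)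
  then have "word_mat n [(i, j, a + b)] = word_mat n [(i, j, a), (i, j, b)]"
    by (intro word_mat_eqI) (auto simp: index_ok_def Omega_nonzero row_op_add)
  then show ?thesis using right_one_mat [OF transv_carrier] by simp
qed

lemma transv_in_GL:
  assumes "index_ok n (i, j, a)"
  shows "transv n (i, j, a) \<in> carrier (GL n)"
proof -
  have ok: "index_ok n (i, j, b)" for b using assms by (simp add: index_ok_def)
  have "transv n (i, j, a) * transv n (i, j, - a) = 1\<^sub>m (2 * n)"
    "transv n (i, j, - a) * transv n (i, j, a) = 1\<^sub>m (2 * n)"
    using transv_add [OF ok, of a "- a"] transv_add [OF ok, of "- a" a] transv_zero [OF ok] by simp_all
  moreover have "transv n (i, j, - a) \<in> carrier_mat (2 * n) (2 * n)" by simp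
  ultimately show ?thesis
    unfolding GL_def units_of_carrier Units_def by auto
qed

lemma elementary_generators_in_GL: "elementary_generators n I Gam \<subseteq> carrier (GL n)"
  using transv_in_GL by (auto simp: elementary_generators_def transv_def index_ok_def)

lemma EU_subgroup: "subgroup (EU bar lam Lam n) (GL n)"
  unfolding EU_def FU_eq
  by (rule group.generate_is_subgroup [OF GL_group elementary_generators_in_GL])

abbreviation EUG :: "nat \<Rightarrow> 'a mat monoid" where
  "EUG n \<equiv> EU_group bar lam Lam n"

lemma EUG_mult: "x \<otimes>\<^bsub>EUG n\<^esub> y = x * y"
  by (simp add: GL_mult)

lemma EU_group: "group (EUG n)"
  using EU_subgroup GL_group by (rule subgroup.subgroup_is_group)

lemma generate_EUG: "S \<subseteq> EU bar lam Lam n \<Longrightarrow> generate (EUG n) S = generate (GL n) S"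
  using EU_subgroup by (intro group.generate_consistent GL_group)

lemma transv_in_EU:
  assumes "index_ok n (i, j, a)" "a \<in> entries UNIV Lam i j"
  shows "transv n (i, j, a) \<in> EU bar lam Lam n"
  using assms unfolding EU_def FU_eq
  by (auto simp: elementary_generators_def transv_def index_ok_def intro!: generate.incl)

lemma EUG_commutatorI:
  assumes "x \<in> EU bar lam Lam n" "y \<in> EU bar lam Lam n" "z \<in> EU bar lam Lam n"
    and "x * y = z * (y * x)"
  shows "group.commutator (EUG n) x y = z"
  using assms by (intro group.commutatorI [OF EU_group]) (auto simp: GL_mult)

text \<open>
  Writing \<open>[x, y] = z\<close> as \<open>x y = z y x\<close> avoids inverse matrices.
\<close>

lemma transv_relation:
  assumes xyz: "transv n x \<in> EU bar lam Lam n" "transv n y \<in> EU bar lam Lam n" "transv n z \<in> EU bar lam Lam n"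
    and ok: "index_ok n x" "index_ok n y" "index_ok n z"
    and eq: "\<And>v p. row_op x (row_op y v) p = row_op z (row_op y (row_op x v)) p"
  shows "group.commutator (EUG n) (transv n x) (transv n y) = transv n z"
proof (rule EUG_commutatorI [OF xyz])
  have "word_mat n [x, y] = word_mat n [z, y, x]"
    using ok eq by (intro word_mat_eqI) auto
  then show "transv n x * transv n y = transv n z * (transv n y * transv n x)"
    using right_one_mat [OF transv_carrier] by simp
qed

lemma unitary_relations_EU:
  assumes "3 \<le> n"
  shows "unitary_relations bar lam Lam (EUG n) n (transvection bar lam n)"
proof -
  note whole = level_whole
  have T: "transvection bar lam n i j c = transv n (i, j, c)" for i j c
    by (simp add: transv_def)
  interpret E: group "EUG n" by (rule EU_group)
  have in_EU: "transv n (i, j, a) \<in> EU bar lam Lam n"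
    if "i \<in> Omega n" "j \<in> Omega n" "i \<noteq> j" "a \<in> entries UNIV Lam i j" for i j a
    using that by (intro transv_in_EU) (auto simp: index_ok_def)
  have in_EU_short: "transv n (i, j, a) \<in> EU bar lam Lam n"
    if "i \<in> Omega n" "j \<in> Omega n" "i \<noteq> j" "j \<noteq> - i" for i j a
    using that by (intro in_EU) (auto simp: entries_short)
  show ?thesis
  proof (unfold_locales, unfold T)
    show "3 \<le> n" by fact
  next
    fix i j a assume "i \<in> Omega n" "j \<in> Omega n" "i \<noteq> j" "a \<in> entries UNIV Lam i j"
    then show "transv n (i, j, a) \<in> carrier (EUG n)" using in_EU by simp
  next
    let ?S = "{transv n (i, j, a) |i j a. i \<in> Omega n \<and> j \<in> Omega n \<and> i \<noteq> j \<and> a \<in> entries UNIV Lam i j}"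
    have S: "?S = elementary_generators n UNIV Lam" by (simp add: elementary_generators_def T)
    have "?S \<subseteq> EU bar lam Lam n" using in_EU by auto
    then show "carrier (EUG n) \<subseteq> generate (EUG n) ?S"
      using generate_EUG [of ?S n] by (simp add: EU_def FU_eq S)
  next
    fix i j a assume *: "i \<in> Omega n" "j \<in> Omega n" "i \<noteq> j" "j \<noteq> - i"
    have "row_op (i, j, a) v p = row_op (- j, - i, - twist i j a) v p" for v p
      using * Omega_nonzero by (intro row_op_flip) auto
    then have "word_mat n [(i, j, a)] = word_mat n [(- j, - i, - twist i j a)]"
      using * by (intro word_mat_eqI) (simp_all add: index_ok_def)
    then show "transv n (i, j, a) = transv n (- j, - i, - twist i j a)" unfolding transv_word .
  next
    fix i j a b assume "i \<in> Omega n" "j \<in> Omega n" "i \<noteq> j"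
    then show "transv n (i, j, a + b) = transv n (i, j, a) \<otimes>\<^bsub>EUG n\<^esub> transv n (i, j, b)"
      using transv_add [of n i j a b] by (simp add: index_ok_def GL_mult)
  next
    fix i j h k a b
    assume *: "i \<in> Omega n" "j \<in> Omega n" "i \<noteq> j" "h \<in> Omega n" "k \<in> Omega n" "h \<noteq> k"
      "h \<noteq> j" "h \<noteq> - i" "k \<noteq> i" "k \<noteq> - j" "a \<in> entries UNIV Lam i j" "b \<in> entries UNIV Lam h k"
    have "word_mat n [(i, j, a), (h, k, b)] = word_mat n [(h, k, b), (i, j, a)]"
      using * row_op_commute [of h j i k a b] by (intro word_mat_eqI) (auto simp: index_ok_def)
    then have "transv n (i, j, a) * transv n (h, k, b) = transv n (h, k, b) * transv n (i, j, a)"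
      using right_one_mat [OF transv_carrier] by simp
    then show "E.commutator (transv n (i, j, a)) (transv n (h, k, b)) = \<one>\<^bsub>EUG n\<^esub>"
      using * by (subst E.commutator_eq_one_iff) (auto simp: in_EU GL_mult)
  next
    fix i j h a b
    assume *: "i \<in> Omega n" "j \<in> Omega n" "h \<in> Omega n" "i \<noteq> j" "i \<noteq> - j" "h \<noteq> j" "h \<noteq> - j" "i \<noteq> h" "i \<noteq> - h"
    then have "j \<noteq> - i" "h \<noteq> - i" by auto
    with * show "E.commutator (transv n (i, j, a)) (transv n (j, h, b)) = transv n (i, h, a * b)"
      by (intro transv_relation in_EU_short row_op_short) (auto simp: index_ok_def Omega_nonzero)
  next
    fix i j a b
    assume *: "i \<in> Omega n" "j \<in> Omega n" "i \<noteq> j" "i \<noteq> - j"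
    then have "j \<noteq> - i" "- i \<noteq> - j" "i \<noteq> 0" "j \<noteq> 0" using Omega_nonzero by auto
    moreover from this have "a * b - twist i (- i) (a * b) \<in> entries UNIV Lam i (- i)"
      using symmetrized_in_entries [OF form_symmetrized [OF whole] whole] by auto
    ultimately show "E.commutator (transv n (i, j, a)) (transv n (j, - i, b))
        = transv n (i, - i, a * b - twist i (- i) (a * b))"
      using * by (intro transv_relation in_EU_short in_EU row_op_short_long) (auto simp: index_ok_def)
  next
    fix i j a b
    assume *: "i \<in> Omega n" "j \<in> Omega n" "i \<noteq> j" "i \<noteq> - j" "a \<in> entries UNIV Lam i (- i)"
    then have nz: "j \<noteq> - i" "- i \<noteq> j" "- j \<noteq> i" "i \<noteq> 0" "j \<noteq> 0" using Omega_nonzero by auto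
    have tw: "twist i (- i) a = - a" using twist_long [OF whole] * nz by auto
    have sq: "- twist (- i) j b * a * b \<in> entries UNIV Lam (- j) j"
      using square_in_entries [OF form_conj [OF whole] whole _ _ _ _ whole, where a = b and \<xi> = a and i = "- i" and j = j
          and X = UNIV and \<Xi> = Lam] * nz by auto
    have mem: "transv n (i, - i, a) \<in> EU bar lam Lam n"
        "transv n (- j, j, - twist (- i) j b * a * b) \<in> EU bar lam Lam n"
      using * nz by (intro in_EU sq; simp)+
    have mem': "transv n (- i, j, b) \<in> EU bar lam Lam n" "transv n (i, j, a * b) \<in> EU bar lam Lam n"
      using * nz by (intro in_EU_short; simp)+
    have "word_mat n [(i, - i, a), (- i, j, b)]
        = word_mat n [(i, j, a * b), (- j, j, - twist (- i) j b * a * b), (- i, j, b), (i, - i, a)]"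
      using * nz row_op_long_short [of i j a b, OF _ _ _ _ tw] by (intro word_mat_eqI) (auto simp: index_ok_def)
    then have "transv n (i, - i, a) * transv n (- i, j, b)
        = transv n (i, j, a * b) * (transv n (- j, j, - twist (- i) j b * a * b) * (transv n (- i, j, b) * transv n (i, - i, a)))"
      using right_one_mat [OF transv_carrier] by simp
    also have "\<dots> = (transv n (i, j, a * b) * transv n (- j, j, - twist (- i) j b * a * b)) * (transv n (- i, j, b) * transv n (i, - i, a))"
      by (rule assoc_mult_mat [symmetric]) (auto intro!: mult_carrier_mat transv_carrier)
    finally show "E.commutator (transv n (i, - i, a)) (transv n (- i, j, b))
        = transv n (i, j, a * b) \<otimes>\<^bsub>EUG n\<^esub> transv n (- j, j, - twist (- i) j b * a * b)"
      using mem mem' subgroup.m_closed [OF EU_subgroup mem'(2) mem(2)]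
      unfolding EUG_mult by (simp only: GL_mult) (rule EUG_commutatorI)
  qed
qed

lemma mixed_commutator_EUG:
  assumes "H \<subseteq> EU bar lam Lam n" "K \<subseteq> EU bar lam Lam n"
  shows "mixed_commutator (EUG n) H K = mixed_commutator (GL n) H K"
proof -
  interpret GL: group "GL n :: 'a mat monoid" by (rule GL_group)
  interpret E: group "EUG n" by (rule EU_group)
  have eq: "{x \<otimes>\<^bsub>EUG n\<^esub> y \<otimes>\<^bsub>EUG n\<^esub> inv\<^bsub>EUG n\<^esub> x \<otimes>\<^bsub>EUG n\<^esub> inv\<^bsub>EUG n\<^esub> y | x y. x \<in> H \<and> y \<in> K}
      = {x \<otimes>\<^bsub>GL n\<^esub> y \<otimes>\<^bsub>GL n\<^esub> inv\<^bsub>GL n\<^esub> x \<otimes>\<^bsub>GL n\<^esub> inv\<^bsub>GL n\<^esub> y | x y. x \<in> H \<and> y \<in> K}" (is "?A = ?B")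
  proof (intro Collect_cong ex_cong1)
    fix z x y
    have "inv\<^bsub>EUG n\<^esub> x = inv\<^bsub>GL n\<^esub> x" "inv\<^bsub>EUG n\<^esub> y = inv\<^bsub>GL n\<^esub> y" if "x \<in> H" "y \<in> K"
      using that assms GL.m_inv_consistent [OF EU_subgroup] by auto
    then show "(z = x \<otimes>\<^bsub>EUG n\<^esub> y \<otimes>\<^bsub>EUG n\<^esub> inv\<^bsub>EUG n\<^esub> x \<otimes>\<^bsub>EUG n\<^esub> inv\<^bsub>EUG n\<^esub> y \<and> x \<in> H \<and> y \<in> K)
        = (z = x \<otimes>\<^bsub>GL n\<^esub> y \<otimes>\<^bsub>GL n\<^esub> inv\<^bsub>GL n\<^esub> x \<otimes>\<^bsub>GL n\<^esub> inv\<^bsub>GL n\<^esub> y \<and> x \<in> H \<and> y \<in> K)"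
      by (cases "x \<in> H \<and> y \<in> K") (simp_all add: GL_mult, auto)
  qed
  have "x \<otimes>\<^bsub>EUG n\<^esub> y \<otimes>\<^bsub>EUG n\<^esub> inv\<^bsub>EUG n\<^esub> x \<otimes>\<^bsub>EUG n\<^esub> inv\<^bsub>EUG n\<^esub> y \<in> carrier (EUG n)"
    if "x \<in> H" "y \<in> K" for x y
  proof -
    have "x \<in> carrier (EUG n)" "y \<in> carrier (EUG n)" using that assms by auto
    then show ?thesis by (intro E.m_closed E.inv_closed)
  qed
  then have "?A \<subseteq> EU bar lam Lam n" by auto
  then show ?thesis
    unfolding mixed_commutator_def using generate_EUG [of ?A n] eq by simp
qed

end

theorem theorem2:
  fixes bar :: "'a::{ring,monoid_mult} \<Rightarrow> 'a"
    and lam :: 'a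
    and Lam I Gam J Del :: "'a set"
    and n :: nat
  assumes "form_ring bar lam Lam"
    and "form_ideal bar lam Lam I Gam"
    and "form_ideal bar lam Lam J Del"
    and "n \<ge> 3"
  shows "mixed_commutator (GL n) (FU bar lam n I Gam) (FU bar lam n J Del)
           \<lhd> EU_group bar lam Lam n
         \<and> mixed_commutator (GL n) (FU bar lam n I Gam) (FU bar lam n J Del)
           = mixed_commutator (GL n) (EU_rel bar lam Lam n I Gam) (EU_rel bar lam Lam n J Del)"
proof -
  interpret form_ring bar lam Lam by fact
  interpret unitary_relations bar lam Lam "EUG n" n "transvection bar lam n"
    by (rule unitary_relations_EU) fact
  have gens: "root_generators M \<Upsilon> (\<lambda>i j. True) = elementary_generators n M \<Upsilon>" for M \<Upsilon>
    by (auto simp: root_generators_def elementary_generators_def)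
  have FU: "FU bar lam n M \<Upsilon> = elementary M \<Upsilon>" if "level M \<Upsilon>" for M \<Upsilon>
    using generate_EUG [of "elementary_generators n M \<Upsilon>" n] root_generators_closed [OF that, of "\<lambda>i j. True"]
    by (simp add: FU_eq root_group_def gens)
  have EU_rel: "EU_rel bar lam Lam n M \<Upsilon> = normal_closure (EUG n) (elementary M \<Upsilon>)" if "level M \<Upsilon>" for M \<Upsilon>
    by (simp add: EU_rel_def FU [OF that])
  have closed: "elementary M \<Upsilon> \<subseteq> EU bar lam Lam n" "normal_closure (EUG n) (elementary M \<Upsilon>) \<subseteq> EU bar lam Lam n"
    if "level M \<Upsilon>" for M \<Upsilon>
  proof -
    show "elementary M \<Upsilon> \<subseteq> EU bar lam Lam n" using elementary_closed [OF that] by simp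
    have K: "generate (EUG n) (unipotent_conjugates 1 M \<Upsilon>) \<lhd> EUG n"
      by (rule unipotent_conjugates_normal [OF _ that]) simp
    then have "generate (EUG n) (unipotent_conjugates 1 M \<Upsilon>) \<subseteq> EU bar lam Lam n"
      using subgroup.subset [OF normal_imp_subgroup [OF K]] by simp
    then show "normal_closure (EUG n) (elementary M \<Upsilon>) \<subseteq> EU bar lam Lam n"
      using normal_closure_elementary_subset [OF _ that, of 1] by auto
  qed
  note levels = assms(2,3)
  show ?thesis
    using mixed_commutator_normal [OF levels] mixed_commutator_relative [OF levels] closed [OF levels(1)] closed [OF levels(2)]
    by (simp add: FU [OF levels(1)] FU [OF levels(2)] EU_rel [OF levels(1)] EU_rel [OF levels(2)]
        flip: mixed_commutator_EUG)
qed

end
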